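(* Let $T$ be a finite tree with at least one edge. (i) The discrete Einstein metric on $T$ has positive curvature if and only if $\lambda_{\max}(R_T)<0$. If $\lambda_{\max}(R_T)<0$, then $T$ is a caterpillar. (ii) Let $T=T_m(a)$ be a caterpillar, where $m\ge 1$ and $a=(a_1,\dots,a_m)$ with $a_1,a_m\ge 1$ and $a_i\ge 0$. Then $\lambda_{\max}(R_T)<0$ if and only if one of the following holds: (a) $m=1$; (b) $m=2$ and $(a_1-1)(a_2-1)<4$; (c) $3\le m\le 11$ and there is $b\in\mathcal M_m$ such that $a\le b$ or $\overleftarrow{a}\le b$ coordinatewise, where $\overleftarrow{a}=(a_m,\dots,a_1)$ and the finite lists $\mathcal M_m$ are $\mathcal M_3=\{(1,1,2),(1,3,1),(2,0,4),(1,0,8)\}$; $\mathcal M_4=\{(1,0,2,1),(1,1,0,2),(1,0,0,5),(2,0,0,4)\}$; $\mathcal M_5=\{(1,0,1,0,1),(1,1,0,0,2),(1,0,0,0,4),(2,0,0,0,3)\}$; $\mathcal M_6=\{(1,0,0,1,0,1),(1,1,0,0,0,2),(1,0,0,0,0,4),(2,0,0,0,0,3)\}$; $\mathcal M_7=\{(1,1,0,0,0,0,2),(1,0,0,0,0,0,4),(2,0,0,0,0,0,3)\}$; $\mathcal M_8=\{(1,1,0,0,0,0,0,2),(2,0,0,0,0,0,0,3)\}$; $\mathcal M_9=\{(1,0,0,0,0,0,0,1,1),(2,0,0,0,0,0,0,0,3)\}$; $\mathcal M_{10}=\{(1,0,0,0,0,0,0,0,1,1),(2,0,0,0,0,0,0,0,0,3)\}$;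 $\mathcal M_{11}=\{(1,0,0,0,0,0,0,0,0,1,1),(2,0,0,0,0,0,0,0,0,0,3)\}$; (d) $m\ge 12$ and $a=(a_1,0,\ldots,0,a_m)$ with $1\le a_1,a_m\le 3$ and $(a_1,a_m)\ne(3,3)$. (iii) One has $\lambda_{\max}(R_T)=0$ if and only if one of the following holds: (a) $T=S_3^2$ (up to isomorphism); (b) $T=T_m(a)$ is a caterpillar with $m\ge2$ and $a=(3,0,\ldots,0,3)$; (c) $T=T_m(a)$ is a caterpillar and, up to reversal, $a$ is one of the following nine parameters: $(2,5)$ ($m=2$); $(1,4,1)$ and $(1,0,9)$ ($m=3$); $(1,0,0,6)$ ($m=4$); $(2,0,0,0,4)$ and $(1,0,0,0,5)$ ($m=5$); $(1,0,0,0,0,0,0,4)$ ($m=8$); $(1,1,0,0,0,0,0,0,2)$ ($m=9$); $(1,0,0,0,0,0,0,0,0,0,1,1)$ ($m=12$).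
   Context: Trees are simple, connected, undirected. For a tree $T=(V,E)$, $d_v$ is the degree of $v\in V$; a leaf is a vertex of degree one. **Ricci matrix.** For a finite tree $T=(V,E)$ the Ricci matrix $R_T\in\mathbb R^{E\times E}$ is the real symmetric matrix with $(R_T)_{e,e}=-\left(\frac1{d_x}+\frac1{d_y}\right)$ for $e=\{x,y\}$, and, for distinct edges $e\ne f$, $(R_T)_{e,f}=1/d_z$ if $e\cap f=\{z\}$ and $(R_T)_{e,f}=0$ if $e\cap f=\varnothing$. $\lambda_{\max}(R_T)$ is its largest eigenvalue. **Curvature and discrete Einstein metric.** For positive edge weights $w:E\to\mathbb R_{>0}$ on $T$, put $S_v=\sum_{u\sim v}w_{uv}$. The Lin--Lu--Yau curvature of the edge $xy$ of the weighted tree is $$\kappa_{xy}=-\left(\frac{S_x-2w_{xy}}{d_xw_{xy}}+\frac{S_y-2w_{xy}}{d_yw_{xy}}\right).$$ A discrete Einstein metric on $T$ is a positive weight $w$ for which $\kappa_{xy}$ equals a constant $\kappa$ independent of the edge $xy$; $\kappa$ is called its curvature. Every finite tree with at least one edge has a discrete Einstein metric, unique up to scaling. **Caterpillars.** For $m\ge1$ and $a=(a_1,\dots,a_m)$ with integers $a_i\ge0$ and $a_1,a_m\ge1$, $T_m(a)$ is the tree consisting of a path $v_1,\dots,v_m$ (the spine, of order $m$) with $a_i$ additional leaves attached to $v_i$ for each $i$. For $m=1$ this is the star $S_{a_1}$ with $a_1$ edges (with $S_1=K_2$). A caterpillar is a tree isomorphic to some $T_m(a)$; equivalently, a tree (with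 at least one edge) for which removing all leaves leaves a path, $K_2$ being included as a degenerate case. Reversing $a$ gives an isomorphic tree. $S_3^2$ is the tree obtained from the star with three edges by subdividing each edge once (seven vertices, six edges). $a\le b$ coordinatewise means $a_i\le b_i$ for all $i$. *)

theory Defs
  imports "Jordan_Normal_Form.Spectral_Radius" "HOL-Library.Countable_Set"
begin

text \<open>
  Graphs are given by a vertex set and an edge set, where an edge is the set of its two end points.
\<close>

definition simple_graph :: "'a set \<Rightarrow> 'a set set \<Rightarrow> bool" where
  "simple_graph V E \<longleftrightarrow> (\<forall>e\<in>E. e \<subseteq> V \<and> card e = 2)"

definition connected_graph :: "'a set \<Rightarrow> 'a set set \<Rightarrow> bool" where
  "connected_graph V E \<longleftrightarrow> V \<noteq> {} \<and> (\<forall>u\<in>V. \<forall>v\<in>V. (u, v) \<in> {(x, y). {x, y} \<in> E}\<^sup>*)"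

text \<open>
  A cycle is given by the list of its vertices in cyclic order.
\<close>

definition graph_cycle :: "'a set set \<Rightarrow> 'a list \<Rightarrow> bool" where
  "graph_cycle E vs \<longleftrightarrow> length vs \<ge> 3 \<and> distinct vs \<and>
     (\<forall>i<length vs. {vs ! i, vs ! (Suc i mod length vs)} \<in> E)"

definition finite_tree :: "'a set \<Rightarrow> 'a set set \<Rightarrow> bool" where
  "finite_tree V E \<longleftrightarrow>
     finite V \<and> simple_graph V E \<and> connected_graph V E \<and> (\<nexists>vs. graph_cycle E vs)"

definition graph_iso :: "'a set \<Rightarrow> 'a set set \<Rightarrow> 'b set \<Rightarrow> 'b set set \<Rightarrow> bool" where
  "graph_iso V E V' E' \<longleftrightarrow>
     (\<exists>f. bij_betw f V V' \<and> (\<forall>u\<in>V. \<forall>v\<in>V. {u, v} \<in> E \<longleftrightarrow> {f u, f v} \<in> E'))"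

definition vertex_degree :: "'a set set \<Rightarrow> 'a \<Rightarrow> nat" where
  "vertex_degree E v = card {e \<in> E. v \<in> e}"


text \<open>
  The entries of the Ricci matrix, indexed by pairs of edges. In a simple graph two distinct edges
  share at most one vertex, so the second sum has at most one term and is \<open>0\<close> for disjoint edges.
\<close>

definition ricci_entry :: "'a set set \<Rightarrow> 'a set \<Rightarrow> 'a set \<Rightarrow> real" where
  "ricci_entry E e f =
     (if e = f then - (\<Sum>z\<in>e. 1 / real (vertex_degree E z))
      else (\<Sum>z\<in>e \<inter> f. 1 / real (vertex_degree E z)))"

text \<open>
  Library matrices are indexed by \<open>{0..<n}\<close>, so the edges have to be numbered. For finite \<open>E\<close>,
  \<^const>\<open>from_nat_into\<close> is a bijection from \<open>{..<card E}\<close> onto \<open>E\<close>; the spectrum does not depend on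
  the numbering.
\<close>

definition ricci_matrix :: "'a set set \<Rightarrow> real mat" where
  "ricci_matrix E = mat (card E) (card E)
     (\<lambda>(i, j). ricci_entry E (from_nat_into E i) (from_nat_into E j))"

definition lambda_max :: "real mat \<Rightarrow> real" where
  "lambda_max A = Max (spectrum A)"


definition weight_sum :: "'a set set \<Rightarrow> ('a set \<Rightarrow> real) \<Rightarrow> 'a \<Rightarrow> real" where
  "weight_sum E w v = (\<Sum>e\<in>{e \<in> E. v \<in> e}. w e)"

text \<open>
  The Lin--Lu--Yau curvature of an edge of a weighted tree; the sum ranges over its two end points.
\<close>

definition lly_curvature :: "'a set set \<Rightarrow> ('a set \<Rightarrow> real) \<Rightarrow> 'a set \<Rightarrow> real" where
  "lly_curvature E w e =
     - (\<Sum>x\<in>e. (weight_sum E w x - 2 * w e) / (real (vertex_degree E x) * w e))"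

definition einstein_metric :: "'a set set \<Rightarrow> ('a set \<Rightarrow> real) \<Rightarrow> real \<Rightarrow> bool" where
  "einstein_metric E w \<kappa> \<longleftrightarrow> (\<forall>e\<in>E. w e > 0) \<and> (\<forall>e\<in>E. lly_curvature E w e = \<kappa>)"


text \<open>
  The caterpillar with parameter list \<open>a = [a\<^sub>1, \<dots>, a\<^sub>m]\<close>, where \<open>m = length a\<close>: the spine vertices
  are \<open>(i, 0)\<close> for \<open>i < m\<close> (counted from \<open>0\<close>), and the leaves attached to \<open>(i, 0)\<close> are
  \<open>(i, 1), \<dots>, (i, a ! i)\<close>.
\<close>

definition cat_verts :: "nat list \<Rightarrow> (nat \<times> nat) set" where
  "cat_verts a = {(i, j). i < length a \<and> j \<le> a ! i}"

definition cat_edges :: "nat list \<Rightarrow> (nat \<times> nat) set set" where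
  "cat_edges a = {{(i, 0), (Suc i, 0)} | i. Suc i < length a} \<union>
     {{(i, 0), (i, j)} | i j. i < length a \<and> 1 \<le> j \<and> j \<le> a ! i}"

definition cat_param :: "nat list \<Rightarrow> bool" where
  "cat_param a \<longleftrightarrow> a \<noteq> [] \<and> hd a \<ge> 1 \<and> last a \<ge> 1"

text \<open>\<open>iso_caterpillar V E a\<close> says that \<open>(V, E)\<close> is the caterpillar \<open>T\<^sub>m(a)\<close> up to isomorphism.\<close>

definition iso_caterpillar :: "'a set \<Rightarrow> 'a set set \<Rightarrow> nat list \<Rightarrow> bool" where
  "iso_caterpillar V E a \<longleftrightarrow> cat_param a \<and> graph_iso V E (cat_verts a) (cat_edges a)"

definition is_caterpillar :: "'a set \<Rightarrow> 'a set set \<Rightarrow> bool" where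
  "is_caterpillar V E \<longleftrightarrow> (\<exists>a. iso_caterpillar V E a)"

text \<open>The star with three edges (centre \<open>0\<close>), each edge subdivided once.\<close>

definition S32_verts :: "nat set" where
  "S32_verts = {0, 1, 2, 3, 4, 5, 6}"

definition S32_edges :: "nat set set" where
  "S32_edges = {{0, 1}, {0, 2}, {0, 3}, {1, 4}, {2, 5}, {3, 6}}"


abbreviation coord_le :: "nat list \<Rightarrow> nat list \<Rightarrow> bool" where
  "coord_le a b \<equiv> list_all2 (\<le>) a b"

text \<open>The finite lists \<open>\<M>\<^sub>m\<close> for \<open>3 \<le> m \<le> 11\<close>.\<close>

definition max_params :: "nat \<Rightarrow> nat list set" where
  "max_params m =
    (if m = 3 then {[1,1,2], [1,3,1], [2,0,4], [1,0,8]}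
     else if m = 4 then {[1,0,2,1], [1,1,0,2], [1,0,0,5], [2,0,0,4]}
     else if m = 5 then {[1,0,1,0,1], [1,1,0,0,2], [1,0,0,0,4], [2,0,0,0,3]}
     else if m = 6 then {[1,0,0,1,0,1], [1,1,0,0,0,2], [1,0,0,0,0,4], [2,0,0,0,0,3]}
     else if m = 7 then {[1,1,0,0,0,0,2], [1,0,0,0,0,0,4], [2,0,0,0,0,0,3]}
     else if m = 8 then {[1,1,0,0,0,0,0,2], [2,0,0,0,0,0,0,3]}
     else if m = 9 then {[1,0,0,0,0,0,0,1,1], [2,0,0,0,0,0,0,0,3]}
     else if m = 10 then {[1,0,0,0,0,0,0,0,1,1], [2,0,0,0,0,0,0,0,0,3]}
     else if m = 11 then {[1,0,0,0,0,0,0,0,0,1,1], [2,0,0,0,0,0,0,0,0,0,3]}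
     else {})"

text \<open>The nine sporadic parameters with largest eigenvalue \<open>0\<close>.\<close>

definition zero_params :: "nat list set" where
  "zero_params =
    {[2,5],
     [1,4,1], [1,0,9],
     [1,0,0,6],
     [2,0,0,0,4], [1,0,0,0,5],
     [1,0,0,0,0,0,0,4],
     [1,1,0,0,0,0,0,0,2],
     [1,0,0,0,0,0,0,0,0,0,1,1]}"

text \<open>The parameter list \<open>(p, 0, \<dots>, 0, q)\<close> of length \<open>m \<ge> 2\<close>.\<close>

definition end_params :: "nat \<Rightarrow> nat \<Rightarrow> nat \<Rightarrow> nat list" where
  "end_params m p q = p # replicate (m - 2) 0 @ [q]"

end

theory Submission
  imports Defs "HOL-Analysis.Function_Topology" "HOL-Analysis.Convex"
begin

text \<open>
  The weight equation \<open>\<kappa>\<^sub>e = \<kappa>\<close> says that \<open>w\<close> is a positive eigenvector of the Ricci matrix for the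
  eigenvalue \<open>- \<kappa>\<close>. The off-diagonal entries are nonnegative and the tree is connected, so by
  Perron's theorem (maximise the quadratic form over the nonnegative part of the unit sphere) such
  an eigenvector exists and belongs to the largest eigenvalue. Pairing with it turns any \<open>w \<ge> 0\<close>
  with \<open>R w \<ge> 0\<close>, \<open>= 0\<close> or \<open>\<le> 0\<close> into a certificate for the sign of \<open>\<lambda>\<^sub>m\<^sub>a\<^sub>x\<close>.

  The quadratic form of \<open>R\<close> at \<open>w\<close> is \<open>\<Sum>\<^sub>v (S\<^sub>v\<^sup>2 - 2 \<Sum>\<^sub>e\<^sub>\<ni>\<^sub>v w\<^sub>e\<^sup>2) / d\<^sub>v\<close>. If a leaf is attached to \<open>v\<close>, the weight
  \<open>S\<^sub>v / (d\<^sub>v + 2)\<close> on the new edge strictly increases it. Hence a tree that properly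
  contains a tree with \<open>\<lambda>\<^sub>m\<^sub>a\<^sub>x \<ge> 0\<close> has \<open>\<lambda>\<^sub>m\<^sub>a\<^sub>x > 0\<close>.

  A tree that is not a caterpillar contains the subdivided star, for which \<open>\<lambda>\<^sub>m\<^sub>a\<^sub>x = 0\<close>. For caterpillars,
  monotonicity reduces the classification to explicit weights on the maximal negative, the zero and
  the minimal positive parameter lists, together with the fact that a long caterpillar contains a
  shorter one as a subtree.
\<close>

section \<open>The Ricci operator\<close>

text \<open>The bounds in the classification come from a one-dimensional boundary problem. Once the
  leaf weights are eliminated, the equation for eigenvalue 0 along leafless spine vertices says that
  the second difference of the spine weights vanishes, so these weights form an arithmetic
  progression there. An end vertex with \<open>p\<close> leaves next to a spine edge of weight
  \<open>t\<close> contributes \<open>(p - 3) * t / (3 * (p + 1))\<close>. Three leaves are thus the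
  balanced end: constant spine weights solve the problem for (3,0,...,0,3) at every length, the only
  infinite family at 0. Ends with one or two leaves force a slope, and meeting it at the other end
  leaves finitely many integer solutions. For m = 2 the two end terms add up to a positive multiple
  of (a_1 - 1)(a_2 - 1) - 4. The spectral argument is carried out for functions on edges; the
  numbering of the edges is met only where the spectrum of the matrix is identified.\<close>

definition ricci_op :: "'a set set \<Rightarrow> ('a set \<Rightarrow> real) \<Rightarrow> 'a set \<Rightarrow> real" where
  "ricci_op E w e = (\<Sum>f\<in>E. ricci_entry E e f * w f)"

text \<open>The level at which Perron's theorem and the addition of leaves are stated. Acyclicity
  enters through the ambient tree, in \<open>spanning_subtree_eq\<close>.\<close>

definition conn_graph :: "'a set \<Rightarrow> 'a set set \<Rightarrow> bool" where
  "conn_graph V E \<longleftrightarrow> finite V \<and> simple_graph V E \<and> connected_graph V E"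

abbreviation ricci_max :: "'a set set \<Rightarrow> real" where
  "ricci_max E \<equiv> lambda_max (ricci_matrix E)"

lemma simple_graphD:
  assumes "simple_graph V E" "e \<in> E"
  shows "e \<subseteq> V" "card e = 2" "finite e"
  using assms by (auto simp: simple_graph_def intro: card_ge_0_finite)

lemma finite_edges:
  assumes "finite V" "simple_graph V E"
  shows "finite E"
  using assms by (auto simp: simple_graph_def intro!: finite_subset[of E "Pow V"])

lemma vertex_degree_pos:
  assumes "finite V" "simple_graph V E" "e \<in> E" "z \<in> e"
  shows "vertex_degree E z > 0"
  using assms finite_edges[OF assms(1,2)] by (auto simp: vertex_degree_def card_gt_0_iff)

lemma ricci_entry_commute: "ricci_entry E e f = ricci_entry E f e"
  by (simp add: ricci_entry_def Int_commute)

lemma ricci_entry_nonneg: "e \<noteq> f \<Longrightarrow> ricci_entry E e f \<ge> 0"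
  by (auto simp: ricci_entry_def intro: sum_nonneg)

lemma ricci_entry_pos:
  assumes "finite V" "simple_graph V E" "e \<in> E" "z \<in> e" "z \<in> f" "e \<noteq> f"
  shows "ricci_entry E e f > 0"
proof -
  have "finite (e \<inter> f)" using simple_graphD[OF assms(2,3)] by auto
  moreover have "\<And>z. z \<in> e \<inter> f \<Longrightarrow> vertex_degree E z > 0"
    using vertex_degree_pos[OF assms(1-3)] by auto
  ultimately show ?thesis using assms by (auto simp: ricci_entry_def intro!: sum_pos)
qed

text \<open>The off-diagonal formula, a sum over \<open>e \<inter> f\<close>, would give +1/d terms
  on the diagonal as well. The actual diagonal entry is its negative, and this correction is the
  source of \<open>2 * w e\<close>, the same term as in the Lin-Lu-Yau curvature.\<close>

lemma ricci_op_vertex_form: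
  assumes fin: "finite V" and sg: "simple_graph V E" and e: "e \<in> E"
  shows "ricci_op E w e = (\<Sum>z\<in>e. (weight_sum E w z - 2 * w e) / vertex_degree E z)"
proof -
  have finE: "finite E" using finite_edges[OF fin sg] .
  have fe: "finite e" using simple_graphD[OF sg e] by auto
  let ?d = "\<lambda>z. 1 / real (vertex_degree E z)"
  have "(\<Sum>z\<in>e. weight_sum E w z * ?d z) = (\<Sum>z\<in>e. \<Sum>f\<in>E. (if z \<in> f then w f * ?d z else 0))"
    unfolding weight_sum_def sum_distrib_right
    by (rule sum.cong[OF refl]) (auto simp: sum.inter_filter[OF finE] intro!: sum.cong)
  also have "\<dots> = (\<Sum>f\<in>E. \<Sum>z\<in>e. (if z \<in> f then w f * ?d z else 0))"
    by (rule sum.swap)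
  also have "\<dots> = (\<Sum>f\<in>E. (\<Sum>z\<in>e \<inter> f. ?d z) * w f)"
    by (rule sum.cong[OF refl]) (auto simp: sum.inter_restrict[OF fe] sum_distrib_left mult.commute[of _ "w _"] intro!: sum.cong)
  also have "\<dots> = (\<Sum>f\<in>E. ricci_entry E e f * w f + (if f = e then 2 * (\<Sum>z\<in>e. ?d z) * w e else 0))"
    by (intro sum.cong refl) (auto simp: ricci_entry_def)
  also have "\<dots> = ricci_op E w e + 2 * (\<Sum>z\<in>e. ?d z) * w e"
    using e finE by (simp add: sum.distrib ricci_op_def)
  finally show ?thesis
    by (simp add: diff_divide_distrib sum_subtractf sum_distrib_left sum_distrib_right mult.assoc mult.commute)
qed

lemma ricci_op_selfadjoint:
  "(\<Sum>e\<in>E. w e * ricci_op E v e) = (\<Sum>e\<in>E. v e * ricci_op E w e)"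
proof -
  have "(\<Sum>e\<in>E. w e * ricci_op E v e) = (\<Sum>e\<in>E. \<Sum>f\<in>E. w e * (ricci_entry E e f * v f))"
    by (simp add: ricci_op_def sum_distrib_left)
  also have "\<dots> = (\<Sum>f\<in>E. \<Sum>e\<in>E. w e * (ricci_entry E e f * v f))"
    by (rule sum.swap)
  also have "\<dots> = (\<Sum>e\<in>E. v e * ricci_op E w e)"
    by (simp add: ricci_op_def sum_distrib_left ricci_entry_commute mult_ac)
  finally show ?thesis .
qed

text \<open>The shape that monotonicity needs: when a leaf is attached, only the summand of the
  attachment vertex changes, and one summand for the leaf is added.\<close>

lemma ricci_form_vertex_form:
  assumes fin: "finite V" and sg: "simple_graph V E"
  shows "(\<Sum>e\<in>E. w e * ricci_op E w e) =
    (\<Sum>z\<in>V. ((weight_sum E w z)\<^sup>2 - 2 * (\<Sum>e\<in>{e\<in>E. z \<in> e}. (w e)\<^sup>2)) / vertex_degree E z)"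
proof -
  have finE: "finite E" using finite_edges[OF fin sg] .
  have "(\<Sum>e\<in>E. w e * ricci_op E w e) =
      (\<Sum>e\<in>E. \<Sum>z\<in>V. if z \<in> e then w e * (weight_sum E w z - 2 * w e) / vertex_degree E z else 0)"
  proof (intro sum.cong refl)
    fix e assume e: "e \<in> E"
    have "V \<inter> e = e" using simple_graphD[OF sg e] by auto
    then show "w e * ricci_op E w e =
        (\<Sum>z\<in>V. if z \<in> e then w e * (weight_sum E w z - 2 * w e) / vertex_degree E z else 0)"
      using sum.inter_restrict[OF fin, of "\<lambda>z. w e * (weight_sum E w z - 2 * w e) / vertex_degree E z" e]
      by (simp add: ricci_op_vertex_form[OF fin sg e] sum_distrib_left)
  qed
  also have "\<dots> = (\<Sum>z\<in>V. \<Sum>e\<in>E. if z \<in> e then w e * (weight_sum E w z - 2 * w e) / vertex_degree E z else 0)"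
    by (rule sum.swap)
  also have "\<dots> = (\<Sum>z\<in>V. ((weight_sum E w z)\<^sup>2 - 2 * (\<Sum>e\<in>{e\<in>E. z \<in> e}. (w e)\<^sup>2)) / vertex_degree E z)"
  proof (intro sum.cong refl)
    fix z
    have "(\<Sum>e\<in>E. if z \<in> e then w e * (weight_sum E w z - 2 * w e) / vertex_degree E z else 0)
        = (\<Sum>e\<in>{e\<in>E. z \<in> e}. w e * (weight_sum E w z - 2 * w e) / vertex_degree E z)"
      by (simp add: sum.inter_filter[OF finE])
    also have "\<dots> = ((\<Sum>e\<in>{e\<in>E. z \<in> e}. w e * weight_sum E w z) - 2 * (\<Sum>e\<in>{e\<in>E. z \<in> e}. (w e)\<^sup>2)) / vertex_degree E z"
      by (simp add: sum_divide_distrib[symmetric] sum_subtractf sum_distrib_left power2_eq_square algebra_simps)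
    also have "(\<Sum>e\<in>{e\<in>E. z \<in> e}. w e * weight_sum E w z) = (weight_sum E w z)\<^sup>2"
      by (simp add: sum_distrib_right[symmetric] power2_eq_square) (simp add: weight_sum_def)
    finally show "(\<Sum>e\<in>E. if z \<in> e then w e * (weight_sum E w z - 2 * w e) / vertex_degree E z else 0)
      = ((weight_sum E w z)\<^sup>2 - 2 * (\<Sum>e\<in>{e\<in>E. z \<in> e}. (w e)\<^sup>2)) / vertex_degree E z" .
  qed
  finally show ?thesis .
qed

text \<open>Transfers connectedness from vertices to edges with a common end point, which is the
  irreducibility used in Perron's theorem.\<close>

lemma connected_edge_propagate:
  assumes conn: "connected_graph V E" and sg: "simple_graph V E"
    and step: "\<And>e f z. \<lbrakk>e \<in> E; f \<in> E; z \<in> e; z \<in> f; P e\<rbrakk> \<Longrightarrow> P f"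
    and e: "e \<in> E" "P e" and f: "f \<in> E"
  shows "P f"
proof -
  obtain x where x: "x \<in> e" using simple_graphD[OF sg e(1)] by fastforce
  obtain y where y: "y \<in> f" using simple_graphD[OF sg f] by fastforce
  have "x \<in> V" "y \<in> V" using x y simple_graphD[OF sg e(1)] simple_graphD[OF sg f] by auto
  then have "(x, y) \<in> {(x, y). {x, y} \<in> E}\<^sup>*" using conn by (auto simp: connected_graph_def)
  then have "\<forall>g\<in>E. y \<in> g \<longrightarrow> P g"
  proof (induction rule: rtrancl_induct)
    case base
    show ?case using step e x by blast
  next
    case (step a b)
    then have "{a, b} \<in> E" "P {a, b}" by auto
    then show ?case using assms(3) by (metis insertI1 insertI2)
  qed
  then show ?thesis using f y by blast
qed

text \<open>Exact expansion of both quadratic forms under a change of one coordinate. The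
  coefficients of \<open>2 * t\<close> are the partial derivatives from which the eigenvector
  equation is read off.\<close>

lemma ricci_form_perturb:
  fixes u :: "'a set \<Rightarrow> real"
  assumes finE: "finite E" and f: "f \<in> E"
  defines "w \<equiv> \<lambda>t. u(f := u f + t)"
  shows "(\<Sum>e\<in>E. w t e * ricci_op E (w t) e) =
    (\<Sum>e\<in>E. u e * ricci_op E u e) + 2 * t * ricci_op E u f + t\<^sup>2 * ricci_entry E f f"
    and "(\<Sum>e\<in>E. (w t e)\<^sup>2) = (\<Sum>e\<in>E. (u e)\<^sup>2) + 2 * t * u f + t\<^sup>2"
proof -
  define \<delta> where "\<delta> = (\<lambda>e. if e = f then 1 else 0 :: real)"
  have w: "w t e = u e + t * \<delta> e" for e by (simp add: w_def \<delta>_def)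
  have op: "ricci_op E (w t) e = ricci_op E u e + t * ricci_op E \<delta> e" for e
    by (simp add: ricci_op_def w algebra_simps sum.distrib sum_distrib_left)
  have opd: "ricci_op E \<delta> e = ricci_entry E e f" for e
  proof -
    have "ricci_op E \<delta> e = (\<Sum>g\<in>E. if g = f then ricci_entry E e g else 0)"
      unfolding ricci_op_def \<delta>_def by (intro sum.cong) auto
    then show ?thesis using finE f by simp
  qed
  have sd: "(\<Sum>e\<in>E. \<delta> e * g e) = g f" for g
  proof -
    have "(\<Sum>e\<in>E. \<delta> e * g e) = (\<Sum>e\<in>E. if e = f then g e else 0)"
      unfolding \<delta>_def by (intro sum.cong) auto
    then show ?thesis using finE f by simp
  qed
  have "(\<Sum>e\<in>E. w t e * ricci_op E (w t) e) = (\<Sum>e\<in>E. u e * ricci_op E u e)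
     + t * (\<Sum>e\<in>E. u e * ricci_op E \<delta> e) + t * (\<Sum>e\<in>E. \<delta> e * ricci_op E u e) + t\<^sup>2 * (\<Sum>e\<in>E. \<delta> e * ricci_op E \<delta> e)"
    by (simp add: w op algebra_simps sum.distrib sum_distrib_left power2_eq_square)
  then show "(\<Sum>e\<in>E. w t e * ricci_op E (w t) e) =
    (\<Sum>e\<in>E. u e * ricci_op E u e) + 2 * t * ricci_op E u f + t\<^sup>2 * ricci_entry E f f"
    using ricci_op_selfadjoint[of u E \<delta>] sd[of "ricci_op E u"] sd[of "ricci_op E \<delta>"] opd[of f]
    by (simp add: algebra_simps)
  have "(\<Sum>e\<in>E. (w t e)\<^sup>2) = (\<Sum>e\<in>E. (u e)\<^sup>2) + 2 * t * (\<Sum>e\<in>E. \<delta> e * u e) + t\<^sup>2 * (\<Sum>e\<in>E. \<delta> e * \<delta> e)"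
    by (simp add: w power2_eq_square algebra_simps sum.distrib sum_distrib_left)
  then show "(\<Sum>e\<in>E. (w t e)\<^sup>2) = (\<Sum>e\<in>E. (u e)\<^sup>2) + 2 * t * u f + t\<^sup>2"
    by (simp only: sd) (simp add: \<delta>_def)
qed

section \<open>The Perron eigenvector\<close>

lemma rayleigh_maximizer:
  assumes finE: "finite E" and ne: "E \<noteq> {}"
  obtains u \<mu> where "\<forall>e\<in>E. u e \<ge> 0" "(\<Sum>e\<in>E. (u e)\<^sup>2) = 1"
    "(\<Sum>e\<in>E. u e * ricci_op E u e) = \<mu>"
    "\<And>w. \<forall>e\<in>E. w e \<ge> 0 \<Longrightarrow> (\<Sum>e\<in>E. w e * ricci_op E w e) \<le> \<mu> * (\<Sum>e\<in>E. (w e)\<^sup>2)"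
proof -
  let ?Q = "\<lambda>w. \<Sum>e\<in>E. w e * ricci_op E w e"
  let ?N = "\<lambda>w :: 'a set \<Rightarrow> real. \<Sum>e\<in>E. (w e)\<^sup>2"
  \<comment> \<open>Coordinates outside \<open>E\<close> are pinned to 0, so the box is a product of
    compact sets and Tychonoff applies in the space of all functions on vertex sets.\<close>
  define B where "B = (\<Pi>\<^sub>E e\<in>UNIV. if e \<in> E then {0..1::real} else {0})"
  have "compactin (product_topology (\<lambda>_. euclidean) UNIV) B"
    unfolding B_def compactin_PiE by auto
  then have B: "compact B"
    by (simp add: euclidean_product_topology)
  have cont: "continuous_on UNIV ?N" "continuous_on UNIV ?Q"
    unfolding ricci_op_def
    by (intro continuous_intros continuous_on_product_coordinates)+
  define S where "S = {w \<in> B. ?N w = 1}"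
  have "closed (?N -` {1})"
    using cont(1) by (intro closed_vimage) auto
  then have "compact (B \<inter> ?N -` {1})" using B by (rule compact_Int_closed[rotated])
  moreover have "B \<inter> ?N -` {1} = S" by (auto simp: S_def)
  ultimately have S: "compact S" by simp
  obtain e0 where e0: "e0 \<in> E" using ne by auto
  have "?N (\<lambda>e. if e = e0 then 1 else 0) = (\<Sum>e\<in>E. if e = e0 then 1 else 0)"
    by (intro sum.cong) auto
  then have "(\<lambda>e. if e = e0 then 1 else 0) \<in> S"
    using e0 finE by (auto simp: S_def B_def)
  then have "S \<noteq> {}" by auto
  then obtain u where u: "u \<in> S" "\<forall>w\<in>S. ?Q w \<le> ?Q u"
    using continuous_attains_sup[OF S _ continuous_on_subset[OF cont(2)]] by auto
  have u': "\<forall>e\<in>E. u e \<ge> 0" "?N u = 1"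
    using u(1) unfolding S_def B_def PiE_iff by (simp_all, metis atLeastAtMost_iff UNIV_I)
  have bound: "?Q w \<le> ?Q u * ?N w" if w: "\<forall>e\<in>E. w e \<ge> 0" for w
  proof (cases "?N w = 0")
    case True
    then have "\<forall>e\<in>E. w e = 0" using finE by (simp add: sum_nonneg_eq_0_iff)
    then show ?thesis by simp
  next
    case False
    then have N: "?N w > 0" by (simp add: less_le sum_nonneg)
    \<comment> \<open>Both sides are homogeneous of degree two, so \<open>w\<close> may be scaled to
      the unit sphere. Its values outside \<open>E\<close> are reset to 0 to land in the
      box.\<close>
    define c where "c = 1 / sqrt (?N w)"
    have c: "c > 0" "c\<^sup>2 * ?N w = 1" using N by (auto simp: c_def power_divide)
    define v where "v = (\<lambda>e. if e \<in> E then c * w e else 0)"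
    have Nv: "?N v = 1"
      using c by (simp add: v_def power_mult_distrib sum_distrib_left[symmetric])
    have "v e \<le> 1" if "e \<in> E" for e
    proof -
      have "(v e)\<^sup>2 \<le> ?N v" by (rule member_le_sum) (use that finE in auto)
      then show ?thesis using Nv by (simp add: abs_square_le_1)
    qed
    then have "v \<in> S" using Nv w c(1) by (auto simp: S_def B_def v_def)
    then have "?Q v \<le> ?Q u" using u by auto
    moreover have "?Q v = c\<^sup>2 * ?Q w"
      by (simp add: v_def ricci_op_def sum_distrib_left power2_eq_square algebra_simps)
    ultimately have "c\<^sup>2 * ?Q w \<le> ?Q u" by simp
    also have "?Q u = ?Q u * (c\<^sup>2 * ?N w)" using c(2) by simp
    also have "\<dots> = c\<^sup>2 * (?Q u * ?N w)" by (simp only: mult.left_commute)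
    finally show ?thesis using c(1) by (subst (asm) mult_le_cancel_left_pos) auto
  qed
  show ?thesis by (rule that[OF u' refl bound])
qed

text \<open>First-order optimality without derivatives: after division by \<open>t\<close> the
  right-hand side tends to 0. The chosen \<open>t\<close> keeps it below
  \<open>c / 2\<close>.\<close>

lemma nonpos_of_linear_le_quadratic:
  fixes c k :: real
  assumes "\<And>t. 0 < t \<Longrightarrow> t < \<epsilon> \<Longrightarrow> t * c \<le> t\<^sup>2 * k" "\<epsilon> > 0"
  shows "c \<le> 0"
proof (rule ccontr)
  assume "\<not> c \<le> 0"
  then have c: "c > 0" by simp
  define t where "t = min (\<epsilon> / 2) (c / (2 * (\<bar>k\<bar> + 1)))"
  have t: "0 < t" "t < \<epsilon>" "t \<le> c / (2 * (\<bar>k\<bar> + 1))" using c assms(2) by (auto simp: t_def)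
  have "t * c \<le> t * (t * k)" using assms(1)[OF t(1,2)] by (simp add: power2_eq_square)
  then have "c \<le> t * k" using t by simp
  also have "t * k \<le> t * (\<bar>k\<bar> + 1)" using t by simp
  also have "\<dots> \<le> c / (2 * (\<bar>k\<bar> + 1)) * (\<bar>k\<bar> + 1)" using t by (intro mult_right_mono) auto
  also have "\<dots> = c / 2" by (simp add: field_simps)
  finally show False using c by simp
qed

text \<open>A maximiser over the nonnegative cone may be increased in every coordinate, which gives
  the inequality \<open>le\<close>; where it is positive it may also be decreased, which gives
  equality. If it vanished at one edge, the operator there would be both nonnegative and at most 0,
  so it would vanish at all adjacent edges and, by connectedness, everywhere, against its norm being
  1.\<close>

lemma perron_vector:
  assumes G: "conn_graph V E" and ne: "E \<noteq> {}"
  obtains u \<mu> where "\<forall>e\<in>E. u e > 0" "\<forall>e\<in>E. ricci_op E u e = \<mu> * u e"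
    "\<And>w. \<forall>e\<in>E. w e \<ge> 0 \<Longrightarrow> (\<Sum>e\<in>E. w e * ricci_op E w e) \<le> \<mu> * (\<Sum>e\<in>E. (w e)\<^sup>2)"
proof -
  have fin: "finite V" and sg: "simple_graph V E" and conn: "connected_graph V E"
    using G by (auto simp: conn_graph_def)
  have finE: "finite E" using finite_edges[OF fin sg] .
  obtain u \<mu> where u: "\<forall>e\<in>E. u e \<ge> 0" "(\<Sum>e\<in>E. (u e)\<^sup>2) = 1"
    "(\<Sum>e\<in>E. u e * ricci_op E u e) = \<mu>"
    and max: "\<And>w. \<forall>e\<in>E. w e \<ge> 0 \<Longrightarrow> (\<Sum>e\<in>E. w e * ricci_op E w e) \<le> \<mu> * (\<Sum>e\<in>E. (w e)\<^sup>2)"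
    by (rule rayleigh_maximizer[OF finE ne], rule that)
  have var: "2 * t * (ricci_op E u f - \<mu> * u f) \<le> t\<^sup>2 * (\<mu> - ricci_entry E f f)"
    if f: "f \<in> E" and t: "u f + t \<ge> 0" for f t
  proof -
    have "\<forall>e\<in>E. (u(f := u f + t)) e \<ge> 0" using u(1) t by auto
    from max[OF this] show ?thesis
      unfolding ricci_form_perturb[OF finE f] u by (simp add: algebra_simps)
  qed
  have le: "ricci_op E u f \<le> \<mu> * u f" if f: "f \<in> E" for f
  proof -
    have "2 * (ricci_op E u f - \<mu> * u f) \<le> 0"
      by (rule nonpos_of_linear_le_quadratic[where \<epsilon>=1 and k="\<mu> - ricci_entry E f f"])
         (use var[OF f] u(1) f in \<open>auto simp: mult_ac\<close>)
    then show ?thesis by simp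
  qed
  have eq: "ricci_op E u f = \<mu> * u f" if f: "f \<in> E" and pos: "u f > 0" for f
  proof -
    have "2 * (\<mu> * u f - ricci_op E u f) \<le> 0"
    proof (rule nonpos_of_linear_le_quadratic[where \<epsilon>="u f" and k="\<mu> - ricci_entry E f f"])
      fix t assume "0 < t" "t < u f"
      then show "t * (2 * (\<mu> * u f - ricci_op E u f)) \<le> t\<^sup>2 * (\<mu> - ricci_entry E f f)"
        using var[OF f, of "- t"] by (simp add: algebra_simps)
    qed (use pos in auto)
    then show ?thesis using le[OF f] by simp
  qed
  have pos: "u f > 0" if f: "f \<in> E" for f
  proof (rule ccontr)
    assume "\<not> u f > 0"
    then have z: "u f = 0" using u(1) f by force
    have step: "u g = 0" if e: "e \<in> E" "g \<in> E" "z \<in> e" "z \<in> g" "u e = 0" for e g z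
    proof (cases "e = g")
      case False
      have nn: "\<forall>h\<in>E. ricci_entry E e h * u h \<ge> 0"
        using u(1) e ricci_entry_nonneg[of e _ E] by (metis mult_nonneg_nonneg mult_zero_right order_refl)
      then have "ricci_op E u e \<ge> 0" by (auto simp: ricci_op_def intro: sum_nonneg)
      moreover have "ricci_op E u e \<le> 0" using le[OF e(1)] e by simp
      ultimately have "(\<Sum>h\<in>E. ricci_entry E e h * u h) = 0" by (simp add: ricci_op_def)
      then have "ricci_entry E e g * u g = 0" using nn finE e(2) by (simp add: sum_nonneg_eq_0_iff)
      then show ?thesis using ricci_entry_pos[OF fin sg e(1,3,4) False] by simp
    qed (use e in simp)
    have "u g = 0" if g: "g \<in> E" for g
      by (rule connected_edge_propagate[OF conn sg, where P = "\<lambda>e. u e = 0", OF _ f z g]) (rule step)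
    then show False using u(2) by simp
  qed
  show ?thesis using that[of u \<mu>] pos eq max by blast
qed

section \<open>From functions on edges to the spectrum of the matrix\<close>

lemma ricci_matrix_mult_vec:
  assumes "finite E" "i < card E"
  shows "(ricci_matrix E *\<^sub>v vec (card E) (\<lambda>j. w (from_nat_into E j))) $ i = ricci_op E w (from_nat_into E i)"
proof -
  have "(ricci_matrix E *\<^sub>v vec (card E) (\<lambda>j. w (from_nat_into E j))) $ i =
      (\<Sum>j\<in>{..<card E}. ricci_entry E (from_nat_into E i) (from_nat_into E j) * w (from_nat_into E j))"
    using assms by (auto simp: ricci_matrix_def scalar_prod_def atLeast0LessThan intro!: sum.cong)
  also have "\<dots> = ricci_op E w (from_nat_into E i)"
    unfolding ricci_op_def
    by (rule sum.reindex_bij_betw[OF bij_betw_from_nat_into_finite[OF assms(1)]])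
  finally show ?thesis .
qed

lemma ricci_matrix_carrier: "ricci_matrix E \<in> carrier_mat (card E) (card E)"
  by (simp add: ricci_matrix_def)

lemma eigenvalue_ricci_matrixI:
  assumes fin: "finite E" and op: "\<forall>e\<in>E. ricci_op E u e = \<mu> * u e" and e: "e \<in> E" "u e \<noteq> 0"
  shows "eigenvalue (ricci_matrix E) \<mu>"
proof -
  let ?n = "card E" and ?v = "vec (card E) (\<lambda>j. u (from_nat_into E j))"
  have ne: "E \<noteq> {}" using e by auto
  have "ricci_matrix E *\<^sub>v ?v = \<mu> \<cdot>\<^sub>v ?v"
  proof (rule eq_vecI)
    fix i assume "i < dim_vec (\<mu> \<cdot>\<^sub>v ?v)"
    then have i: "i < card E" by simp
    show "(ricci_matrix E *\<^sub>v ?v) $ i = (\<mu> \<cdot>\<^sub>v ?v) $ i"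
      using i op from_nat_into[OF ne, of i] by (simp add: ricci_matrix_mult_vec[OF fin])
  qed (simp add: ricci_matrix_def)
  moreover obtain i where i: "i < ?n" "from_nat_into E i = e"
    using bij_betw_from_nat_into_finite[OF fin] e(1) unfolding bij_betw_def by (metis imageE lessThan_iff)
  have "?v \<noteq> 0\<^sub>v ?n"
  proof
    assume "?v = 0\<^sub>v ?n"
    then have "?v $ i = 0\<^sub>v ?n $ i" by simp
    then show False using i e by simp
  qed
  ultimately show ?thesis
    using ricci_matrix_carrier[of E] by (auto simp: eigenvalue_def eigenvector_def intro!: exI[of _ ?v])
qed

lemma eigenvalue_ricci_matrixE:
  assumes fin: "finite E" and "eigenvalue (ricci_matrix E) \<mu>"
  obtains x where "\<forall>e\<in>E. ricci_op E x e = \<mu> * x e" "\<exists>e\<in>E. x e \<noteq> 0"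
proof -
  let ?n = "card E"
  obtain v where v: "v \<in> carrier_vec ?n" "v \<noteq> 0\<^sub>v ?n" "ricci_matrix E *\<^sub>v v = \<mu> \<cdot>\<^sub>v v"
    using assms ricci_matrix_carrier[of E] by (auto simp: eigenvalue_def eigenvector_def)
  define x where "x = (\<lambda>e. v $ (to_nat_on E e))"
  have to: "to_nat_on E (from_nat_into E i) = i" "from_nat_into E i \<in> E" if "i < ?n" for i
    using that to_nat_on_finite[OF fin] bij_betw_from_nat_into_finite[OF fin]
    by (auto simp: bij_betw_def)
  have idx: "to_nat_on E e < ?n" "from_nat_into E (to_nat_on E e) = e" if "e \<in> E" for e
    using that to_nat_on_finite[OF fin] fin by (auto simp: bij_betw_def countable_finite)
  have vx: "v = vec ?n (\<lambda>j. x (from_nat_into E j))"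
    using v(1) to by (intro eq_vecI) (auto simp: x_def)
  show ?thesis
  proof (rule that[of x])
    show "\<forall>e\<in>E. ricci_op E x e = \<mu> * x e"
    proof
      fix e assume e: "e \<in> E"
      have "ricci_op E x e = (ricci_matrix E *\<^sub>v v) $ (to_nat_on E e)"
        using ricci_matrix_mult_vec[OF fin idx(1)[OF e], of x] idx[OF e] vx by simp
      then show "ricci_op E x e = \<mu> * x e" using v idx(1)[OF e] by (simp add: x_def)
    qed
    obtain i where i: "i < ?n" "v $ i \<noteq> 0"
      using v(1,2) by (metis eq_vecI carrier_vecD dim_vec index_zero_vec zero_vec_def)
    then show "\<exists>e\<in>E. x e \<noteq> 0" using to[OF i(1)] by (auto simp: x_def intro!: bexI[of _ "from_nat_into E i"])
  qed
qed

text \<open>If \<open>x\<close> is an eigenvector for \<nu>, its absolute value satisfies the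
  eigenvalue equation as an inequality. Pairing this with the positive vector \<open>u\<close> and
  moving the operator to the other side compares \<nu> with \<mu>.\<close>

lemma lambda_max_eqI:
  assumes fin: "finite E" and ne: "E \<noteq> {}"
    and u: "\<forall>e\<in>E. u e > 0" and op: "\<forall>e\<in>E. ricci_op E u e = \<mu> * u e"
  shows "ricci_max E = \<mu>"
  unfolding lambda_max_def
proof (rule Max_eqI)
  show "finite (spectrum (ricci_matrix E))"
    using card_finite_spectrum(1)[OF ricci_matrix_carrier] .
  show "\<mu> \<in> spectrum (ricci_matrix E)"
    using ne eigenvalue_ricci_matrixI[OF fin op] u by (force simp: spectrum_def)
  fix \<nu> assume "\<nu> \<in> spectrum (ricci_matrix E)"
  then obtain x where x: "\<forall>e\<in>E. ricci_op E x e = \<nu> * x e" "\<exists>e\<in>E. x e \<noteq> 0"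
    using eigenvalue_ricci_matrixE[OF fin] by (auto simp: spectrum_def)
  have ge: "\<nu> * \<bar>x e\<bar> \<le> ricci_op E (\<lambda>e. \<bar>x e\<bar>) e" if e: "e \<in> E" for e
  proof -
    have eq: "ricci_op E y e = ricci_entry E e e * y e + (\<Sum>f\<in>E - {e}. ricci_entry E e f * y f)" for y
      using fin e by (simp add: ricci_op_def sum.remove)
    \<comment> \<open>The diagonal entry is moved to the left before absolute values are taken,
      because only the off-diagonal entries are known to be nonnegative.\<close>
    have "(\<nu> - ricci_entry E e e) * \<bar>x e\<bar> \<le> \<bar>(\<nu> - ricci_entry E e e) * x e\<bar>"
      by (simp add: abs_mult mult_right_mono)
    also have "(\<nu> - ricci_entry E e e) * x e = (\<Sum>f\<in>E - {e}. ricci_entry E e f * x f)"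
      using eq[of x] x(1) e by (simp add: algebra_simps)
    also have "\<bar>\<dots>\<bar> \<le> (\<Sum>f\<in>E - {e}. ricci_entry E e f * \<bar>x f\<bar>)"
      by (rule order_trans[OF sum_abs])
         (use ricci_entry_nonneg[of e _ E] in \<open>fastforce intro!: sum_mono mult_right_mono simp: abs_mult\<close>)
    finally show ?thesis using eq[of "\<lambda>e. \<bar>x e\<bar>"] by (simp add: algebra_simps)
  qed
  have "\<nu> * (\<Sum>e\<in>E. u e * \<bar>x e\<bar>) = (\<Sum>e\<in>E. u e * (\<nu> * \<bar>x e\<bar>))"
    by (simp add: sum_distrib_left mult_ac)
  also have "\<dots> \<le> (\<Sum>e\<in>E. u e * ricci_op E (\<lambda>e. \<bar>x e\<bar>) e)"
    using ge u by (intro sum_mono mult_left_mono) (auto simp: less_imp_le)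
  also have "\<dots> = (\<Sum>e\<in>E. \<bar>x e\<bar> * ricci_op E u e)" by (rule ricci_op_selfadjoint)
  also have "\<dots> = \<mu> * (\<Sum>e\<in>E. u e * \<bar>x e\<bar>)"
    using op by (simp add: sum_distrib_left mult_ac)
  finally have "\<nu> * (\<Sum>e\<in>E. u e * \<bar>x e\<bar>) \<le> \<mu> * (\<Sum>e\<in>E. u e * \<bar>x e\<bar>)" .
  moreover obtain e where e: "e \<in> E" "x e \<noteq> 0" using x by auto
  then have "(\<Sum>e\<in>E. u e * \<bar>x e\<bar>) > 0"
    using u fin by (intro sum_pos2[of E e]) (auto simp: less_imp_le)
  ultimately show "\<nu> \<le> \<mu>" by simp
qed

lemma ricci_max_perron:
  assumes G: "conn_graph V E" and ne: "E \<noteq> {}"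
  obtains u where "\<forall>e\<in>E. u e > 0" "\<forall>e\<in>E. ricci_op E u e = ricci_max E * u e"
    "\<And>w. \<forall>e\<in>E. w e \<ge> 0 \<Longrightarrow> (\<Sum>e\<in>E. w e * ricci_op E w e) \<le> ricci_max E * (\<Sum>e\<in>E. (w e)\<^sup>2)"
proof -
  have fin: "finite E" using G finite_edges by (auto simp: conn_graph_def)
  obtain u \<mu> where u: "\<forall>e\<in>E. u e > 0" "\<forall>e\<in>E. ricci_op E u e = \<mu> * u e"
    "\<And>w. \<forall>e\<in>E. w e \<ge> 0 \<Longrightarrow> (\<Sum>e\<in>E. w e * ricci_op E w e) \<le> \<mu> * (\<Sum>e\<in>E. (w e)\<^sup>2)"
    by (rule perron_vector[OF assms], rule that)
  show ?thesis using that[of u] u lambda_max_eqI[OF fin ne u(1,2)] by simp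
qed

section \<open>Sign certificates\<close>

lemma ricci_max_pairing:
  assumes G: "conn_graph V E" and ne: "E \<noteq> {}"
  obtains u where "\<forall>e\<in>E. u e > 0"
    "\<And>w. ricci_max E * (\<Sum>e\<in>E. u e * w e) = (\<Sum>e\<in>E. u e * ricci_op E w e)"
proof -
  obtain u where u: "\<forall>e\<in>E. u e > 0" "\<forall>e\<in>E. ricci_op E u e = ricci_max E * u e"
    using ricci_max_perron[OF assms] by metis
  have "(\<Sum>e\<in>E. u e * ricci_op E w e) = ricci_max E * (\<Sum>e\<in>E. u e * w e)" for w
    by (subst ricci_op_selfadjoint) (use u in \<open>simp add: sum_distrib_left mult_ac\<close>)
  then show ?thesis using that u by metis
qed

lemma ricci_max_negI:
  assumes G: "conn_graph V E" and w: "\<forall>e\<in>E. w e \<ge> 0" "\<forall>e\<in>E. ricci_op E w e \<le> 0"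
    and e: "e \<in> E" "ricci_op E w e < 0"
  shows "ricci_max E < 0"
proof -
  have ne: "E \<noteq> {}" using e by auto
  have fin: "finite E" using G finite_edges by (auto simp: conn_graph_def)
  obtain u where u: "\<forall>e\<in>E. u e > 0"
    "\<And>w. ricci_max E * (\<Sum>e\<in>E. u e * w e) = (\<Sum>e\<in>E. u e * ricci_op E w e)"
    using ricci_max_pairing[OF G ne] by metis
  have "(\<Sum>e\<in>E. u e * - ricci_op E w e) > 0"
    using u(1) w e fin by (intro sum_pos2[of E e]) (auto simp: less_imp_le mult_nonneg_nonpos mult_pos_neg)
  then have "ricci_max E * (\<Sum>e\<in>E. u e * w e) < 0" using u(2)[of w] by (simp add: sum_negf)
  moreover have "(\<Sum>e\<in>E. u e * w e) \<ge> 0" using u(1) w by (auto intro!: sum_nonneg simp: less_imp_le)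
  ultimately show ?thesis by (simp add: mult_less_0_iff)
qed

lemma ricci_max_posI:
  assumes G: "conn_graph V E" and w: "\<forall>e\<in>E. w e \<ge> 0" "\<forall>e\<in>E. ricci_op E w e \<ge> 0"
    and e: "e \<in> E" "ricci_op E w e > 0"
  shows "ricci_max E > 0"
proof -
  have ne: "E \<noteq> {}" using e by auto
  have fin: "finite E" using G finite_edges by (auto simp: conn_graph_def)
  obtain u where u: "\<forall>e\<in>E. u e > 0"
    "\<And>w. ricci_max E * (\<Sum>e\<in>E. u e * w e) = (\<Sum>e\<in>E. u e * ricci_op E w e)"
    using ricci_max_pairing[OF G ne] by metis
  have "(\<Sum>e\<in>E. u e * ricci_op E w e) > 0"
    using u(1) w e fin by (intro sum_pos2[of E e]) (auto simp: less_imp_le)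
  then have "ricci_max E * (\<Sum>e\<in>E. u e * w e) > 0" using u(2)[of w] by simp
  moreover have "(\<Sum>e\<in>E. u e * w e) \<ge> 0" using u(1) w by (auto intro!: sum_nonneg simp: less_imp_le)
  ultimately show ?thesis by (simp add: zero_less_mult_iff)
qed

lemma ricci_max_zeroI:
  assumes "conn_graph V E" "E \<noteq> {}" "\<forall>e\<in>E. w e > 0" "\<forall>e\<in>E. ricci_op E w e = 0"
  shows "ricci_max E = 0"
  using assms finite_edges lambda_max_eqI[of E w 0] by (auto simp: conn_graph_def)

section \<open>Einstein metrics as positive eigenvectors\<close>

lemma einstein_metric_iff:
  assumes fin: "finite V" and sg: "simple_graph V E"
  shows "einstein_metric E w \<kappa> \<longleftrightarrow> (\<forall>e\<in>E. w e > 0) \<and> (\<forall>e\<in>E. ricci_op E w e = - \<kappa> * w e)"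
proof -
  have "lly_curvature E w e = - (ricci_op E w e / w e)" if "e \<in> E" for e
    by (simp add: lly_curvature_def ricci_op_vertex_form[OF fin sg that] sum_divide_distrib)
  then have "lly_curvature E w e = \<kappa> \<longleftrightarrow> ricci_op E w e = - \<kappa> * w e" if "e \<in> E" "w e > 0" for e
    using that by (simp add: minus_equation_iff[of _ \<kappa>] nonzero_divide_eq_eq eq_commute[of "- \<kappa>"])
  then show ?thesis by (auto simp: einstein_metric_def)
qed

lemma finite_tree_conn_graph: "finite_tree V E \<Longrightarrow> conn_graph V E"
  by (simp add: finite_tree_def conn_graph_def)

lemma ex_einstein_metric:
  assumes "conn_graph V E" "E \<noteq> {}"
  shows "\<exists>w \<kappa>. einstein_metric E w \<kappa>"
proof -
  obtain u where "\<forall>e\<in>E. u e > 0" "\<forall>e\<in>E. ricci_op E u e = ricci_max E * u e"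
    using ricci_max_perron[OF assms] by metis
  then have "einstein_metric E u (- ricci_max E)"
    using assms(1) by (subst einstein_metric_iff[of V]) (auto simp: conn_graph_def)
  then show ?thesis by blast
qed

lemma einstein_curvature:
  assumes "conn_graph V E" "E \<noteq> {}" "einstein_metric E w \<kappa>"
  shows "\<kappa> = - ricci_max E"
proof -
  have "ricci_max E = - \<kappa>"
    using assms finite_edges
    by (intro lambda_max_eqI[of E w]) (auto simp: conn_graph_def einstein_metric_iff[of V])
  then show ?thesis by simp
qed

section \<open>Isomorphisms\<close>

lemma image_edge_eq_iff:
  assumes "simple_graph V E" "inj_on f V" "e \<in> E" "g \<in> E"
  shows "f ` e = f ` g \<longleftrightarrow> e = g"
  using assms inj_on_image_eq_iff[of f V e g] by (auto simp: simple_graph_def)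

lemma inj_on_image_edges:
  "simple_graph V E \<Longrightarrow> inj_on f V \<Longrightarrow> inj_on ((`) f) E"
  using image_edge_eq_iff[of V E f] by (auto simp: inj_on_def)

lemma simple_graph_image:
  assumes "simple_graph V E" "inj_on f V"
  shows "simple_graph (f ` V) ((`) f ` E)"
  unfolding simple_graph_def
proof (intro ballI conjI)
  fix e assume "e \<in> (`) f ` E"
  then obtain e' where e: "e' \<in> E" "e = f ` e'" by auto
  note d = simple_graphD[OF assms(1) e(1)]
  show "e \<subseteq> f ` V" using d e by auto
  show "card e = 2" using d e inj_on_subset[OF assms(2)] by (simp add: card_image)
qed

lemma vertex_degree_image:
  assumes "simple_graph V E" "inj_on f V" "z \<in> V"
  shows "vertex_degree ((`) f ` E) (f z) = vertex_degree E z"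
proof -
  have "f z \<in> f ` e \<longleftrightarrow> z \<in> e" if "e \<in> E" for e
    using inj_on_image_mem_iff[OF assms(2,3)] simple_graphD[OF assms(1) that] by auto
  then have "{e \<in> (`) f ` E. f z \<in> e} = (`) f ` {e \<in> E. z \<in> e}" by auto
  then show ?thesis
    unfolding vertex_degree_def
    by (simp add: card_image[OF inj_on_subset[OF inj_on_image_edges[OF assms(1,2)]]])
qed

lemma ricci_entry_image:
  assumes sg: "simple_graph V E" and inj: "inj_on f V" and e: "e \<in> E" and g: "g \<in> E"
  shows "ricci_entry ((`) f ` E) (f ` e) (f ` g) = ricci_entry E e g"
proof -
  have V: "e \<subseteq> V" "g \<subseteq> V" using simple_graphD[OF sg] e g by auto
  have *: "(\<Sum>z\<in>f ` A. 1 / real (vertex_degree ((`) f ` E) z)) = (\<Sum>z\<in>A. 1 / real (vertex_degree E z))"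
    if A: "A \<subseteq> V" for A
    using A by (subst sum.reindex)
      (auto intro!: sum.cong inj_on_subset[OF inj] simp: vertex_degree_image[OF sg inj] subset_iff)
  show ?thesis
    using V *[of e] *[of "e \<inter> g"]
    by (simp add: ricci_entry_def image_edge_eq_iff[OF sg inj e g] inj_on_image_Int[OF inj V, symmetric] le_infI1) auto
qed

lemma ricci_op_image:
  assumes sg: "simple_graph V E" and inj: "inj_on f V" and e: "e \<in> E"
  shows "ricci_op ((`) f ` E) w (f ` e) = ricci_op E (\<lambda>g. w (f ` g)) e"
  unfolding ricci_op_def
  by (subst sum.reindex[OF inj_on_image_edges[OF sg inj]])
     (auto intro!: sum.cong simp: ricci_entry_image[OF sg inj e])

lemma connected_graph_image:
  assumes "connected_graph V E"
  shows "connected_graph (f ` V) ((`) f ` E)"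
proof -
  have "(f x, f y) \<in> {(x, y). {x, y} \<in> (`) f ` E}\<^sup>*" if "(x, y) \<in> {(x, y). {x, y} \<in> E}\<^sup>*" for x y
    using that
  proof (induction rule: rtrancl_induct)
    case (step y z)
    then have "f ` {y, z} \<in> (`) f ` E" by blast
    then have "(f y, f z) \<in> {(x, y). {x, y} \<in> (`) f ` E}" by simp
    then show ?case using step.IH by (rule rtrancl_into_rtrancl[rotated])
  qed simp
  then show ?thesis using assms by (auto simp: connected_graph_def)
qed

lemma conn_graph_image:
  assumes "conn_graph V E" "inj_on f V"
  shows "conn_graph (f ` V) ((`) f ` E)"
  using assms connected_graph_image simple_graph_image by (auto simp: conn_graph_def)

lemma ricci_max_image:
  assumes G: "conn_graph V E" and ne: "E \<noteq> {}" and inj: "inj_on f V"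
  shows "ricci_max ((`) f ` E) = ricci_max E"
proof -
  have sg: "simple_graph V E" and fin: "finite E" 
    using G finite_edges by (auto simp: conn_graph_def)
  obtain u where u: "\<forall>e\<in>E. u e > 0" "\<forall>e\<in>E. ricci_op E u e = ricci_max E * u e"
    using ricci_max_perron[OF G ne] by metis
  \<comment> \<open>The Perron vector is transported along \<open>f\<close>; it stays positive and
    keeps its eigenvalue, and that determines the largest eigenvalue of the image.\<close>
  define w where "w = (\<lambda>e. u (inv_into E ((`) f) e))"
  have w: "w (f ` e) = u e" if "e \<in> E" for e
    by (simp add: w_def inv_into_f_f[OF inj_on_image_edges[OF sg inj] that])
  have "ricci_op E (\<lambda>g. w (f ` g)) e = ricci_op E u e" for e
    unfolding ricci_op_def using w by (intro sum.cong) auto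
  then show ?thesis
    using u w fin ne by (intro lambda_max_eqI[of _ w]) (auto simp: ricci_op_image[OF sg inj])
qed

lemma graph_iso_iff:
  assumes sg: "simple_graph V E" "simple_graph V' E'"
  shows "graph_iso V E V' E' \<longleftrightarrow> (\<exists>f. bij_betw f V V' \<and> (`) f ` E = E')"
proof -
  have "(\<forall>u\<in>V. \<forall>v\<in>V. {u, v} \<in> E \<longleftrightarrow> {f u, f v} \<in> E') \<longleftrightarrow> (`) f ` E = E'" if f: "bij_betw f V V'" for f
  proof
    assume *: "\<forall>u\<in>V. \<forall>v\<in>V. {u, v} \<in> E \<longleftrightarrow> {f u, f v} \<in> E'"
    show "(`) f ` E = E'"
    proof (intro equalityI subsetI)
      fix e' assume "e' \<in> (`) f ` E"
      then obtain e where e: "e \<in> E" "e' = f ` e" by auto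
      moreover obtain x y where "e = {x, y}"
        using simple_graphD(2)[OF sg(1) e(1)] by (auto simp: card_2_iff)
      ultimately show "e' \<in> E'" using * simple_graphD[OF sg(1) e(1)] by auto
    next
      fix e' assume e': "e' \<in> E'"
      then obtain x y where xy: "e' = {x, y}"
        using simple_graphD(2)[OF sg(2) e'] by (auto simp: card_2_iff)
      then have "x \<in> f ` V" "y \<in> f ` V"
        using simple_graphD(1)[OF sg(2) e'] f by (auto simp: bij_betw_def)
      then obtain u v where uv: "u \<in> V" "v \<in> V" "x = f u" "y = f v" by auto
      then have "{u, v} \<in> E" using * e' xy by auto
      moreover have "e' = f ` {u, v}" using xy uv by auto
      ultimately show "e' \<in> (`) f ` E" by blast
    qed
  next
    assume eq: "(`) f ` E = E'"
    show "\<forall>u\<in>V. \<forall>v\<in>V. {u, v} \<in> E \<longleftrightarrow> {f u, f v} \<in> E'"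
    proof (intro ballI iffI)
      fix u v assume "{u, v} \<in> E"
      then have "f ` {u, v} \<in> (`) f ` E" by (rule imageI)
      then have "f ` {u, v} \<in> E'" unfolding eq .
      then show "{f u, f v} \<in> E'" by simp
    next
      fix u v assume uv: "u \<in> V" "v \<in> V" and "{f u, f v} \<in> E'"
      then have "f ` {u, v} \<in> (`) f ` E" using eq by simp
      then obtain e where e: "e \<in> E" "f ` {u, v} = f ` e" by (rule imageE)
      have inj: "inj_on f V" using f by (simp add: bij_betw_def)
      have "{u, v} = e"
        using inj_on_image_eq_iff[OF inj, of "{u, v}" e] e(2) uv simple_graphD(1)[OF sg(1) e(1)] by simp
      then show "{u, v} \<in> E" using e by simp
    qed
  qed
  then show ?thesis unfolding graph_iso_def by (intro ex_cong1) blast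
qed

lemma ricci_max_iso:
  assumes G: "conn_graph V E" "E \<noteq> {}" and sg: "simple_graph V' E'" and iso: "graph_iso V E V' E'"
  shows "ricci_max E' = ricci_max E"
proof -
  have "simple_graph V E" using G by (simp add: conn_graph_def)
  then obtain f where "bij_betw f V V'" "(`) f ` E = E'" using iso unfolding graph_iso_iff[OF \<open>simple_graph V E\<close> sg] by blast
  then show ?thesis using ricci_max_image[OF G, of f] by (auto simp: bij_betw_def)
qed

section \<open>Growing a subtree inside a tree\<close>

lemma edge_rel_sym: "(x, y) \<in> {(x, y). {x, y} \<in> E}\<^sup>* \<Longrightarrow> (y, x) \<in> {(x, y). {x, y} \<in> E}\<^sup>*"
proof -
  have "sym ({(x, y). {x, y} \<in> E}\<^sup>*)"
    by (rule sym_rtrancl) (auto simp: sym_def insert_commute)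
  then show "(x, y) \<in> {(x, y). {x, y} \<in> E}\<^sup>* \<Longrightarrow> (y, x) \<in> {(x, y). {x, y} \<in> E}\<^sup>*"
    by (auto dest: symD)
qed

lemma connected_graphI:
  assumes "r \<in> V" "\<And>v. v \<in> V \<Longrightarrow> (r, v) \<in> {(x, y). {x, y} \<in> E}\<^sup>*"
  shows "connected_graph V E"
  unfolding connected_graph_def
proof (intro conjI ballI)
  fix u v assume "u \<in> V" "v \<in> V"
  then show "(u, v) \<in> {(x, y). {x, y} \<in> E}\<^sup>*"
    using edge_rel_sym[OF assms(2)[of u]] assms(2)[of v] by (auto intro: rtrancl_trans)
qed (use assms in auto)

lemma conn_graph_single_edge: "x \<noteq> y \<Longrightarrow> conn_graph {x, y} {{x, y}}"
  unfolding conn_graph_def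
  by (intro conjI connected_graphI[of x]) (auto simp: simple_graph_def intro: r_into_rtrancl)

lemma conn_graph_add_leaf:
  assumes G: "conn_graph V E" and x: "x \<in> V" and y: "y \<notin> V"
  shows "conn_graph (insert y V) (insert {x, y} E)"
proof -
  have mono: "{(x, y). {x, y} \<in> E}\<^sup>* \<subseteq> {(a, b). {a, b} \<in> insert {x, y} E}\<^sup>*"
    by (rule rtrancl_mono) auto
  have "connected_graph (insert y V) (insert {x, y} E)"
  proof (rule connected_graphI[of x])
    fix v assume "v \<in> insert y V"
    then show "(x, v) \<in> {(a, b). {a, b} \<in> insert {x, y} E}\<^sup>*"
      using G x mono by (auto simp: conn_graph_def connected_graph_def)
  qed (use x in auto)
  moreover have "card {x, y} = 2" using x y by (auto simp: card_2_iff)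
  ultimately show ?thesis using G x by (auto simp: conn_graph_def simple_graph_def)
qed

text \<open>Loop erasure: when a walk returns to a vertex already on the path, the path is cut back
  to that vertex.\<close>

lemma rtrancl_simple_path:
  assumes "(x, y) \<in> {(x, y). {x, y} \<in> E}\<^sup>*"
  obtains vs where "vs \<noteq> []" "hd vs = x" "last vs = y" "distinct vs"
    "\<And>i. Suc i < length vs \<Longrightarrow> {vs ! i, vs ! Suc i} \<in> E"
proof -
  have "\<exists>vs. vs \<noteq> [] \<and> hd vs = x \<and> last vs = y \<and> distinct vs \<and> (\<forall>i. Suc i < length vs \<longrightarrow> {vs ! i, vs ! Suc i} \<in> E)"
    using assms
  proof (induction rule: rtrancl_induct)
    case base
    show ?case by (intro exI[of _ "[x]"]) auto
  next
    case (step y z)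
    then obtain vs where vs: "vs \<noteq> []" "hd vs = x" "last vs = y" "distinct vs"
      "\<forall>i. Suc i < length vs \<longrightarrow> {vs ! i, vs ! Suc i} \<in> E" by blast
    show ?case
    proof (cases "z \<in> set vs")
      case True
      then obtain k where k: "k < length vs" "vs ! k = z" by (auto simp: in_set_conv_nth)
      show ?thesis
        using vs k by (intro exI[of _ "take (Suc k) vs"]) (auto simp: last_conv_nth)
    next
      case False
      have "{(vs @ [z]) ! i, (vs @ [z]) ! Suc i} \<in> E" if "Suc i < length (vs @ [z])" for i
      proof (cases "Suc i < length vs")
        case True
        then show ?thesis using vs(5) by (simp add: nth_append)
      next
        case False
        then have "i = length vs - 1" using that by simp
        then have "vs ! i = y" using vs(1,3) by (simp add: last_conv_nth)
        then show ?thesis using False that step.hyps(2) by (simp add: nth_append)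
      qed
      then show ?thesis
        using vs False by (intro exI[of _ "vs @ [z]"]) auto
    qed
  qed
  then show ?thesis using that by blast
qed

text \<open>An additional edge of \<open>E\<close> would close a simple path of \<open>E'\<close>
  between its end points to a cycle. The path has at least three vertices, since with two it would
  be the edge itself.\<close>

lemma spanning_subtree_eq:
  assumes T: "finite_tree V E" and G: "conn_graph V E'" and sub: "E' \<subseteq> E"
  shows "E' = E"
proof (rule ccontr)
  assume "E' \<noteq> E"
  then obtain e where e: "e \<in> E" "e \<notin> E'" using sub by auto
  have sg: "simple_graph V E" using T by (simp add: finite_tree_def)
  obtain x y where xy: "e = {x, y}" "x \<noteq> y" "x \<in> V" "y \<in> V"
    using simple_graphD[OF sg e(1)] by (auto simp: card_2_iff)
  then have "(x, y) \<in> {(x, y). {x, y} \<in> E'}\<^sup>*" using G by (auto simp: conn_graph_def connected_graph_def)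
  then obtain vs where vs: "vs \<noteq> []" "hd vs = x" "last vs = y" "distinct vs"
    "\<And>i. Suc i < length vs \<Longrightarrow> {vs ! i, vs ! Suc i} \<in> E'" using rtrancl_simple_path by metis
  have ends: "vs ! 0 = x" "vs ! (length vs - 1) = y" using vs by (auto simp: hd_conv_nth last_conv_nth)
  have "length vs \<noteq> 1" using ends xy by auto
  moreover have "length vs \<noteq> 2"
    using vs(5)[of 0] ends e xy by (auto simp: eval_nat_numeral)
  ultimately have len: "length vs \<ge> 3" using vs(1) by (cases "length vs") auto
  have "{vs ! i, vs ! (Suc i mod length vs)} \<in> E" if i: "i < length vs" for i
  proof (cases "Suc i < length vs")
    case True
    then show ?thesis using vs(5) sub by auto
  next
    case False
    then have i: "Suc i = length vs" using i by simp
    then have "vs ! i = y" using ends(2) by (metis diff_Suc_1)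
    then show ?thesis using i ends(1) e xy by (auto simp: insert_commute)
  qed
  then have "graph_cycle E vs" using len vs(4) by (simp add: graph_cycle_def)
  then show False using T by (auto simp: finite_tree_def)
qed

lemma connected_boundary_edge:
  assumes conn: "connected_graph V E" and sg: "simple_graph V E" and sub: "V' \<subset> V" "V' \<noteq> {}"
  obtains x y where "x \<in> V'" "y \<in> V - V'" "{x, y} \<in> E"
proof -
  obtain a b where ab: "a \<in> V'" "b \<in> V" "b \<notin> V'" using sub by auto
  then have "(a, b) \<in> {(x, y). {x, y} \<in> E}\<^sup>*" using conn sub by (auto simp: connected_graph_def)
  then have "b \<notin> V' \<longrightarrow> (\<exists>x y. x \<in> V' \<and> y \<notin> V' \<and> {x, y} \<in> E)"
  proof (induction rule: rtrancl_induct)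
    case (step y z)
    then show ?case by (cases "y \<in> V'") auto
  qed (use ab in auto)
  then obtain x y where xy: "x \<in> V'" "y \<notin> V'" "{x, y} \<in> E" using ab by blast
  have "y \<in> V" using simple_graphD(1)[OF sg xy(3)] by auto
  then show ?thesis using that xy by blast
qed

text \<open>As long as vertices are missing, connectedness provides an edge that leaves the current
  subgraph, and adding it attaches a leaf. When all vertices are present, acyclicity makes the edge
  sets agree. Hence a statement about one added leaf extends to arbitrary subtrees.\<close>

lemma subtree_grow_induct [consumes 4, case_names base grow]:
  assumes T: "finite_tree V E" and G: "conn_graph V0 E0" and sub: "V0 \<subseteq> V" "E0 \<subseteq> E"
    and base: "P V0 E0"
    and grow: "\<And>V' E' x y. \<lbrakk>conn_graph V' E'; V0 \<subseteq> V'; E0 \<subseteq> E'; x \<in> V'; y \<notin> V'; P V' E'\<rbrakk>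
      \<Longrightarrow> P (insert y V') (insert {x, y} E')"
  shows "P V E"
proof -
  have sg: "simple_graph V E" and fin: "finite V" and conn: "connected_graph V E"
    using T by (auto simp: finite_tree_def)
  have "P V E" if "conn_graph V' E'" "V0 \<subseteq> V'" "E0 \<subseteq> E'" "V' \<subseteq> V" "E' \<subseteq> E" "P V' E'" for V' E'
    using that
  proof (induction "card (V - V')" arbitrary: V' E' rule: less_induct)
    case less
    show ?case
    proof (cases "V' = V")
      case True
      then show ?thesis using spanning_subtree_eq[OF T, of E'] less.prems by auto
    next
      case False
      have "V' \<noteq> {}" using less.prems(1) by (auto simp: conn_graph_def connected_graph_def)
      then obtain x y where xy: "x \<in> V'" "y \<in> V - V'" "{x, y} \<in> E"
        using connected_boundary_edge[OF conn sg, of V'] False less.prems by blast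
      have "card (V - insert y V') < card (V - V')"
        using xy fin by (intro psubset_card_mono) auto
      then show ?thesis
        using xy less.prems conn_graph_add_leaf[OF less.prems(1)]
        by (intro less.hyps[of "insert y V'" "insert {x, y} E'"] grow) auto
    qed
  qed
  then show ?thesis using G sub base by blast
qed

section \<open>Monotonicity\<close>

text \<open>The value of \<open>t\<close> maximises the right-hand side.\<close>

lemma add_leaf_form_increase:
  fixes S \<Sigma> d t :: real
  assumes d: "d > 0" and S: "S > 0" and cs: "S\<^sup>2 \<le> d * \<Sigma>" and t: "t = S / (d + 2)"
  shows "(S\<^sup>2 - 2 * \<Sigma>) / d < ((S + t)\<^sup>2 - 2 * (\<Sigma> + t\<^sup>2)) / (d + 1) - t\<^sup>2"
proof -
  have S': "S = t * (d + 2)" using t d by (simp add: field_simps)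
  have "t > 0" using t S d by simp
  have cs': "t\<^sup>2 * (d + 2)\<^sup>2 \<le> d * \<Sigma>" using cs by (simp add: S' power_mult_distrib)
  have "((S + t)\<^sup>2 - 2 * (\<Sigma> + t\<^sup>2)) / (d + 1) - t\<^sup>2 - (S\<^sup>2 - 2 * \<Sigma>) / d
     = (2 * \<Sigma> - 2 * t\<^sup>2 * (d + 2)) / (d * (d + 1))"
    using d by (simp add: S' divide_simps) (simp add: power2_eq_square algebra_simps)
  \<comment> \<open>The hypothesis \<open>cs\<close> is the Cauchy-Schwarz bound. It makes \<Sigma>
    at least t^2 (d + 2)^2 / d, which exceeds t^2 (d + 2) because d + 2 > d.\<close>
  moreover have "2 * \<Sigma> - 2 * t\<^sup>2 * (d + 2) > 0"
  proof -
    have "d * (t\<^sup>2 * (d + 2)) < (d + 2) * (t\<^sup>2 * (d + 2))" using d \<open>t > 0\<close> by simp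
    also have "\<dots> \<le> d * \<Sigma>" using cs' by (simp add: power2_eq_square mult_ac)
    finally show ?thesis using d by simp
  qed
  ultimately have "((S + t)\<^sup>2 - 2 * (\<Sigma> + t\<^sup>2)) / (d + 1) - t\<^sup>2 - (S\<^sup>2 - 2 * \<Sigma>) / d > 0"
    using d by simp
  then show ?thesis by linarith
qed

text \<open>The test vector is the Perron vector of the smaller graph with one further weight
  \<open>t\<close>. In the vertex form the new leaf contributes -t^2, and the gain at
  \<open>x\<close> outweighs it, so the quadratic form becomes positive as soon as it was
  nonnegative before.\<close>

lemma ricci_max_add_leaf:
  assumes G: "conn_graph V E" and ne: "E \<noteq> {}" and x: "x \<in> V" and y: "y \<notin> V"
    and nonneg: "ricci_max E \<ge> 0"
  shows "ricci_max (insert {x, y} E) > 0"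
proof -
  have fin: "finite V" and sg: "simple_graph V E" and conn: "connected_graph V E"
    using G by (auto simp: conn_graph_def)
  have finE: "finite E" using finite_edges[OF fin sg] .
  let ?e = "{x, y}" and ?E = "insert {x, y} E"
  obtain u where u: "\<forall>e\<in>E. u e > 0" "\<forall>e\<in>E. ricci_op E u e = ricci_max E * u e"
    using ricci_max_perron[OF G ne] by metis
  have G': "conn_graph (insert y V) ?E" using conn_graph_add_leaf[OF G x y] .
  then have fin': "finite (insert y V)" and sg': "simple_graph (insert y V) ?E"
    by (auto simp: conn_graph_def)
  have eE: "?e \<notin> E" using sg y by (auto simp: simple_graph_def)
  have yE: "\<And>e. e \<in> E \<Longrightarrow> y \<notin> e" using sg y by (auto simp: simple_graph_def)
  let ?S = "weight_sum E u x" and ?\<Sigma> = "\<Sum>e\<in>{e\<in>E. x \<in> e}. (u e)\<^sup>2" and ?d = "real (vertex_degree E x)"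
  define t where "t = ?S / (?d + 2)"
  define w where "w = u(?e := t)"
  have wu: "w e = u e" if "e \<in> E" for e using that eE by (auto simp: w_def)
  have ex: "\<exists>e\<in>E. x \<in> e"
  proof -
    obtain e z where z: "e \<in> E" "z \<in> e" using ne simple_graphD[OF sg] by fastforce
    then have "(z, x) \<in> {(x, y). {x, y} \<in> E}\<^sup>*"
      using conn x simple_graphD[OF sg z(1)] by (auto simp: connected_graph_def)
    then show ?thesis
      by (cases rule: rtrancl.cases) (use z in auto)
  qed
  then have d: "?d > 0" using vertex_degree_pos[OF fin sg] by auto
  have S: "?S > 0"
    unfolding weight_sum_def using ex u(1) finE by (intro sum_pos) auto
  have t: "t > 0" using S d by (simp add: t_def)
  have cs: "?S\<^sup>2 \<le> ?d * ?\<Sigma>"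
    using Cauchy_Schwarz_ineq_sum[of "\<lambda>_. 1" u "{e\<in>E. x \<in> e}"]
    by (simp add: weight_sum_def vertex_degree_def)
  let ?q = "\<lambda>E w z. ((weight_sum E w z)\<^sup>2 - 2 * (\<Sum>e\<in>{e\<in>E. z \<in> e}. (w e)\<^sup>2)) / real (vertex_degree E z)"
  have same: "?q ?E w z = ?q E u z" if z: "z \<in> V - {x}" for z
  proof -
    have "{e \<in> ?E. z \<in> e} = {e \<in> E. z \<in> e}" using z y by auto
    moreover have "(\<Sum>e\<in>{e\<in>E. z \<in> e}. w e) = (\<Sum>e\<in>{e\<in>E. z \<in> e}. u e)"
      "(\<Sum>e\<in>{e\<in>E. z \<in> e}. (w e)\<^sup>2) = (\<Sum>e\<in>{e\<in>E. z \<in> e}. (u e)\<^sup>2)"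
      by (rule sum.cong; simp add: wu)+
    ultimately show ?thesis unfolding weight_sum_def vertex_degree_def by simp
  qed
  have "{e \<in> ?E. y \<in> e} = {?e}" using yE by auto
  then have qy: "?q ?E w y = - t\<^sup>2" by (simp add: weight_sum_def vertex_degree_def w_def)
  have Ex: "{e \<in> ?E. x \<in> e} = insert ?e {e \<in> E. x \<in> e}" by auto
  have sums: "(\<Sum>e\<in>{e\<in>E. x \<in> e}. w e) = ?S" "(\<Sum>e\<in>{e\<in>E. x \<in> e}. (w e)\<^sup>2) = ?\<Sigma>"
    unfolding weight_sum_def by (rule sum.cong; simp add: wu)+
  have "weight_sum ?E w x = ?S + t" "vertex_degree ?E x = vertex_degree E x + 1"
    "(\<Sum>e\<in>{e\<in>?E. x \<in> e}. (w e)\<^sup>2) = ?\<Sigma> + t\<^sup>2"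
    using finE eE sums w_def unfolding vertex_degree_def weight_sum_def[of ?E] Ex by simp_all
  then have qx: "?q ?E w x = ((?S + t)\<^sup>2 - 2 * (?\<Sigma> + t\<^sup>2)) / (?d + 1)" by simp
  have "0 \<le> ricci_max E * (\<Sum>e\<in>E. (u e)\<^sup>2)" using nonneg by (simp add: sum_nonneg)
  also have "\<dots> = (\<Sum>e\<in>E. u e * ricci_op E u e)"
    using u(2) by (simp add: sum_distrib_left power2_eq_square mult_ac)
  also have "\<dots> = (\<Sum>z\<in>V. ?q E u z)" by (rule ricci_form_vertex_form[OF fin sg])
  also have "\<dots> = ?q E u x + (\<Sum>z\<in>V - {x}. ?q E u z)" using x fin by (simp add: sum.remove)
  also have "?q E u x < ?q ?E w x + ?q ?E w y"
    using add_leaf_form_increase[OF d S cs t_def] qx qy by simp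
  also have "?q ?E w x + ?q ?E w y + (\<Sum>z\<in>V - {x}. ?q E u z) = (\<Sum>z\<in>insert y V. ?q ?E w z)"
    using x y fin same by (simp add: sum.remove[of V x] add_ac)
  also have "\<dots> = (\<Sum>e\<in>?E. w e * ricci_op ?E w e)"
    by (rule ricci_form_vertex_form[OF fin' sg', symmetric])
  also have "\<dots> \<le> ricci_max ?E * (\<Sum>e\<in>?E. (w e)\<^sup>2)"
  proof -
    have "\<forall>e\<in>?E. w e \<ge> 0" using u(1) t wu by (auto simp: w_def less_imp_le)
    then show ?thesis using ricci_max_perron[OF G'] by blast
  qed
  finally have "0 < ricci_max ?E * (\<Sum>e\<in>?E. (w e)\<^sup>2)" by simp
  then show ?thesis by (metis mult_nonpos_nonneg not_le sum_nonneg zero_le_power2)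
qed

lemma ricci_max_subtree:
  assumes T: "finite_tree V E" and G: "conn_graph V' E'" and sub: "V' \<subseteq> V" "E' \<subseteq> E"
    and ne: "E' \<noteq> {}" and nonneg: "ricci_max E' \<ge> 0"
  shows "(V' = V \<and> E' = E) \<or> ricci_max E > 0"
  using T G sub
proof (induction rule: subtree_grow_induct)
  case (grow V2 E2 x y)
  then have "ricci_max E2 \<ge> 0" "E2 \<noteq> {}" using nonneg ne by auto
  then show ?case using ricci_max_add_leaf[of V2 E2 x y] grow by blast
qed simp

definition graph_embeds :: "'a set \<Rightarrow> 'a set set \<Rightarrow> 'b set \<Rightarrow> 'b set set \<Rightarrow> ('a \<Rightarrow> 'b) \<Rightarrow> bool" where
  "graph_embeds V E V' E' f \<longleftrightarrow> inj_on f V \<and> f ` V \<subseteq> V' \<and> (\<forall>e\<in>E. f ` e \<in> E')"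

lemma ricci_max_embed:
  assumes T: "finite_tree V' E'" and G: "conn_graph V E" "E \<noteq> {}" and f: "graph_embeds V E V' E' f"
    and nonneg: "ricci_max E \<ge> 0"
  shows "ricci_max E' > 0 \<or> f ` V = V' \<and> (`) f ` E = E'"
proof -
  have f: "inj_on f V" "f ` V \<subseteq> V'" "(`) f ` E \<subseteq> E'" using f by (auto simp: graph_embeds_def)
  show ?thesis
    using ricci_max_subtree[OF T conn_graph_image[OF G(1) f(1)] f(2,3)] nonneg
      ricci_max_image[OF G f(1)] G(2) by auto
qed

text \<open>The image of a connected graph is a connected spanning subgraph of the tree, hence the
  whole tree. So surjectivity has to be checked on vertices only.\<close>

lemma graph_isoI_embed:
  assumes T: "finite_tree V' E'" and G: "conn_graph V E" and f: "graph_embeds V E V' E' f"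
    and onto: "V' \<subseteq> f ` V"
  shows "graph_iso V E V' E'"
proof -
  have V: "f ` V = V'" "inj_on f V" using f onto by (auto simp: graph_embeds_def)
  have "(`) f ` E = E'"
    using spanning_subtree_eq[OF T] conn_graph_image[OF G V(2)] V f by (auto simp: graph_embeds_def)
  then show ?thesis
    using V G T by (subst graph_iso_iff) (auto simp: conn_graph_def finite_tree_def bij_betw_def)
qed

lemma graph_iso_sym:
  assumes "simple_graph V E" "simple_graph V' E'" "graph_iso V E V' E'"
  shows "graph_iso V' E' V E"
proof -
  obtain f where f: "bij_betw f V V'" "\<forall>u\<in>V. \<forall>v\<in>V. {u, v} \<in> E \<longleftrightarrow> {f u, f v} \<in> E'"
    using assms(3) by (auto simp: graph_iso_def)
  let ?g = "inv_into V f"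
  have "bij_betw ?g V' V" by (rule bij_betw_inv_into[OF f(1)])
  moreover have "\<forall>u\<in>V'. f (?g u) = u \<and> ?g u \<in> V"
    using f(1) by (auto simp: bij_betw_def f_inv_into_f inv_into_into)
  ultimately show ?thesis using f unfolding graph_iso_def by metis
qed

section \<open>Caterpillars\<close>

text \<open>Every edge joins a vertex to its parent of smaller rank. At a vertex of maximal rank on
  a cycle both neighbours would be that one parent, but the neighbours on a cycle are
  distinct.\<close>

lemma no_cycle_if_ranked:
  fixes rank :: "'a \<Rightarrow> nat"
  assumes "\<And>e. e \<in> E \<Longrightarrow> \<exists>v. e = {v, p v} \<and> rank (p v) < rank v"
  shows "\<nexists>vs. graph_cycle E vs"
proof
  assume "\<exists>vs. graph_cycle E vs"
  then obtain vs where len: "length vs \<ge> 3" and dist: "distinct vs"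
    and edges: "\<And>i. i < length vs \<Longrightarrow> {vs ! i, vs ! (Suc i mod length vs)} \<in> E"
    by (auto simp: graph_cycle_def)
  let ?n = "length vs"
  obtain k where k: "k < ?n" "\<And>i. i < ?n \<Longrightarrow> rank (vs ! i) \<le> rank (vs ! k)"
  proof -
    have ne: "rank ` set vs \<noteq> {}" using len by auto
    have "Max (rank ` set vs) \<in> rank ` set vs" using ne by (intro Max_in) auto
    then obtain k where "k < ?n" "rank (vs ! k) = Max (rank ` set vs)" by (auto simp: in_set_conv_nth)
    then show ?thesis by (intro that[of k]) auto
  qed
  have parent: "b = p (vs ! k)" if "{vs ! k, b} \<in> E" "rank b \<le> rank (vs ! k)" for b
    using assms[OF that(1)] that(2) by (auto simp: doubleton_eq_iff)
  define i where "i = Suc k mod ?n"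
  \<comment> \<open>The cyclic predecessor, written by cases because subtraction on natural numbers
    does not wrap around.\<close>
  define j where "j = (if k = 0 then ?n - 1 else k - 1)"
  have ij: "i < ?n" "j < ?n" "Suc j mod ?n = k" "i \<noteq> j"
    using k(1) len by (auto simp: i_def j_def mod_Suc split: if_splits)
  have "vs ! i = p (vs ! k)" using parent edges[OF k(1)] k(2) ij(1) by (simp add: i_def)
  moreover have "vs ! j = p (vs ! k)"
    using parent[of "vs ! j"] edges[OF ij(2)] k(2) ij by (simp add: insert_commute)
  ultimately show False using nth_eq_iff_index_eq[OF dist ij(1,2)] ij(4) by simp
qed

lemma cat_edgesE:
  assumes "e \<in> cat_edges a"
  obtains i where "Suc i < length a" "e = {(i, 0), (Suc i, 0)}"
  | i j where "i < length a" "1 \<le> j" "j \<le> a ! i" "e = {(i, 0), (i, j)}"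
  using assms by (auto simp: cat_edges_def)

lemma cat_edges_spineI: "Suc i < length a \<Longrightarrow> {(i, 0), (Suc i, 0)} \<in> cat_edges a"
  by (auto simp: cat_edges_def)

lemma cat_edges_leafI: "\<lbrakk>i < length a; 1 \<le> j; j \<le> a ! i\<rbrakk> \<Longrightarrow> {(i, 0), (i, j)} \<in> cat_edges a"
  by (auto simp: cat_edges_def)

lemma finite_cat_verts: "finite (cat_verts a)"
proof -
  have "cat_verts a = (SIGMA i : {..<length a}. {..a ! i})" by (auto simp: cat_verts_def)
  then show ?thesis by simp
qed

lemma simple_graph_cat: "simple_graph (cat_verts a) (cat_edges a)"
  unfolding simple_graph_def
proof (intro ballI conjI)
  fix e assume "e \<in> cat_edges a"
  then show "e \<subseteq> cat_verts a" "card e = 2"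
    by (cases rule: cat_edgesE; simp add: cat_verts_def card_2_iff; fastforce)+
qed

lemma connected_cat:
  assumes "a \<noteq> []"
  shows "connected_graph (cat_verts a) (cat_edges a)"
proof (rule connected_graphI[of "(0, 0)"])
  let ?R = "{(x, y). {x, y} \<in> cat_edges a}"
  show "(0, 0) \<in> cat_verts a" using assms by (simp add: cat_verts_def)
  have spine: "((0, 0), (i, 0)) \<in> ?R\<^sup>*" if "i < length a" for i
    using that
  proof (induction i)
    case (Suc i)
    then have "((0, 0), (i, 0)) \<in> ?R\<^sup>*" by simp
    moreover have "((i, 0), (Suc i, 0)) \<in> ?R" using Suc.prems by (simp add: cat_edges_spineI)
    ultimately show ?case by (rule rtrancl_into_rtrancl)
  qed simp
  fix v assume "v \<in> cat_verts a"
  then obtain i j where v: "v = (i, j)" "i < length a" "j \<le> a ! i" by (auto simp: cat_verts_def)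
  show "((0, 0), v) \<in> ?R\<^sup>*"
  proof (cases "j = 0")
    case False
    then have "((i, 0), v) \<in> ?R" using v by (simp add: cat_edges_leafI)
    then show ?thesis by (rule rtrancl_into_rtrancl[OF spine[OF v(2)]])
  qed (use v spine in auto)
qed

lemma finite_tree_cat:
  assumes "a \<noteq> []"
  shows "finite_tree (cat_verts a) (cat_edges a)"
  unfolding finite_tree_def
proof (intro conjI finite_cat_verts simple_graph_cat connected_cat assms)
  show "\<nexists>vs. graph_cycle (cat_edges a) vs"
  proof (rule no_cycle_if_ranked)
    fix e assume "e \<in> cat_edges a"
    \<comment> \<open>The tree is rooted at \<open>(0, 0)\<close>, a leaf ranking one above its
      spine vertex. The truncated \<open>i - 1\<close> at the root is harmless, as the root is never
      taken for \<open>v\<close>.\<close>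
    then show "\<exists>v. e = {v, (\<lambda>(i, j). if j = 0 then (i - 1, 0) else (i, 0)) v} \<and>
        (\<lambda>(i, j). if j = 0 then i else Suc i) ((\<lambda>(i, j). if j = 0 then (i - 1, 0) else (i, 0)) v)
        < (\<lambda>(i, j). if j = 0 then i else Suc i) v"
    proof (cases rule: cat_edgesE)
      case (1 i)
      then show ?thesis by (intro exI[of _ "(Suc i, 0)"]) auto
    next
      case (2 i j)
      then show ?thesis by (intro exI[of _ "(i, j)"]) auto
    qed
  qed
qed

lemma conn_graph_cat: "a \<noteq> [] \<Longrightarrow> conn_graph (cat_verts a) (cat_edges a)"
  by (rule finite_tree_conn_graph[OF finite_tree_cat])

lemma cat_edges_nonempty: "cat_param a \<Longrightarrow> cat_edges a \<noteq> {}"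
  using cat_edges_leafI[of 0 a 1] by (auto simp: cat_param_def hd_conv_nth)

abbreviation cat_max :: "nat list \<Rightarrow> real" where
  "cat_max a \<equiv> ricci_max (cat_edges a)"

lemma cat_max_iso:
  assumes "conn_graph V E" "E \<noteq> {}" "iso_caterpillar V E a"
  shows "ricci_max E = cat_max a"
  using ricci_max_iso[OF assms(1,2) simple_graph_cat] assms(3) by (simp add: iso_caterpillar_def)

lemma cat_reversal:
  assumes "a \<noteq> []"
  defines "f \<equiv> \<lambda>(i, j :: nat). (length a - 1 - i, j)"
  shows "bij_betw f (cat_verts a) (cat_verts (rev a))" "(`) f ` cat_edges a = cat_edges (rev a)"
proof -
  have emb: "graph_embeds (cat_verts a) (cat_edges a) (cat_verts (rev a)) (cat_edges (rev a)) f"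
    unfolding graph_embeds_def
  proof (intro conjI ballI)
    show "inj_on f (cat_verts a)" by (auto simp: inj_on_def cat_verts_def f_def)
    show "f ` cat_verts a \<subseteq> cat_verts (rev a)" by (auto simp: cat_verts_def rev_nth f_def)
    fix e assume "e \<in> cat_edges a"
    then show "f ` e \<in> cat_edges (rev a)"
    proof (cases rule: cat_edgesE)
      case (1 i)
      then have "f ` e = {(length a - 2 - i, 0), (Suc (length a - 2 - i), 0)}"
        by (auto simp: doubleton_eq_iff f_def)
      then show ?thesis using 1 by (simp add: cat_edges_spineI)
    next
      case (2 i j)
      then show ?thesis by (auto simp: rev_nth f_def intro!: cat_edges_leafI)
    qed
  qed
  have onto: "cat_verts (rev a) \<subseteq> f ` cat_verts a"
  proof
    fix v assume "v \<in> cat_verts (rev a)"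
    then obtain i j where v: "v = (i, j)" "i < length a" "j \<le> rev a ! i" by (auto simp: cat_verts_def)
    then have "v = f (length a - 1 - i, j)" "(length a - 1 - i, j) \<in> cat_verts a"
      by (auto simp: cat_verts_def rev_nth f_def)
    then show "v \<in> f ` cat_verts a" by (rule image_eqI)
  qed
  show bij: "bij_betw f (cat_verts a) (cat_verts (rev a))"
    using emb onto by (auto simp: graph_embeds_def bij_betw_def)
  have "rev a \<noteq> []" using assms by simp
  moreover have "conn_graph (cat_verts (rev a)) ((`) f ` cat_edges a)"
    using conn_graph_image[OF conn_graph_cat[OF assms(1)], of f] bij by (simp add: bij_betw_def)
  moreover have "(`) f ` cat_edges a \<subseteq> cat_edges (rev a)"
    using emb by (auto simp: graph_embeds_def)
  ultimately show "(`) f ` cat_edges a = cat_edges (rev a)"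
    by (intro spanning_subtree_eq[OF finite_tree_cat])
qed

lemma cat_param_rev: "cat_param (rev a) \<longleftrightarrow> cat_param a"
  by (cases "a = []") (auto simp: cat_param_def hd_rev last_rev)

lemma cat_max_rev: "cat_param a \<Longrightarrow> cat_max (rev a) = cat_max a"
  using ricci_max_image[OF conn_graph_cat cat_edges_nonempty] cat_reversal[of a]
  by (metis bij_betw_def cat_param_def)

lemma cat_subset:
  assumes "coord_le a b"
  shows "cat_verts a \<subseteq> cat_verts b" "cat_edges a \<subseteq> cat_edges b"
proof -
  have len: "length a = length b" and le: "\<And>i. i < length a \<Longrightarrow> a ! i \<le> b ! i"
    using assms by (auto simp: list_all2_conv_all_nth)
  show "cat_verts a \<subseteq> cat_verts b" using len le by (force simp: cat_verts_def)
  show "cat_edges a \<subseteq> cat_edges b"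
  proof
    fix e assume "e \<in> cat_edges a"
    then show "e \<in> cat_edges b"
      by (cases rule: cat_edgesE) (use len le in \<open>auto intro!: cat_edges_spineI cat_edges_leafI intro: order_trans\<close>)
  qed
qed

text \<open>Turns the equality case of \<open>ricci_max_subtree\<close> back into equality of
  parameter lists.\<close>

lemma cat_verts_inject:
  assumes "cat_verts a = cat_verts b"
  shows "a = b"
proof -
  have mem: "(i < length a \<and> j \<le> a ! i) \<longleftrightarrow> (i < length b \<and> j \<le> b ! i)" for i j
    using assms by (auto simp: cat_verts_def set_eq_iff)
  have lt: "i < length a \<longleftrightarrow> i < length b" for i using mem[of i 0] by simp
  then have "length a = length b" by (metis linorder_neqE_nat less_irrefl)
  moreover have "a ! i = b ! i" if "i < length a" for i
    using mem[of i "a ! i"] mem[of i "b ! i"] that lt[of i] by auto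
  ultimately show ?thesis by (rule nth_equalityI)
qed

lemma cat_max_mono:
  assumes "cat_param a" "coord_le a b" "cat_max a \<ge> 0"
  shows "b = a \<or> cat_max b > 0"
proof -
  have "a \<noteq> []" "b \<noteq> []" using assms by (auto simp: cat_param_def)
  then show ?thesis
    using ricci_max_subtree[OF finite_tree_cat conn_graph_cat cat_subset[OF assms(2)] cat_edges_nonempty]
      assms cat_verts_inject by metis
qed

lemma cat_max_neg_antimono:
  assumes "cat_param a" "coord_le a b" "cat_max b < 0"
  shows "cat_max a < 0"
  using cat_max_mono[OF assms(1,2)] assms(3) by (metis less_asym not_less)

text \<open>The first spine vertex of \<open>T(p, x, r)\<close> plays the role of the last leaf at the first spine vertex
  of \<open>T(x + 1, r)\<close>.\<close>

lemma cat_max_extend_spine: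
  assumes a: "cat_param (Suc x # r)" and p: "p \<ge> 1" and nonneg: "cat_max (Suc x # r) \<ge> 0"
  shows "cat_max (p # x # r) > 0"
proof -
  let ?a = "Suc x # r" and ?b = "p # x # r"
  let ?f = "\<lambda>(i, j). if i = 0 \<and> j = Suc x then (0, 0) else (Suc i, j)"
  have f: "graph_embeds (cat_verts ?a) (cat_edges ?a) (cat_verts ?b) (cat_edges ?b) ?f"
    unfolding graph_embeds_def
  proof (intro conjI ballI)
    show "inj_on ?f (cat_verts ?a)" by (auto simp: inj_on_def split: if_splits)
    show "?f ` cat_verts ?a \<subseteq> cat_verts ?b"
      by (auto simp: cat_verts_def nth_Cons' split: if_splits)
    fix e assume "e \<in> cat_edges ?a"
    then show "?f ` e \<in> cat_edges ?b"
    proof (cases rule: cat_edgesE)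
      case (1 i)
      then show ?thesis using cat_edges_spineI[of "Suc i" ?b] by auto
    next
      case (2 i j)
      show ?thesis
      proof (cases "i = 0 \<and> j = Suc x")
        case True
        then show ?thesis using 2 cat_edges_spineI[of 0 ?b] by (auto simp: insert_commute)
      next
        case False
        then show ?thesis using 2 by (auto simp: nth_Cons' intro!: cat_edges_leafI split: if_splits)
      qed
    qed
  qed
  \<comment> \<open>The first leaf at the new spine vertex is missed by the embedding. This makes
    the subtree proper and the conclusion strict.\<close>
  have "(0, 1) \<in> cat_verts ?b" using p by (simp add: cat_verts_def)
  moreover have "(0, 1) \<notin> ?f ` cat_verts ?a" by (auto split: if_splits)
  ultimately have "?f ` cat_verts ?a \<noteq> cat_verts ?b" by blast
  then show ?thesis
    using ricci_max_embed[OF finite_tree_cat conn_graph_cat cat_edges_nonempty[OF a] f] nonneg by simp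
qed

section \<open>The Ricci operator on a caterpillar\<close>

text \<open>\<open>x i\<close> is the weight of the spine edge between the \<open>i\<close>-th and the next spine vertex, and \<open>y i\<close>
  the weight of the leaf edges at the \<open>i\<close>-th spine vertex.\<close>

definition cat_weight :: "(nat \<Rightarrow> real) \<Rightarrow> (nat \<Rightarrow> real) \<Rightarrow> (nat \<times> nat) set \<Rightarrow> real" where
  "cat_weight x y e = (if snd ` e = {0} then x (Min (fst ` e)) else y (Min (fst ` e)))"

definition cat_deg :: "nat list \<Rightarrow> nat \<Rightarrow> nat" where
  "cat_deg a i = a ! i + (if 0 < i then 1 else 0) + (if Suc i < length a then 1 else 0)"

definition cat_spine_sum :: "nat list \<Rightarrow> (nat \<Rightarrow> real) \<Rightarrow> nat \<Rightarrow> real" where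
  "cat_spine_sum a x i = (if 0 < i then x (i - 1) else 0) + (if Suc i < length a then x i else 0)"

lemma cat_weight_spine [simp]: "cat_weight x y {(i, 0), (Suc i, 0)} = x i"
  by (simp add: cat_weight_def)

lemma cat_weight_leaf: "1 \<le> j \<Longrightarrow> cat_weight x y {(i, 0), (i, j)} = y i"
  by (auto simp: cat_weight_def doubleton_eq_iff)

lemma cat_weight_one: "cat_weight (\<lambda>_. c) (\<lambda>_. c) = (\<lambda>_. c)"
  by (auto simp: cat_weight_def)

lemma cat_incident_spine:
  assumes "i < length a"
  shows "{e \<in> cat_edges a. (i, 0) \<in> e} = (\<lambda>j. {(i, 0), (i, j)}) ` {1..a ! i} \<union>
    ((if 0 < i then {{(i - 1, 0), (i, 0)}} else {}) \<union>
     (if Suc i < length a then {{(i, 0), (Suc i, 0)}} else {}))" (is "?L = ?R")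
proof (intro equalityI subsetI)
  fix e assume "e \<in> ?L"
  then have "e \<in> cat_edges a" "(i, 0) \<in> e" by auto
  then show "e \<in> ?R" by (cases rule: cat_edgesE) auto
next
  fix e assume "e \<in> ?R"
  then consider j where "1 \<le> j" "j \<le> a ! i" "e = {(i, 0), (i, j)}"
    | "0 < i" "e = {(i - 1, 0), (i, 0)}" | "Suc i < length a" "e = {(i, 0), (Suc i, 0)}"
    by (auto split: if_splits)
  then show "e \<in> ?L"
  proof cases
    case 2
    then show ?thesis using cat_edges_spineI[of "i - 1" a] assms by auto
  qed (use assms in \<open>auto intro: cat_edges_spineI cat_edges_leafI\<close>)
qed

lemma cat_weight_sum_spine:
  assumes i: "i < length a"
  shows "weight_sum (cat_edges a) (cat_weight x y) (i, 0) = real (a ! i) * y i + cat_spine_sum a x i"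
proof -
  let ?A = "(\<lambda>j. {(i, 0), (i, j)}) ` {1..a ! i}"
  let ?B = "if 0 < i then {{(i - 1, 0), (i, 0)}} else {}"
  let ?C = "if Suc i < length a then {{(i, 0), (Suc i, 0)}} else {}"
  let ?w = "cat_weight x y"
  have "inj_on (\<lambda>j. {(i, 0), (i, j)}) {1..a ! i}" by (auto simp: inj_on_def doubleton_eq_iff)
  then have "sum ?w ?A = (\<Sum>j\<in>{1..a ! i}. ?w {(i, 0), (i, j)})" by (simp add: sum.reindex)
  also have "\<dots> = (\<Sum>j\<in>{1..a ! i}. y i)" by (intro sum.cong) (auto simp: cat_weight_leaf)
  finally have A: "sum ?w ?A = real (a ! i) * y i" by simp
  have B: "sum ?w ?B = (if 0 < i then x (i - 1) else 0)"
    using cat_weight_spine[of x y "i - 1"] by (cases i) auto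
  have C: "sum ?w ?C = (if Suc i < length a then x i else 0)" by auto
  have BC: "?B \<inter> ?C = {}" by (cases "0 < i"; cases "Suc i < length a"; simp add: doubleton_eq_iff)
  have fstA: "fst v = i" if "v \<in> e" "e \<in> ?A" for v e using that by auto
  have AB: "{(i - 1, 0), (i, 0)} \<notin> ?A" if "0 < i"
  proof
    assume "{(i - 1, 0), (i, 0)} \<in> ?A"
    then have "fst (i - 1, 0 :: nat) = i" by (rule fstA[rotated]) (rule insertI1)
    then show False using that by simp
  qed
  have AC: "{(i, 0), (Suc i, 0)} \<notin> ?A"
  proof
    assume "{(i, 0), (Suc i, 0)} \<in> ?A"
    then have "fst (Suc i, 0 :: nat) = i" by (rule fstA[rotated]) simp
    then show False by simp
  qed
  have "?A \<inter> ?B = {}"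
    by (cases "0 < i") (simp_all only: if_True if_False Int_insert_right_if0[OF AB] Int_empty_right)
  moreover have "?A \<inter> ?C = {}"
    by (cases "Suc i < length a") (simp_all only: if_True if_False Int_insert_right_if0[OF AC] Int_empty_right)
  ultimately have ABC: "?A \<inter> (?B \<union> ?C) = {}" by (simp only: Int_Un_distrib Un_empty)
  have fin: "finite ?A" "finite ?B" "finite ?C" by simp_all
  have "sum ?w (?A \<union> (?B \<union> ?C)) = sum ?w ?A + sum ?w (?B \<union> ?C)"
    by (rule sum.union_disjoint[OF fin(1) finite_UnI[OF fin(2,3)] ABC])
  also have "sum ?w (?B \<union> ?C) = sum ?w ?B + sum ?w ?C"
    by (rule sum.union_disjoint[OF fin(2,3) BC])
  finally show ?thesis
    unfolding weight_sum_def cat_incident_spine[OF i] A B C cat_spine_sum_def .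
qed

lemma cat_weight_sum_leaf:
  assumes "i < length a" "1 \<le> j" "j \<le> a ! i"
  shows "weight_sum (cat_edges a) (cat_weight x y) (i, j) = y i"
proof -
  have "{e \<in> cat_edges a. (i, j) \<in> e} = {{(i, 0), (i, j)}}" (is "?L = ?R")
  proof (intro equalityI subsetI)
    fix e assume "e \<in> ?L"
    then have "e \<in> cat_edges a" "(i, j) \<in> e" by auto
    then show "e \<in> ?R" using assms by (cases rule: cat_edgesE) auto
  qed (use assms in \<open>auto intro: cat_edges_leafI\<close>)
  then show ?thesis using assms by (simp add: weight_sum_def cat_weight_leaf)
qed

text \<open>Lets the degree formulas be read off from the weight sums at constant weight 1.\<close>

lemma vertex_degree_eq_weight_sum: "real (vertex_degree E v) = weight_sum E (\<lambda>_. 1) v"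
  by (simp add: vertex_degree_def weight_sum_def)

lemma cat_degree_spine: "i < length a \<Longrightarrow> vertex_degree (cat_edges a) (i, 0) = cat_deg a i"
  using cat_weight_sum_spine[of i a "\<lambda>_. 1" "\<lambda>_. 1"] vertex_degree_eq_weight_sum[of "cat_edges a" "(i, 0)"]
  by (auto simp: cat_weight_one cat_deg_def cat_spine_sum_def)

lemma cat_degree_leaf: "\<lbrakk>i < length a; 1 \<le> j; j \<le> a ! i\<rbrakk> \<Longrightarrow> vertex_degree (cat_edges a) (i, j) = 1"
  using cat_weight_sum_leaf[of i a j "\<lambda>_. 1" "\<lambda>_. 1"] vertex_degree_eq_weight_sum[of "cat_edges a" "(i, j)"]
  by (auto simp: cat_weight_one)

lemma cat_op_spine:
  assumes i: "Suc i < length a"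
  shows "ricci_op (cat_edges a) (cat_weight x y) {(i, 0), (Suc i, 0)} =
    (real (a ! i) * y i + cat_spine_sum a x i - 2 * x i) / cat_deg a i +
    (real (a ! Suc i) * y (Suc i) + cat_spine_sum a x (Suc i) - 2 * x i) / cat_deg a (Suc i)"
  using ricci_op_vertex_form[OF finite_cat_verts simple_graph_cat cat_edges_spineI[OF i], of "cat_weight x y"] i
  by (simp add: cat_weight_sum_spine cat_degree_spine)

lemma cat_op_leaf:
  assumes i: "i < length a" "1 \<le> j" "j \<le> a ! i"
  shows "ricci_op (cat_edges a) (cat_weight x y) {(i, 0), (i, j)} =
    (real (a ! i) * y i + cat_spine_sum a x i - 2 * y i) / cat_deg a i - y i"
  using ricci_op_vertex_form[OF finite_cat_verts simple_graph_cat cat_edges_leafI[OF i], of "cat_weight x y"] i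
  by (simp add: cat_weight_sum_spine cat_weight_sum_leaf cat_degree_spine cat_degree_leaf cat_weight_leaf)

text \<open>The leaf weights that make the Ricci operator vanish on the leaf edges.\<close>

definition cat_leaf_weight :: "nat list \<Rightarrow> (nat \<Rightarrow> real) \<Rightarrow> nat \<Rightarrow> real" where
  "cat_leaf_weight a x i = cat_spine_sum a x i / (real (cat_deg a i) + 2 - real (a ! i))"

text \<open>The share of the \<open>i\<close>-th spine vertex in the operator on an adjacent spine
  edge of weight \<open>t\<close>, namely (S - 2t)/d, where S already includes the eliminated
  leaves. At a leafless interior vertex it is half the difference of the two spine weights; at an
  end with \<open>p\<close> leaves, where \<open>t\<close> is the only spine weight, it equals
  \<open>(p - 3) * t / (3 * (p + 1))\<close>.\<close>

definition cat_flux :: "nat list \<Rightarrow> (nat \<Rightarrow> real) \<Rightarrow> nat \<Rightarrow> real \<Rightarrow> real" where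
  "cat_flux a x i t = ((real (cat_deg a i) + 2) / (real (cat_deg a i) + 2 - real (a ! i)) * cat_spine_sum a x i
     - 2 * t) / cat_deg a i"

definition cat_residual :: "nat list \<Rightarrow> (nat \<Rightarrow> real) \<Rightarrow> nat \<Rightarrow> real" where
  "cat_residual a x i = cat_flux a x i (x i) + cat_flux a x (Suc i) (x i)"

lemma cat_deg_ge: "cat_deg a i \<ge> a ! i" by (simp add: cat_deg_def)

lemma cat_leaf_total:
  "real (a ! i) * cat_leaf_weight a x i + cat_spine_sum a x i =
   (real (cat_deg a i) + 2) / (real (cat_deg a i) + 2 - real (a ! i)) * cat_spine_sum a x i"
proof -
  have "real (cat_deg a i) + 2 - real (a ! i) \<noteq> 0" using cat_deg_ge[of a i] by linarith
  then show ?thesis by (simp add: cat_leaf_weight_def divide_simps) (simp add: algebra_simps)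
qed

lemma cat_residual_spine:
  assumes "Suc i < length a"
  shows "ricci_op (cat_edges a) (cat_weight x (cat_leaf_weight a x)) {(i, 0), (Suc i, 0)} = cat_residual a x i"
  by (simp add: cat_op_spine[OF assms] cat_leaf_total cat_residual_def cat_flux_def)

lemma cat_residual_leaf:
  assumes i: "i < length a" "1 \<le> j" "j \<le> a ! i"
  shows "ricci_op (cat_edges a) (cat_weight x (cat_leaf_weight a x)) {(i, 0), (i, j)} = 0"
proof -
  have D: "real (cat_deg a i) + 2 - real (a ! i) > 0" "real (cat_deg a i) > 0"
    using cat_deg_ge[of a i] i by linarith+
  show ?thesis
    unfolding cat_op_leaf[OF i] cat_leaf_total using D
    by (simp add: cat_leaf_weight_def divide_simps) (simp add: algebra_simps)
qed

lemma cat_leaf_weight_nonneg: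
  assumes "\<And>i. Suc i < length a \<Longrightarrow> x i \<ge> 0" "i < length a"
  shows "cat_leaf_weight a x i \<ge> 0"
proof -
  have "cat_spine_sum a x i \<ge> 0"
    using assms(1)[of i] assms(1)[of "i - 1"] assms(2) by (auto simp: cat_spine_sum_def)
  then show ?thesis using cat_deg_ge[of a i] by (simp add: cat_leaf_weight_def)
qed

lemma cat_leaf_weight_pos:
  assumes "\<And>i. Suc i < length a \<Longrightarrow> x i > 0" "i < length a" "length a \<ge> 2"
  shows "cat_leaf_weight a x i > 0"
proof -
  have "cat_spine_sum a x i > 0"
    using assms(1)[of i] assms(1)[of "i - 1"] assms(2,3) by (auto simp: cat_spine_sum_def intro: add_pos_pos)
  then show ?thesis using cat_deg_ge[of a i] by (simp add: cat_leaf_weight_def)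
qed

lemma cat_max_negI:
  assumes ne: "a \<noteq> []" and x: "\<And>i. Suc i < length a \<Longrightarrow> x i \<ge> 0"
    and res: "\<And>i. Suc i < length a \<Longrightarrow> cat_residual a x i \<le> 0"
    and k: "Suc k < length a" "cat_residual a x k < 0"
  shows "cat_max a < 0"
proof (rule ricci_max_negI[OF conn_graph_cat[OF ne]])
  let ?w = "cat_weight x (cat_leaf_weight a x)"
  show "{(k, 0), (Suc k, 0)} \<in> cat_edges a" "ricci_op (cat_edges a) ?w {(k, 0), (Suc k, 0)} < 0"
    using k by (auto simp: cat_edges_spineI cat_residual_spine)
  show "\<forall>e\<in>cat_edges a. ?w e \<ge> 0"
    using x cat_leaf_weight_nonneg[OF x] by (auto elim!: cat_edgesE simp: cat_weight_leaf)
  show "\<forall>e\<in>cat_edges a. ricci_op (cat_edges a) ?w e \<le> 0"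
    using res by (auto elim!: cat_edgesE simp: cat_residual_spine cat_residual_leaf)
qed

lemma cat_max_posI:
  assumes ne: "a \<noteq> []" and x: "\<And>i. Suc i < length a \<Longrightarrow> x i \<ge> 0"
    and res: "\<And>i. Suc i < length a \<Longrightarrow> cat_residual a x i \<ge> 0"
    and k: "Suc k < length a" "cat_residual a x k > 0"
  shows "cat_max a > 0"
proof (rule ricci_max_posI[OF conn_graph_cat[OF ne]])
  let ?w = "cat_weight x (cat_leaf_weight a x)"
  show "{(k, 0), (Suc k, 0)} \<in> cat_edges a" "ricci_op (cat_edges a) ?w {(k, 0), (Suc k, 0)} > 0"
    using k by (auto simp: cat_edges_spineI cat_residual_spine)
  show "\<forall>e\<in>cat_edges a. ?w e \<ge> 0"
    using x cat_leaf_weight_nonneg[OF x] by (auto elim!: cat_edgesE simp: cat_weight_leaf)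
  show "\<forall>e\<in>cat_edges a. ricci_op (cat_edges a) ?w e \<ge> 0"
    using res by (auto elim!: cat_edgesE simp: cat_residual_spine cat_residual_leaf)
qed

lemma cat_max_zeroI:
  assumes len: "length a \<ge> 2" and x: "\<And>i. Suc i < length a \<Longrightarrow> x i > 0"
    and res: "\<And>i. Suc i < length a \<Longrightarrow> cat_residual a x i = 0"
  shows "cat_max a = 0"
proof (rule ricci_max_zeroI[OF conn_graph_cat])
  let ?w = "cat_weight x (cat_leaf_weight a x)"
  show "a \<noteq> []" using len by auto
  show "cat_edges a \<noteq> {}" using len cat_edges_spineI[of 0 a] by auto
  show "\<forall>e\<in>cat_edges a. ?w e > 0"
    using x cat_leaf_weight_pos[OF x _ len] by (auto elim!: cat_edgesE simp: cat_weight_leaf)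
  show "\<forall>e\<in>cat_edges a. ricci_op (cat_edges a) ?w e = 0"
    using res by (auto elim!: cat_edgesE simp: cat_residual_spine cat_residual_leaf)
qed

text \<open>A star has no spine edge, so leaf elimination has nothing to act on. With constant
  weights every edge receives (n - 2)/n - 1 = -2/n.\<close>

lemma cat_max_star:
  assumes "n \<ge> 1"
  shows "cat_max [n] < 0"
proof (rule ricci_max_negI[OF conn_graph_cat])
  have op: "ricci_op (cat_edges [n]) (cat_weight (\<lambda>_. 1) (\<lambda>_. 1)) {(0, 0), (0, j)} < 0"
    if "1 \<le> j" "j \<le> n" for j
    using cat_op_leaf[of 0 "[n]" j "\<lambda>_. 1" "\<lambda>_. 1"] that
    by (simp add: cat_deg_def cat_spine_sum_def diff_divide_distrib)
  show "{(0, 0), (0, 1)} \<in> cat_edges [n]" using assms cat_edges_leafI[of 0 "[n]" 1] by simp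
  show "ricci_op (cat_edges [n]) (cat_weight (\<lambda>_. 1) (\<lambda>_. 1)) {(0, 0), (0, 1)} < 0"
    using op[of 1] assms by simp
  show "\<forall>e\<in>cat_edges [n]. cat_weight (\<lambda>_. 1) (\<lambda>_. 1) e \<ge> 0" by (simp add: cat_weight_def)
  show "\<forall>e\<in>cat_edges [n]. ricci_op (cat_edges [n]) (cat_weight (\<lambda>_. 1) (\<lambda>_. 1)) e \<le> 0"
    by (auto elim!: cat_edgesE intro!: less_imp_le[OF op])
qed simp

section \<open>Trees that are not caterpillars\<close>

lemma simple_graph_S32: "simple_graph S32_verts S32_edges"
  by (auto simp: simple_graph_def S32_verts_def S32_edges_def)

lemma connected_S32: "connected_graph S32_verts S32_edges"
proof (rule connected_graphI[of 0])
  let ?R = "{(x, y). {x, y} \<in> S32_edges}"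
  have "(0, 1) \<in> ?R" "(0, 2) \<in> ?R" "(0, 3) \<in> ?R" "(1, 4) \<in> ?R" "(2, 5) \<in> ?R" "(3, 6) \<in> ?R"
    by (simp_all add: S32_edges_def)
  then have "(0, 1) \<in> ?R\<^sup>*" "(0, 2) \<in> ?R\<^sup>*" "(0, 3) \<in> ?R\<^sup>*" "(0, 4) \<in> ?R\<^sup>*" "(0, 5) \<in> ?R\<^sup>*" "(0, 6) \<in> ?R\<^sup>*"
    by (meson r_into_rtrancl rtrancl_into_rtrancl)+
  then show "(0, v) \<in> ?R\<^sup>*" if "v \<in> S32_verts" for v
    using that unfolding S32_verts_def by blast
qed (simp add: S32_verts_def)

lemma conn_graph_S32: "conn_graph S32_verts S32_edges"
  using simple_graph_S32 connected_S32 by (simp add: conn_graph_def S32_verts_def)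

lemma S32_edges_nonempty: "S32_edges \<noteq> {}"
  by (simp add: S32_edges_def)

lemma ricci_max_S32: "ricci_max S32_edges = 0"
proof (rule ricci_max_zeroI[OF conn_graph_S32 S32_edges_nonempty])
  \<comment> \<open>Balancing an outer edge of weight 1 against an inner one of weight
    \<open>c\<close> gives (c - 1)/2 = 1, so c = 3. At an inner edge the centre then contributes 1
    and the middle vertex -1.\<close>
  let ?w = "\<lambda>e. if (0 :: nat) \<in> e then 3 else 1 :: real"
  show "\<forall>e\<in>S32_edges. ?w e > 0" by simp
  have inc: "{e \<in> S32_edges. 0 \<in> e} = {{0, 1}, {0, 2}, {0, 3}}"
    "{e \<in> S32_edges. 1 \<in> e} = {{0, 1}, {1, 4}}" "{e \<in> S32_edges. 2 \<in> e} = {{0, 2}, {2, 5}}"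
    "{e \<in> S32_edges. 3 \<in> e} = {{0, 3}, {3, 6}}" "{e \<in> S32_edges. 4 \<in> e} = {{1, 4}}"
    "{e \<in> S32_edges. 5 \<in> e} = {{2, 5}}" "{e \<in> S32_edges. 6 \<in> e} = {{3, 6}}"
    by (auto simp: S32_edges_def)
  have deg: "vertex_degree S32_edges 0 = 3" "vertex_degree S32_edges 1 = 2" "vertex_degree S32_edges 2 = 2"
    "vertex_degree S32_edges 3 = 2" "vertex_degree S32_edges 4 = 1" "vertex_degree S32_edges 5 = 1"
    "vertex_degree S32_edges 6 = 1"
    unfolding vertex_degree_def inc by (simp_all add: doubleton_eq_iff)
  have ws: "weight_sum S32_edges ?w 0 = 9" "weight_sum S32_edges ?w 1 = 4" "weight_sum S32_edges ?w 2 = 4"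
    "weight_sum S32_edges ?w 3 = 4" "weight_sum S32_edges ?w 4 = 1" "weight_sum S32_edges ?w 5 = 1"
    "weight_sum S32_edges ?w 6 = 1"
    unfolding weight_sum_def inc by (simp_all add: doubleton_eq_iff)
  show "\<forall>e\<in>S32_edges. ricci_op S32_edges ?w e = 0"
  proof
    fix e assume e: "e \<in> S32_edges"
    have fin: "finite S32_verts" by (simp add: S32_verts_def)
    have pair: "(\<Sum>z\<in>{m, n}. F z) = F m + F n" if "m \<noteq> n" for m n :: nat and F :: "nat \<Rightarrow> real"
      using that by simp
    have "e = {0, 1} \<or> e = {0, 2} \<or> e = {0, 3} \<or> e = {1, 4} \<or> e = {2, 5} \<or> e = {3, 6}"
      using e by (simp add: S32_edges_def)
    then have "(\<Sum>z\<in>e. (weight_sum S32_edges ?w z - 2 * ?w e) / vertex_degree S32_edges z) = 0"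
      by (elim disjE) (simp_all add: pair deg ws del: One_nat_def sum.insert)
    then show "ricci_op S32_edges ?w e = 0"
      unfolding ricci_op_vertex_form[OF fin simple_graph_S32 e] .
  qed
qed

text \<open>A new leaf can force a renumbering of the spine. The old caterpillar is therefore
  re-embedded by \<open>h\<close> into the new one so that exactly one vertex \<open>p\<close> is
  left over, and the new leaf is sent there.\<close>

lemma graph_iso_add_leaf:
  assumes G: "conn_graph V E" and g: "bij_betw g V (cat_verts a)" "(`) g ` E = cat_edges a"
    and xy: "x \<in> V" "y \<notin> V" and a': "a' \<noteq> []"
    and h: "graph_embeds (cat_verts a) (cat_edges a) (cat_verts a') (cat_edges a') h"
    and p: "p \<notin> h ` cat_verts a" "cat_verts a' = insert p (h ` cat_verts a)" "{h (g x), p} \<in> cat_edges a'"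
  shows "graph_iso (insert y V) (insert {x, y} E) (cat_verts a') (cat_edges a')"
proof (rule graph_isoI_embed[OF finite_tree_cat[OF a'] conn_graph_add_leaf[OF G xy]])
  let ?f = "\<lambda>v. if v = y then p else h (g v)"
  have inj: "inj_on (h \<circ> g) V"
    using g h by (intro comp_inj_on) (auto simp: bij_betw_def graph_embeds_def)
  have img: "h ` g ` V = h ` cat_verts a" using g by (simp add: bij_betw_def)
  have fV: "?f ` V = h ` g ` V" using xy by auto
  show "graph_embeds (insert y V) (insert {x, y} E) (cat_verts a') (cat_edges a') ?f"
    unfolding graph_embeds_def
  proof (intro conjI ballI)
    show "inj_on ?f (insert y V)"
    proof (subst inj_on_insert, intro conjI)
      show "inj_on ?f V" using inj xy by (auto simp: inj_on_def)
      show "?f y \<notin> ?f ` (V - {y})" using p(1) img fV xy by auto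
    qed
    show "?f ` insert y V \<subseteq> cat_verts a'" using fV img p by auto
    fix e assume "e \<in> insert {x, y} E"
    then consider "e = {x, y}" | "e \<in> E" by auto
    then show "?f ` e \<in> cat_edges a'"
    proof cases
      case 1
      have "x \<noteq> y" using xy by auto
      then show ?thesis using 1 p(3) by (simp add: insert_commute)
    next
      case 2
      have "y \<notin> e" using 2 xy G by (auto simp: conn_graph_def simple_graph_def)
      then have "?f ` e = h ` g ` e" by (auto simp: image_iff)
      moreover have "g ` e \<in> cat_edges a" using g(2) 2 by auto
      ultimately show ?thesis using h by (simp add: graph_embeds_def)
    qed
  qed
  show "cat_verts a' \<subseteq> ?f ` insert y V" using p(2) img fV by auto
qed

lemma embeds_increase_leaf:
  assumes i: "i < length a"
  defines "a' \<equiv> a[i := Suc (a ! i)]"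
  shows "graph_embeds (cat_verts a) (cat_edges a) (cat_verts a') (cat_edges a') id"
    and "(i, Suc (a ! i)) \<notin> id ` cat_verts a"
    and "cat_verts a' = insert (i, Suc (a ! i)) (id ` cat_verts a)"
    and "{(i, 0), (i, Suc (a ! i))} \<in> cat_edges a'"
proof -
  have "coord_le a a'" by (simp add: list_all2_conv_all_nth a'_def nth_list_update i)
  from cat_subset[OF this]
  show "graph_embeds (cat_verts a) (cat_edges a) (cat_verts a') (cat_edges a') id"
    by (auto simp: graph_embeds_def)
  show "(i, Suc (a ! i)) \<notin> id ` cat_verts a" by (simp add: cat_verts_def)
  show "cat_verts a' = insert (i, Suc (a ! i)) (id ` cat_verts a)"
    using i by (auto simp: cat_verts_def a'_def nth_list_update split: if_splits)
  show "{(i, 0), (i, Suc (a ! i))} \<in> cat_edges a'"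
    using i by (intro cat_edges_leafI) (auto simp: a'_def)
qed

text \<open>A leaf hung on the leaf \<open>(0, j)\<close> turns that leaf into a new first spine
  vertex. The old spine moves up by one, the leaves numbered above \<open>j\<close> close the gap,
  and the new leaf becomes \<open>(0, 1)\<close>.\<close>

lemma embeds_new_end:
  assumes j: "1 \<le> j" "j \<le> c"
  defines "h \<equiv> \<lambda>(i, k). if i = 0 \<and> k = j then (0, 0) else if i = 0 \<and> j < k then (1, k - 1) else (Suc i, k)"
  shows "graph_embeds (cat_verts (c # r)) (cat_edges (c # r)) (cat_verts (1 # (c - 1) # r)) (cat_edges (1 # (c - 1) # r)) h"
    and "(0, 1) \<notin> h ` cat_verts (c # r)"
    and "cat_verts (1 # (c - 1) # r) = insert (0, 1) (h ` cat_verts (c # r))"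
    and "{h (0, j), (0, 1)} \<in> cat_edges (1 # (c - 1) # r)"
proof -
  let ?a = "c # r" and ?b = "1 # (c - 1) # r"
  have sub: "h ` cat_verts ?a \<subseteq> cat_verts ?b"
    using j by (auto simp: cat_verts_def h_def nth_Cons' split: if_splits)
  show "graph_embeds (cat_verts ?a) (cat_edges ?a) (cat_verts ?b) (cat_edges ?b) h"
    unfolding graph_embeds_def
  proof (intro conjI ballI sub)
    show "inj_on h (cat_verts ?a)" by (auto simp: inj_on_def h_def split: if_splits)
    fix e assume "e \<in> cat_edges ?a"
    then show "h ` e \<in> cat_edges ?b"
    proof (cases rule: cat_edgesE)
      case (1 i)
      then show ?thesis using cat_edges_spineI[of "Suc i" ?b] j by (auto simp: h_def)
    next
      case (2 i k)
      consider "i = 0" "k = j" | "i = 0" "j < k" | "i = 0" "k < j" | "i \<noteq> 0" by linarith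
      then show ?thesis
      proof cases
        case 1
        then show ?thesis using 2 j cat_edges_spineI[of 0 ?b] by (auto simp: h_def insert_commute)
      next
        case i: 2
        then show ?thesis using 2 j cat_edges_leafI[of 1 ?b "k - 1"] by (auto simp: h_def)
      next
        case 3
        then show ?thesis using 2 j cat_edges_leafI[of 1 ?b k] by (auto simp: h_def)
      next
        case 4
        then show ?thesis using 2 cat_edges_leafI[of "Suc i" ?b k] by (auto simp: h_def nth_Cons')
      qed
    qed
  qed
  show new: "(0, 1) \<notin> h ` cat_verts ?a" by (auto simp: h_def split: if_splits)
  show "cat_verts ?b = insert (0, 1) (h ` cat_verts ?a)"
  proof (intro equalityI subsetI)
    fix v assume "v \<in> cat_verts ?b"
    then obtain i k where v: "v = (i, k)" "i < length ?b" "k \<le> ?b ! i" by (auto simp: cat_verts_def)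
    consider "i = 0" "k = 0" | "i = 0" "k = 1" | "i = 1" "k < j" | "i = 1" "j \<le> k" | "i > 1"
    proof -
      have "k \<le> 1" if "i = 0" using v that by simp
      then show thesis using that by linarith
    qed
    then show "v \<in> insert (0, 1) (h ` cat_verts ?a)"
    proof cases
      case 1
      then have "v = h (0, j)" "(0, j) \<in> cat_verts ?a" using v j by (auto simp: h_def cat_verts_def)
      then show ?thesis by blast
    next
      case 3
      then have "v = h (0, k)" "(0, k) \<in> cat_verts ?a" using v j by (auto simp: h_def cat_verts_def)
      then show ?thesis by blast
    next
      case 4
      then have "v = h (0, Suc k)" "(0, Suc k) \<in> cat_verts ?a" using v j by (auto simp: h_def cat_verts_def)
      then show ?thesis by blast
    next
      case 5
      then have "v = h (i - 1, k)" "(i - 1, k) \<in> cat_verts ?a"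
        using v j by (auto simp: h_def cat_verts_def nth_Cons')
      then show ?thesis by blast
    qed (use v in simp)
  qed (use sub in \<open>auto simp: cat_verts_def\<close>)
  show "{h (0, j), (0, 1)} \<in> cat_edges ?b"
    using cat_edges_leafI[of 0 ?b 1] by (simp add: h_def)
qed

text \<open>For a single edge \<open>embeds_new_end\<close> would produce \<open>[1, 0]\<close>,
  which violates \<open>cat_param\<close>. Exchanging the two end points makes the vertex that
  receives the leaf the centre of a star instead.\<close>

lemma embeds_single_edge_swap:
  defines "h \<equiv> \<lambda>v :: nat \<times> nat. if v = (0, 0) then (0, 1) else (0, 0)"
  shows "graph_embeds (cat_verts [1]) (cat_edges [1]) (cat_verts [2]) (cat_edges [2]) h"
    and "(0, 2) \<notin> h ` cat_verts [1]"
    and "cat_verts [2] = insert (0, 2) (h ` cat_verts [1])"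
    and "{h (0, 1), (0, 2)} \<in> cat_edges [2]"
proof -
  have V: "cat_verts [1] = {(0, 0), (0, 1)}" "cat_verts [2] = {(0, 0), (0, 1), (0, 2)}"
    by (auto simp: cat_verts_def)
  have E: "cat_edges [1] = {{(0, 0), (0, 1)}}"
  proof (intro equalityI subsetI)
    fix e assume "e \<in> cat_edges [1]"
    then show "e \<in> {{(0, 0), (0, 1)}}"
    proof (cases rule: cat_edgesE)
      case (2 i j)
      then have "i = 0" by simp
      moreover from this have "j = 1" using 2 by simp
      ultimately show ?thesis using 2 by simp
    qed simp
  qed (use cat_edges_leafI[of 0 "[1]" 1] in simp)
  have "{(0, 1), (0, 0)} \<in> cat_edges [2]"
    by (subst insert_commute, rule cat_edges_leafI) simp_all
  then show "graph_embeds (cat_verts [1]) (cat_edges [1]) (cat_verts [2]) (cat_edges [2]) h"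
    using cat_edges_leafI[of 0 "[2]" 1] unfolding graph_embeds_def V E by (simp add: h_def)
  show "(0, 2) \<notin> h ` cat_verts [1]" unfolding V by (simp add: h_def)
  show "cat_verts [2] = insert (0, 2) (h ` cat_verts [1])" unfolding V by (auto simp: h_def)
  show "{h (0, 1), (0, 2)} \<in> cat_edges [2]"
    using cat_edges_leafI[of 0 "[2]" 2] by (simp add: h_def)
qed

lemma S32_verts_eq: "S32_verts = {..<7}"
  by (auto simp: S32_verts_def)

lemma embeds_S32I:
  assumes "distinct [A, B, C, D, B', C', D']" "set [A, B, C, D, B', C', D'] \<subseteq> V"
    and "{A, B} \<in> E" "{A, C} \<in> E" "{A, D} \<in> E" "{B, B'} \<in> E" "{C, C'} \<in> E" "{D, D'} \<in> E"
  shows "\<exists>f. graph_embeds S32_verts S32_edges V E f"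
proof (rule exI[of _ "(!) [A, B, C, D, B', C', D']"], unfold graph_embeds_def, intro conjI)
  let ?l = "[A, B, C, D, B', C', D']"
  show "inj_on ((!) ?l) S32_verts"
    unfolding S32_verts_eq by (rule inj_on_nth[OF assms(1)]) auto
  show "(!) ?l ` S32_verts \<subseteq> V"
  proof
    fix v assume "v \<in> (!) ?l ` S32_verts"
    then obtain i where i: "i \<in> {..<7}" "v = ?l ! i" unfolding S32_verts_eq by blast
    then have "i < length ?l" by simp
    then show "v \<in> V" using nth_mem[of i ?l] i(2) assms(2) by blast
  qed
  show "\<forall>e\<in>S32_edges. (!) ?l ` e \<in> E"
    using assms by (simp add: S32_edges_def)
qed

text \<open>The centre of the subdivided star is the spine vertex \<open>(i, 0)\<close>. Two arms
  run along the spine in both directions, and the third consists of the leaf \<open>x\<close> and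
  the new vertex \<open>y\<close>.\<close>

lemma caterpillar_add_interior:
  assumes G: "simple_graph V E" and g: "bij_betw g V (cat_verts a)" "(`) g ` E = cat_edges a"
    and a: "cat_param a" and xy: "x \<in> V" "y \<notin> V"
    and gx: "g x = (i, j)" and i: "0 < i" "Suc i < length a" and j: "1 \<le> j"
  shows "\<exists>f. graph_embeds S32_verts S32_edges (insert y V) (insert {x, y} E) f"
proof -
  let ?k = "inv_into V g"
  have k: "?k v \<in> V" "g (?k v) = v" if "v \<in> cat_verts a" for v
    using that g(1) by (auto simp: bij_betw_def inv_into_into f_inv_into_f)
  have kx: "?k (g x) = x" using g(1) xy by (simp add: bij_betw_def)
  have k_eq: "?k u = ?k v \<longleftrightarrow> u = v" if "u \<in> cat_verts a" "v \<in> cat_verts a" for u v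
    using k that by metis
  have kE: "{?k u, ?k v} \<in> E" if "{u, v} \<in> cat_edges a" for u v
  proof -
    have "{u, v} \<in> (`) g ` E" unfolding g(2) using that .
    then obtain e where e: "e \<in> E" "{u, v} = g ` e" by auto
    have "?k ` g ` e = e"
      using inv_into_image_cancel[of g V e] simple_graphD(1)[OF G e(1)] g(1) by (simp add: bij_betw_def)
    then have "?k ` {u, v} = e" unfolding e(2) .
    then show ?thesis using e(1) by simp
  qed
  have ij: "(i, j) \<in> cat_verts a" using imageI[OF xy(1), of g] g(1) gx by (simp add: bij_betw_def)
  then have ja: "j \<le> a ! i" by (simp add: cat_verts_def)
  have ends: "a ! 0 \<ge> 1" "a ! (length a - 1) \<ge> 1"
    using a by (auto simp: cat_param_def hd_conv_nth last_conv_nth)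
  \<comment> \<open>The outer vertex of a spine arm is the next spine vertex, or at the end of the
    spine a leaf, which exists because the end entries are at least 1.\<close>
  obtain b where b: "b \<in> cat_verts a" "{(i - 1, 0), b} \<in> cat_edges a" "b \<noteq> (i, 0)" "b \<noteq> (i - 1, 0)"
    "fst b < i"
  proof (cases "i = 1")
    case True
    have "{(0, 0), (0, 1)} \<in> cat_edges a" using ends i by (intro cat_edges_leafI) auto
    moreover have "(0, 1) \<in> cat_verts a" using ends i by (auto simp: cat_verts_def)
    ultimately show ?thesis using that[of "(0, 1)"] True by simp
  next
    case False
    have "{(i - 2, 0), (Suc (i - 2), 0)} \<in> cat_edges a" using i by (intro cat_edges_spineI) auto
    moreover have "Suc (i - 2) = i - 1" using False i by simp
    ultimately show ?thesis using that[of "(i - 2, 0)"] False i by (auto simp: cat_verts_def insert_commute)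
  qed
  obtain c where c: "c \<in> cat_verts a" "{(Suc i, 0), c} \<in> cat_edges a" "c \<noteq> (Suc i, 0)" "i < fst c"
  proof (cases "Suc (Suc i) < length a")
    case True
    then show ?thesis using that[of "(Suc (Suc i), 0)"] cat_edges_spineI[OF True] by (auto simp: cat_verts_def)
  next
    case False
    then have "Suc i = length a - 1" using i by simp
    then show ?thesis using that[of "(Suc i, 1)"] cat_edges_leafI[of "Suc i" a 1] ends i
      by (auto simp: cat_verts_def)
  qed
  have spine: "(i, 0) \<in> cat_verts a" "(i - 1, 0) \<in> cat_verts a" "(Suc i, 0) \<in> cat_verts a"
    using i by (auto simp: cat_verts_def)
  note vs = spine b(1) c(1) ij
  have dist: "distinct [(i, 0), (i - 1, 0), (Suc i, 0), (i, j), b, c]"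
    using b c i j by auto
  have kS: "{?k (i, 0), ?k (i - 1, 0)} \<in> E"
    using kE[of "(i - 1, 0)" "(i, 0)"] cat_edges_spineI[of "i - 1" a] i by (simp add: insert_commute)
  show ?thesis
  proof (rule embeds_S32I)
    show "distinct [?k (i, 0), ?k (i - 1, 0), ?k (Suc i, 0), x, ?k b, ?k c, y]"
      using dist k_eq[OF vs(1)] k_eq[OF vs(2)] k_eq[OF vs(3)] k_eq[OF vs(4)] k_eq[OF vs(5)] k_eq[OF vs(6)]
        vs k(1)[OF vs(1)] k(1)[OF vs(2)] k(1)[OF vs(3)] k(1)[OF vs(4)] k(1)[OF vs(5)] xy kx[unfolded gx, symmetric]
      by auto
    show "set [?k (i, 0), ?k (i - 1, 0), ?k (Suc i, 0), x, ?k b, ?k c, y] \<subseteq> insert y V"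
      using k(1) vs xy by simp
    show "{?k (i, 0), ?k (i - 1, 0)} \<in> insert {x, y} E" using kS by simp
    show "{?k (i, 0), ?k (Suc i, 0)} \<in> insert {x, y} E" using kE cat_edges_spineI i by simp
    show "{?k (i, 0), x} \<in> insert {x, y} E"
      using kE[of "(i, 0)" "(i, j)"] cat_edges_leafI[of i a j] kx gx i j ja by simp
    show "{?k (i - 1, 0), ?k b} \<in> insert {x, y} E" using kE b by simp
    show "{?k (Suc i, 0), ?k c} \<in> insert {x, y} E" using kE c by simp
    show "{x, y} \<in> insert {x, y} E" by simp
  qed
qed

lemma caterpillar_add_end_leaf:
  assumes G: "conn_graph V E" and g: "bij_betw g V (cat_verts a)" "(`) g ` E = cat_edges a"
    and a: "cat_param a" and xy: "x \<in> V" "y \<notin> V" and gx: "g x = (0, j)" and j: "1 \<le> j"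
  shows "is_caterpillar (insert y V) (insert {x, y} E)"
proof -
  obtain c r where cr: "a = c # r" using a by (cases a) (auto simp: cat_param_def)
  have "g x \<in> cat_verts a" using g(1) xy by (auto simp: bij_betw_def)
  then have jc: "j \<le> c" using gx cr by (simp add: cat_verts_def)
  show ?thesis
  proof (cases "c = 1 \<and> r = []")
    case True
    then have "j = 1" "a = [1]" using j jc cr by auto
    then have "graph_iso (insert y V) (insert {x, y} E) (cat_verts [2]) (cat_edges [2])"
      using graph_iso_add_leaf[OF G g xy _ embeds_single_edge_swap(1)[folded \<open>a = [1]\<close>]]
        embeds_single_edge_swap(2-4) gx by simp
    then show ?thesis unfolding is_caterpillar_def iso_caterpillar_def by (intro exI[of _ "[2]"]) (simp add: cat_param_def)
  next
    case False
    let ?b = "1 # (c - 1) # r"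
    have "graph_iso (insert y V) (insert {x, y} E) (cat_verts ?b) (cat_edges ?b)"
      using graph_iso_add_leaf[OF G g xy _ embeds_new_end(1)[OF j jc, of r, folded cr]]
        embeds_new_end(2-4)[OF j jc, of r] gx cr by simp
    moreover have "cat_param ?b" using a False j jc cr by (auto simp: cat_param_def)
    ultimately show ?thesis unfolding is_caterpillar_def iso_caterpillar_def by blast
  qed
qed

text \<open>Only the place of attachment matters: a spine vertex gains a leaf, a leaf at an end of
  the spine prolongs it, and a leaf at an interior spine vertex creates the subdivided star. The far
  end is reduced to the near one by reversal.\<close>

lemma caterpillar_add_leaf:
  assumes G: "conn_graph V E" and iso: "iso_caterpillar V E a" and xy: "x \<in> V" "y \<notin> V"
  shows "is_caterpillar (insert y V) (insert {x, y} E) \<or>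
    (\<exists>f. graph_embeds S32_verts S32_edges (insert y V) (insert {x, y} E) f)"
proof -
  have sg: "simple_graph V E" using G by (simp add: conn_graph_def)
  have a: "cat_param a" and ne: "a \<noteq> []" using iso by (auto simp: iso_caterpillar_def cat_param_def)
  obtain g where g: "bij_betw g V (cat_verts a)" "(`) g ` E = cat_edges a"
    using iso graph_iso_iff[OF sg simple_graph_cat] by (auto simp: iso_caterpillar_def)
  obtain i j where gx: "g x = (i, j)" by fastforce
  have "g x \<in> cat_verts a" using g(1) xy by (auto simp: bij_betw_def)
  then have ij: "i < length a" "j \<le> a ! i" using gx by (auto simp: cat_verts_def)
  consider "j = 0" | "j \<ge> 1" "i = 0" | "j \<ge> 1" "0 < i" "Suc i < length a" | "j \<ge> 1" "Suc i = length a"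
    using ij by linarith
  then show ?thesis
  proof cases
    case 1
    let ?b = "a[i := Suc (a ! i)]"
    have "graph_iso (insert y V) (insert {x, y} E) (cat_verts ?b) (cat_edges ?b)"
      using graph_iso_add_leaf[OF G g xy _ embeds_increase_leaf(1)[OF ij(1)]]
        embeds_increase_leaf(2-4)[OF ij(1)] gx 1 ne by simp
    moreover have "cat_param ?b"
      using a ij ne by (auto simp: cat_param_def hd_conv_nth last_conv_nth nth_list_update)
    ultimately show ?thesis unfolding is_caterpillar_def iso_caterpillar_def by blast
  next
    case 2
    then show ?thesis using caterpillar_add_end_leaf[OF G g a xy] gx by blast
  next
    case 3
    then show ?thesis using caterpillar_add_interior[OF sg g a xy gx] by blast
  next
    case 4
    define h where "h = (\<lambda>(i, j :: nat). (length a - 1 - i, j))"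
    have h: "bij_betw h (cat_verts a) (cat_verts (rev a))" "(`) h ` cat_edges a = cat_edges (rev a)"
      using cat_reversal[OF ne] by (simp_all add: h_def)
    have hij: "h (i, j) = (0, j)" using 4 by (simp add: h_def)
    have "bij_betw (h \<circ> g) V (cat_verts (rev a))" using bij_betw_trans g(1) h(1) .
    moreover have "(`) (h \<circ> g) ` E = cat_edges (rev a)"
      unfolding h(2)[symmetric] g(2)[symmetric] by (simp add: image_comp o_def image_image)
    ultimately show ?thesis
      using caterpillar_add_end_leaf[OF G, of "h \<circ> g" "rev a" x y j] a xy gx hij 4 by (simp add: cat_param_rev)
  qed
qed

text \<open>The tree is grown from one of its edges, which is the caterpillar \<open>[1]\<close>. A
  subdivided star, once present, survives all further additions.\<close>

theorem caterpillar_or_S32: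
  assumes T: "finite_tree V E" and ne: "E \<noteq> {}"
  shows "is_caterpillar V E \<or> (\<exists>f. graph_embeds S32_verts S32_edges V E f)"
proof -
  have sg: "simple_graph V E" using T by (simp add: finite_tree_def)
  obtain e where e: "e \<in> E" using ne by auto
  obtain x0 y0 where xy0: "e = {x0, y0}" "x0 \<noteq> y0" using simple_graphD(2)[OF sg e] by (auto simp: card_2_iff)
  have sub: "{x0, y0} \<subseteq> V" "{{x0, y0}} \<subseteq> E" using simple_graphD(1)[OF sg e] e xy0 by auto
  show ?thesis
    using T conn_graph_single_edge[OF xy0(2)] sub
  proof (induction rule: subtree_grow_induct)
    case base
    let ?f = "\<lambda>v. if v = x0 then (0, 0) else (0, 1)"
    have "graph_iso {x0, y0} {{x0, y0}} (cat_verts [1]) (cat_edges [1])"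
    proof (rule graph_isoI_embed[OF finite_tree_cat conn_graph_single_edge[OF xy0(2)]])
      show "graph_embeds {x0, y0} {{x0, y0}} (cat_verts [1]) (cat_edges [1]) ?f"
      proof -
        have "{(0, 1), (0, 0)} \<in> cat_edges [1]" by (subst insert_commute, rule cat_edges_leafI) simp_all
        then show ?thesis
          using xy0(2) cat_edges_leafI[of 0 "[1]" 1] by (simp add: graph_embeds_def cat_verts_def)
      qed
      show "cat_verts [1] \<subseteq> ?f ` {x0, y0}" using xy0 by (auto simp: cat_verts_def)
    qed simp
    then have "iso_caterpillar {x0, y0} {{x0, y0}} [1]" by (simp add: iso_caterpillar_def cat_param_def)
    then show ?case unfolding is_caterpillar_def by blast
  next
    case (grow V' E' x y)
    from grow.IH show ?case
    proof
      assume "is_caterpillar V' E'"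
      then show ?thesis using caterpillar_add_leaf[OF grow.hyps(1)] grow.hyps by (auto simp: is_caterpillar_def)
    next
      assume "\<exists>f. graph_embeds S32_verts S32_edges V' E' f"
      then obtain f where "graph_embeds S32_verts S32_edges V' E' f" ..
      then have "graph_embeds S32_verts S32_edges (insert y V') (insert {x, y} E') f"
        by (auto simp: graph_embeds_def)
      then show ?thesis by blast
    qed
  qed
qed

lemma non_caterpillar_sign:
  assumes T: "finite_tree V E" and ne: "E \<noteq> {}" and nc: "\<not> is_caterpillar V E"
  shows "ricci_max E > 0 \<or> graph_iso V E S32_verts S32_edges"
proof -
  have sg: "simple_graph V E" using T by (simp add: finite_tree_def)
  obtain f where f: "graph_embeds S32_verts S32_edges V E f" using caterpillar_or_S32[OF T ne] nc by blast
  have "ricci_max E > 0 \<or> f ` S32_verts = V"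
    using ricci_max_embed[OF T conn_graph_S32 S32_edges_nonempty f] ricci_max_S32 by auto
  moreover have "graph_iso V E S32_verts S32_edges" if "f ` S32_verts = V"
    using graph_iso_sym[OF simple_graph_S32 sg graph_isoI_embed[OF T conn_graph_S32 f]] that by simp
  ultimately show ?thesis by blast
qed

section \<open>Signs of the caterpillars\<close>

text \<open>All residuals but the last may vanish or share the sign \<open>s\<close>, and the last
  one must have it. This fits spine weights found by solving the equations from one end, where the
  last edge absorbs the defect. For \<open>s = 0\<close> all residuals vanish.\<close>

lemma cat_sgnI:
  assumes len: "length a = Suc (length xs)" "xs \<noteq> []"
    and pos: "\<forall>x\<in>set xs. 0 < x"
    and res: "\<forall>i\<in>set [0..<length xs - 1]. cat_residual a ((!) xs) i = 0 \<or> sgn (cat_residual a ((!) xs) i) = s"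
    and s: "sgn (cat_residual a ((!) xs) (length xs - 1)) = s"
  shows "sgn (cat_max a) = s"
proof -
  let ?r = "cat_residual a ((!) xs) (length xs - 1)"
  have x: "xs ! i > 0" if "Suc i < length a" for i using pos that len by simp
  have last: "Suc (length xs - 1) < length a" using len by simp
  have a: "a \<noteq> []" "length a \<ge> 2" using len by (auto simp: Suc_le_eq)
  have r: "cat_residual a ((!) xs) i = 0 \<or> sgn (cat_residual a ((!) xs) i) = sgn ?r" if "Suc i < length a" for i
    using res s that len by (cases "i = length xs - 1") auto
  consider "?r < 0" | "?r = 0" | "?r > 0" by linarith
  then show ?thesis
  proof cases
    case 1
    have "cat_max a < 0"
      by (rule cat_max_negI[OF a(1) _ _ last 1]) (use x r 1 in \<open>force intro: less_imp_le simp: sgn_if split: if_splits\<close>)+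
    then show ?thesis using 1 s by simp
  next
    case 2
    have "cat_max a = 0"
      by (rule cat_max_zeroI[OF a(2), of "(!) xs"]) (use x r 2 in \<open>force simp: sgn_if split: if_splits\<close>)+
    then show ?thesis using 2 s by simp
  next
    case 3
    have "cat_max a > 0"
      by (rule cat_max_posI[OF a(1) _ _ last 3]) (use x r 3 in \<open>force intro: less_imp_le simp: sgn_if split: if_splits\<close>)+
    then show ?thesis using 3 s by simp
  qed
qed

text \<open>\<open>xs\<close> lists the spine weights; the leaf edges need no check, since the leaf weights are chosen
  to make the operator vanish there.\<close>

definition cat_certificate :: "nat list \<Rightarrow> real list \<Rightarrow> real \<Rightarrow> bool" where
  "cat_certificate a xs s \<longleftrightarrow> length a = Suc (length xs) \<and> xs \<noteq> [] \<and> (\<forall>x\<in>set xs. 0 < x) \<and>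
     (let rs = map (cat_residual a ((!) xs)) [0..<length xs]
      in list_all (\<lambda>r. r = 0 \<or> sgn r = s) (butlast rs) \<and> sgn (last rs) = s)"

lemma sgn_cat_max:
  assumes "cat_certificate a xs s"
  shows "sgn (cat_max a) = s"
proof -
  have "butlast (map f [0..<length xs]) = map f [0..<length xs - 1]" for f :: "nat \<Rightarrow> real"
    by (cases "length xs") auto
  then show ?thesis
    using assms by (intro cat_sgnI[of a xs]) (auto simp: cat_certificate_def Let_def last_map list_all_iff)
qed

lemmas cat_certificate_eval =
  cat_certificate_def Let_def cat_residual_def cat_flux_def cat_deg_def cat_spine_sum_def

lemma list_all_sgn_cat_max:
  assumes "list_all (\<lambda>(a, xs). cat_certificate a xs s) L"
    and "a \<in> set (map fst L)"
  shows "sgn (cat_max a) = s"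
  using assms sgn_cat_max by (fastforce simp: list_all_iff)

text \<open>The first two rows are the spiders behind \<open>cat_nonneg_spider\<close>; the others
  are minimal lists outside the negative region. Most weight lists solve residual = 0 from the left:
  if the second spine vertex is leafless, the first two weights are in the ratio 3:5, 9:11, 1:1,
  15:13 or 9:7 for one to five leaves at the left end, and arithmetic progressions follow along
  zeros. For \<open>[1, 0, 1, 1, 0, 1]\<close> this recursion runs into a negative weight; symmetric
  weights with all residuals positive serve there.\<close>

definition cat_positive_certs :: "(nat list \<times> real list) list" where
  "cat_positive_certs =
    [([1, 0, 0, 0, 1, 0, 1], [15, 25, 35, 45, 39, 21]),
     ([1, 0, 0, 1, 0, 0, 1], [45, 75, 105, 99, 61, 23]),
     ([3, 1, 1], [5, 3]),
     ([1, 2, 2], [9, 11]),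
     ([5, 0, 2], [9, 7]),
     ([2, 1, 2], [15, 13]),
     ([2, 1, 0, 1], [15, 13, 7]),
     ([1, 0, 3, 1], [21, 35, 25]),
     ([3, 0, 1, 1], [5, 5, 3]),
     ([1, 1, 1, 1], [25, 35, 17]),
     ([1, 2, 0, 2], [9, 11, 7]),
     ([5, 0, 0, 2], [9, 7, 5]),
     ([2, 1, 0, 0, 1], [15, 13, 7, 1]),
     ([1, 0, 0, 2, 1], [3, 5, 7, 5]),
     ([2, 0, 1, 0, 1], [27, 33, 27, 13]),
     ([1, 0, 1, 1, 1], [75, 125, 135, 37]),
     ([1, 0, 2, 0, 1], [9, 15, 13, 5]),
     ([3, 0, 0, 1, 1], [5, 5, 5, 3]),
     ([1, 1, 0, 1, 1], [15, 21, 19, 9]),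
     ([5, 0, 0, 0, 0, 1], [9, 7, 5, 3, 1]),
     ([1, 0, 0, 0, 1, 2], [15, 25, 35, 45, 39]),
     ([1, 0, 0, 0, 2, 1], [9, 15, 21, 27, 17]),
     ([1, 0, 0, 1, 0, 2], [45, 75, 105, 99, 61]),
     ([1, 0, 0, 1, 1, 1], [75, 125, 175, 165, 23]),
     ([1, 0, 0, 2, 0, 1], [3, 5, 7, 5, 1]),
     ([1, 0, 1, 0, 0, 2], [45, 75, 81, 59, 37]),
     ([1, 0, 1, 0, 1, 1], [45, 75, 81, 59, 9]),
     ([1, 0, 1, 1, 0, 1], [1, 2, 3, 2, 1]),
     ([3, 0, 0, 0, 1, 1], [5, 5, 5, 5, 3]),
     ([1, 1, 0, 0, 1, 1], [75, 105, 95, 85, 39]),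
     ([4, 0, 0, 0, 0, 2], [15, 13, 11, 9, 7]),
     ([1, 0, 0, 0, 0, 0, 5], [3, 5, 7, 9, 11, 13]),
     ([1, 0, 0, 0, 0, 1, 2], [3, 5, 7, 9, 11, 9]),
     ([1, 0, 0, 0, 0, 2, 1], [9, 15, 21, 27, 33, 19]),
     ([3, 0, 0, 0, 0, 1, 1], [5, 5, 5, 5, 5, 3]),
     ([1, 1, 0, 0, 0, 1, 1], [75, 105, 95, 85, 75, 33]),
     ([4, 0, 0, 0, 0, 0, 2], [15, 13, 11, 9, 7, 5]),
     ([1, 0, 0, 0, 0, 0, 1, 2], [15, 25, 35, 45, 55, 65, 51]),
     ([1, 0, 0, 0, 0, 0, 2, 1], [3, 5, 7, 9, 11, 13, 7]),
     ([3, 0, 0, 0, 0, 0, 1, 1], [5, 5, 5, 5, 5, 5, 3]),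
     ([1, 1, 0, 0, 0, 0, 1, 1], [75, 105, 95, 85, 75, 65, 27]),
     ([4, 0, 0, 0, 0, 0, 0, 0, 1], [15, 13, 11, 9, 7, 5, 3, 1]),
     ([1, 0, 0, 0, 0, 0, 0, 1, 2], [15, 25, 35, 45, 55, 65, 75, 57]),
     ([1, 0, 0, 0, 0, 0, 0, 2, 1], [9, 15, 21, 27, 33, 39, 45, 23]),
     ([1, 1, 0, 0, 0, 0, 0, 1, 1], [75, 105, 95, 85, 75, 65, 55, 21]),
     ([1, 0, 0, 0, 0, 0, 0, 0, 0, 4], [3, 5, 7, 9, 11, 13, 15, 17, 19]),
     ([1, 0, 0, 0, 0, 0, 0, 0, 1, 2], [15, 25, 35, 45, 55, 65, 75, 85, 63]),
     ([1, 0, 0, 0, 0, 0, 0, 0, 2, 1], [9, 15, 21, 27, 33, 39, 45, 51, 25]),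
     ([1, 1, 0, 0, 0, 0, 0, 0, 0, 2], [15, 21, 19, 17, 15, 13, 11, 9, 7]),
     ([1, 1, 0, 0, 0, 0, 0, 0, 1, 1], [15, 21, 19, 17, 15, 13, 11, 9, 3]),
     ([1, 0, 0, 0, 0, 0, 0, 0, 0, 0, 4], [3, 5, 7, 9, 11, 13, 15, 17, 19, 21]),
     ([1, 0, 0, 0, 0, 0, 0, 0, 0, 1, 2], [15, 25, 35, 45, 55, 65, 75, 85, 95, 69]),
     ([1, 0, 0, 0, 0, 0, 0, 0, 0, 2, 1], [3, 5, 7, 9, 11, 13, 15, 17, 19, 9]),
     ([1, 1, 0, 0, 0, 0, 0, 0, 0, 0, 2], [15, 21, 19, 17, 15, 13, 11, 9, 7, 5]),
     ([1, 1, 0, 0, 0, 0, 0, 0, 0, 1, 1], [75, 105, 95, 85, 75, 65, 55, 45, 35, 9])]"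

lemma cat_positive_certs: "a \<in> set (map fst cat_positive_certs) \<Longrightarrow> sgn (cat_max a) = 1"
proof (rule list_all_sgn_cat_max)
  show "list_all (\<lambda>(a, xs). cat_certificate a xs 1) cat_positive_certs"
    unfolding cat_positive_certs_def list.pred_inject prod.case by (intro conjI TrueI; simp add: cat_certificate_eval)
qed

text \<open>The maximal lists of \<open>max_params\<close>, and \<open>[2, 4]\<close> for a spine of
  order two. By monotonicity they settle everything below them.\<close>

definition cat_negative_certs :: "(nat list \<times> real list) list" where
  "cat_negative_certs =
    [([2, 4], [1]),
     ([1, 1, 2], [5, 7]),
     ([1, 3, 1], [21, 23]),
     ([2, 0, 4], [9, 11]),
     ([1, 0, 8], [3, 5]),
     ([1, 0, 2, 1], [9, 15, 13]),
     ([1, 1, 0, 2], [15, 21, 19]),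
     ([1, 0, 0, 5], [3, 5, 7]),
     ([2, 0, 0, 4], [9, 11, 13]),
     ([1, 0, 1, 0, 1], [45, 75, 81, 59]),
     ([1, 1, 0, 0, 2], [15, 21, 19, 17]),
     ([1, 0, 0, 0, 4], [3, 5, 7, 9]),
     ([2, 0, 0, 0, 3], [9, 11, 13, 15]),
     ([1, 0, 0, 1, 0, 1], [45, 75, 105, 99, 61]),
     ([1, 1, 0, 0, 0, 2], [15, 21, 19, 17, 15]),
     ([1, 0, 0, 0, 0, 4], [3, 5, 7, 9, 11]),
     ([2, 0, 0, 0, 0, 3], [9, 11, 13, 15, 17]),
     ([1, 1, 0, 0, 0, 0, 2], [15, 21, 19, 17, 15, 13]),
     ([1, 0, 0, 0, 0, 0, 4], [3, 5, 7, 9, 11, 13]),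
     ([2, 0, 0, 0, 0, 0, 3], [9, 11, 13, 15, 17, 19]),
     ([1, 1, 0, 0, 0, 0, 0, 2], [15, 21, 19, 17, 15, 13, 11]),
     ([2, 0, 0, 0, 0, 0, 0, 3], [9, 11, 13, 15, 17, 19, 21]),
     ([1, 0, 0, 0, 0, 0, 0, 1, 1], [15, 25, 35, 45, 55, 65, 75, 57]),
     ([2, 0, 0, 0, 0, 0, 0, 0, 3], [9, 11, 13, 15, 17, 19, 21, 23]),
     ([1, 0, 0, 0, 0, 0, 0, 0, 1, 1], [15, 25, 35, 45, 55, 65, 75, 85, 63]),
     ([2, 0, 0, 0, 0, 0, 0, 0, 0, 3], [9, 11, 13, 15, 17, 19, 21, 23, 25]),
     ([1, 0, 0, 0, 0, 0, 0, 0, 0, 1, 1], [15, 25, 35, 45, 55, 65, 75, 85, 95, 69]),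
     ([2, 0, 0, 0, 0, 0, 0, 0, 0, 0, 3], [9, 11, 13, 15, 17, 19, 21, 23, 25, 27])]"

lemma cat_negative_certs: "a \<in> set (map fst cat_negative_certs) \<Longrightarrow> sgn (cat_max a) = (- 1)"
proof (rule list_all_sgn_cat_max)
  show "list_all (\<lambda>(a, xs). cat_certificate a xs (- 1)) cat_negative_certs"
    unfolding cat_negative_certs_def list.pred_inject prod.case by (intro conjI TrueI; simp add: cat_certificate_eval)
qed

text \<open>For (1,0,...,0,q) of length m the weights are 3, 5, ..., 2m - 1, and the last residual
  vanishes iff (q - 3)(m - 2) = 6, which gives q = 9, 6, 5, 4 at m = 3, 4, 5, 8. For (2,0,...,0,q)
  they are 9, 11, ..., 2m + 5, and the condition (q - 3)(m + 1) = 6 gives q = 5, 4 at m = 2,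
  5.\<close>

definition cat_zero_certs :: "(nat list \<times> real list) list" where
  "cat_zero_certs =
    [([2, 5], [1]),
     ([1, 0, 9], [3, 5]),
     ([1, 4, 1], [1, 1]),
     ([1, 0, 0, 6], [3, 5, 7]),
     ([1, 0, 0, 0, 5], [3, 5, 7, 9]),
     ([2, 0, 0, 0, 4], [9, 11, 13, 15]),
     ([1, 0, 0, 0, 0, 0, 0, 4], [3, 5, 7, 9, 11, 13, 15]),
     ([1, 1, 0, 0, 0, 0, 0, 0, 2], [15, 21, 19, 17, 15, 13, 11, 9]),
     ([1, 0, 0, 0, 0, 0, 0, 0, 0, 0, 1, 1], [3, 5, 7, 9, 11, 13, 15, 17, 19, 21, 15])]"

lemma cat_zero_certs: "a \<in> set (map fst cat_zero_certs) \<Longrightarrow> sgn (cat_max a) = 0"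
proof (rule list_all_sgn_cat_max)
  show "list_all (\<lambda>(a, xs). cat_certificate a xs 0) cat_zero_certs"
    unfolding cat_zero_certs_def list.pred_inject prod.case by (intro conjI TrueI; simp add: cat_certificate_eval)
qed

section \<open>Minimal elements outside the negative region, spines of order 3 to 11\<close>

lemma nonneg_dominates_3:
  assumes len: "length a = 3" and a: "cat_param a" and nl: "\<forall>b\<in>max_params 3. \<not>
      coord_le a b \<and> \<not> coord_le (rev a) b"
  shows "\<exists>c\<in>{[1, 0, 9],
     [3, 1, 1],
     [1, 2, 2],
     [1, 4, 1],
     [5, 0, 2],
     [2, 1, 2],
     [3, 0, 3]}.
     coord_le c a \<or> coord_le c (rev a)"
proof -
  obtain x0 x1 x2 where a_eq: "a = [x0, x1, x2]"
    using len by (auto simp: length_Suc_conv eval_nat_numeral)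
  show ?thesis
    using nl a unfolding a_eq by (simp add: max_params_def cat_param_def) presburger
qed

lemma nonneg_dominates_4:
  assumes len: "length a = 4" and a: "cat_param a" and nl: "\<forall>b\<in>max_params 4. \<not> coord_le a b \<and> \<not> coord_le (rev a) b"
  shows "\<exists>c\<in>{[1, 0, 0, 6],
     [2, 1, 0, 1],
     [1, 0, 3, 1],
     [3, 0, 1, 1],
     [1, 1, 1, 1],
     [1, 2, 0, 2],
     [5, 0, 0, 2],
     [3, 0, 0, 3]}.
     coord_le c a \<or> coord_le c (rev a)"
proof -
  obtain x0 x1 x2 x3 where a_eq: "a = [x0, x1, x2, x3]"
    using len by (auto simp: length_Suc_conv eval_nat_numeral)
  show ?thesis
    using nl a unfolding a_eq by (simp add: max_params_def cat_param_def) presburger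
qed

lemma nonneg_dominates_5:
  assumes len: "length a = 5" and a: "cat_param a" and nl: "\<forall>b\<in>max_params 5. \<not> coord_le a b \<and> \<not> coord_le (rev a) b"
  shows "\<exists>c\<in>{[1, 0, 0, 0, 5],
     [2, 1, 0, 0, 1],
     [1, 0, 0, 2, 1],
     [2, 0, 1, 0, 1],
     [1, 0, 1, 1, 1],
     [1, 0, 2, 0, 1],
     [3, 0, 0, 1, 1],
     [1, 1, 0, 1, 1],
     [2, 0, 0, 0, 4],
     [3, 0, 0, 0, 3]}.
     coord_le c a \<or> coord_le c (rev a)"
proof -
  obtain x0 x1 x2 x3 x4 where a_eq: "a = [x0, x1, x2, x3, x4]"
    using len by (auto simp: length_Suc_conv eval_nat_numeral)
  show ?thesis
    using nl a unfolding a_eq by (simp add: max_params_def cat_param_def) presburger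
qed

lemma nonneg_dominates_6:
  assumes len: "length a = 6" and a: "cat_param a" and nl: "\<forall>b\<in>max_params 6. \<not> coord_le a b \<and> \<not> coord_le (rev a) b"
  shows "\<exists>c\<in>{[5, 0, 0, 0, 0, 1],
     [1, 0, 0, 0, 1, 2],
     [1, 0, 0, 0, 2, 1],
     [1, 0, 0, 1, 0, 2],
     [1, 0, 0, 1, 1, 1],
     [1, 0, 0, 2, 0, 1],
     [1, 0, 1, 0, 0, 2],
     [1, 0, 1, 0, 1, 1],
     [1, 0, 1, 1, 0, 1],
     [3, 0, 0, 0, 1, 1],
     [1, 1, 0, 0, 1, 1],
     [4, 0, 0, 0, 0, 2],
     [3, 0, 0, 0, 0, 3]}.
     coord_le c a \<or> coord_le c (rev a)"
proof -
  obtain x0 x1 x2 x3 x4 x5 where a_eq: "a = [x0, x1, x2, x3, x4, x5]"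
    using len by (auto simp: length_Suc_conv eval_nat_numeral)
  show ?thesis
    using nl a unfolding a_eq by (simp add: max_params_def cat_param_def) presburger
qed

text \<open>From length 7 on, a leaf at a spine vertex other than the outer two on each side already
  yields a large enough spider, as \<open>cat_nonneg_interior\<close> shows. The hypothesis
  \<open>mid\<close> records that this case is settled, so that four entries remain free at every
  length.\<close>

lemma nonneg_dominates_7:
  assumes len: "length a = 7" and a: "cat_param a" and nl: "\<forall>b\<in>max_params 7. \<not> coord_le a b \<and> \<not> coord_le (rev a) b"
    and mid: "\<And>i. 2 \<le> i \<Longrightarrow> i + 3 \<le> 7 \<Longrightarrow> a ! i = 0"
  shows "\<exists>c\<in>{[1, 0, 0, 0, 0, 0, 5],
     [1, 0, 0, 0, 0, 1, 2],
     [1, 0, 0, 0, 0, 2, 1],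
     [3, 0, 0, 0, 0, 1, 1],
     [1, 1, 0, 0, 0, 1, 1],
     [4, 0, 0, 0, 0, 0, 2],
     [3, 0, 0, 0, 0, 0, 3]}.
     coord_le c a \<or> coord_le c (rev a)"
proof -
  obtain x0 x1 x2 x3 x4 x5 x6 where a_eq: "a = [x0, x1, x2, x3, x4, x5, x6]"
    using len by (auto simp: length_Suc_conv eval_nat_numeral)
  have zero: "x2 = 0" "x3 = 0" "x4 = 0"
    using mid[of 2] mid[of 3] mid[of 4] by (simp_all add: a_eq)
  show ?thesis
    using nl a unfolding a_eq zero by (simp add: max_params_def cat_param_def) presburger
qed

lemma nonneg_dominates_8:
  assumes len: "length a = 8" and a: "cat_param a" and nl: "\<forall>b\<in>max_params 8. \<not> coord_le a b \<and> \<not> coord_le (rev a) b"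
    and mid: "\<And>i. 2 \<le> i \<Longrightarrow> i + 3 \<le> 8 \<Longrightarrow> a ! i = 0"
  shows "\<exists>c\<in>{[1, 0, 0, 0, 0, 0, 0, 4],
     [1, 0, 0, 0, 0, 0, 1, 2],
     [1, 0, 0, 0, 0, 0, 2, 1],
     [3, 0, 0, 0, 0, 0, 1, 1],
     [1, 1, 0, 0, 0, 0, 1, 1],
     [3, 0, 0, 0, 0, 0, 0, 3]}.
     coord_le c a \<or> coord_le c (rev a)"
proof -
  obtain x0 x1 x2 x3 x4 x5 x6 x7 where a_eq: "a = [x0, x1, x2, x3, x4, x5, x6, x7]"
    using len by (auto simp: length_Suc_conv eval_nat_numeral)
  have zero: "x2 = 0" "x3 = 0" "x4 = 0" "x5 = 0"
    using mid[of 2] mid[of 3] mid[of 4] mid[of 5] by (simp_all add: a_eq)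
  show ?thesis
    using nl a unfolding a_eq zero by (simp add: max_params_def cat_param_def) presburger
qed

lemma nonneg_dominates_9:
  assumes len: "length a = 9" and a: "cat_param a" and nl: "\<forall>b\<in>max_params 9. \<not> coord_le a b \<and> \<not> coord_le (rev a) b"
    and mid: "\<And>i. 2 \<le> i \<Longrightarrow> i + 3 \<le> 9 \<Longrightarrow> a ! i = 0"
  shows "\<exists>c\<in>{[4, 0, 0, 0, 0, 0, 0, 0, 1],
     [1, 0, 0, 0, 0, 0, 0, 1, 2],
     [1, 0, 0, 0, 0, 0, 0, 2, 1],
     [1, 1, 0, 0, 0, 0, 0, 0, 2],
     [1, 1, 0, 0, 0, 0, 0, 1, 1],
     [3, 0, 0, 0, 0, 0, 0, 0, 3]}.
     coord_le c a \<or> coord_le c (rev a)"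
proof -
  obtain x0 x1 x2 x3 x4 x5 x6 x7 x8 where a_eq: "a = [x0, x1, x2, x3, x4, x5, x6, x7, x8]"
    using len by (auto simp: length_Suc_conv eval_nat_numeral)
  have zero: "x2 = 0" "x3 = 0" "x4 = 0" "x5 = 0" "x6 = 0"
    using mid[of 2] mid[of 3] mid[of 4] mid[of 5] mid[of 6] by (simp_all add: a_eq)
  show ?thesis
    using nl a unfolding a_eq zero by (simp add: max_params_def cat_param_def) presburger
qed

lemma nonneg_dominates_10:
  assumes len: "length a = 10" and a: "cat_param a" and nl: "\<forall>b\<in>max_params 10. \<not> coord_le a b \<and> \<not> coord_le (rev a) b"
    and mid: "\<And>i. 2 \<le> i \<Longrightarrow> i + 3 \<le> 10 \<Longrightarrow> a ! i = 0"
  shows "\<exists>c\<in>{[1, 0, 0, 0, 0, 0, 0, 0, 0, 4],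
     [1, 0, 0, 0, 0, 0, 0, 0, 1, 2],
     [1, 0, 0, 0, 0, 0, 0, 0, 2, 1],
     [1, 1, 0, 0, 0, 0, 0, 0, 0, 2],
     [1, 1, 0, 0, 0, 0, 0, 0, 1, 1],
     [3, 0, 0, 0, 0, 0, 0, 0, 0, 3]}.
     coord_le c a \<or> coord_le c (rev a)"
proof -
  obtain x0 x1 x2 x3 x4 x5 x6 x7 x8 x9 where a_eq: "a = [x0, x1, x2, x3, x4, x5, x6, x7, x8, x9]"
    using len by (auto simp: length_Suc_conv eval_nat_numeral)
  have zero: "x2 = 0" "x3 = 0" "x4 = 0" "x5 = 0" "x6 = 0" "x7 = 0"
    using mid[of 2] mid[of 3] mid[of 4] mid[of 5] mid[of 6] mid[of 7] by (simp_all add: a_eq)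
  show ?thesis
    using nl a unfolding a_eq zero by (simp add: max_params_def cat_param_def) presburger
qed

lemma nonneg_dominates_11:
  assumes len: "length a = 11" and a: "cat_param a" and nl: "\<forall>b\<in>max_params 11. \<not> coord_le a b \<and> \<not> coord_le (rev a) b"
    and mid: "\<And>i. 2 \<le> i \<Longrightarrow> i + 3 \<le> 11 \<Longrightarrow> a ! i = 0"
  shows "\<exists>c\<in>{[1, 0, 0, 0, 0, 0, 0, 0, 0, 0, 4],
     [1, 0, 0, 0, 0, 0, 0, 0, 0, 1, 2],
     [1, 0, 0, 0, 0, 0, 0, 0, 0, 2, 1],
     [1, 1, 0, 0, 0, 0, 0, 0, 0, 0, 2],
     [1, 1, 0, 0, 0, 0, 0, 0, 0, 1, 1],
     [3, 0, 0, 0, 0, 0, 0, 0, 0, 0, 3]}.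
     coord_le c a \<or> coord_le c (rev a)"
proof -
  obtain x0 x1 x2 x3 x4 x5 x6 x7 x8 x9 x10 where a_eq: "a = [x0, x1, x2, x3, x4, x5, x6, x7, x8, x9, x10]"
    using len by (auto simp: length_Suc_conv eval_nat_numeral)
  have zero: "x2 = 0" "x3 = 0" "x4 = 0" "x5 = 0" "x6 = 0" "x7 = 0" "x8 = 0"
    using mid[of 2] mid[of 3] mid[of 4] mid[of 5] mid[of 6] mid[of 7] mid[of 8] by (simp_all add: a_eq)
  show ?thesis
    using nl a unfolding a_eq zero by (simp add: max_params_def cat_param_def) presburger
qed


section \<open>The balanced ends and the equality cases\<close>

lemma cat_param_nth:
  "cat_param a \<longleftrightarrow> a \<noteq> [] \<and> 1 \<le> a ! 0 \<and> 1 \<le> a ! (length a - 1)"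
  by (auto simp: cat_param_def hd_conv_nth last_conv_nth)

lemma end_params_nth:
  assumes "m \<ge> 2" "i < m"
  shows "end_params m p q ! i = (if i = 0 then p else if i = m - 1 then q else 0)"
  using assms by (auto simp: end_params_def nth_Cons' nth_append)

lemma length_end_params [simp]: "m \<ge> 2 \<Longrightarrow> length (end_params m p q) = m"
  by (simp add: end_params_def)

lemma cat_param_end_params: "cat_param (end_params m p q) \<longleftrightarrow> 1 \<le> p \<and> 1 \<le> q"
  by (simp add: end_params_def cat_param_def)

lemma eq_end_paramsI:
  assumes "length a \<ge> 2" "\<And>i. \<lbrakk>1 \<le> i; i + 2 \<le> length a\<rbrakk> \<Longrightarrow> a ! i = 0"
  shows "a = end_params (length a) (a ! 0) (a ! (length a - 1))"
proof (rule nth_equalityI)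
  fix i assume "i < length a"
  then show "a ! i = end_params (length a) (a ! 0) (a ! (length a - 1)) ! i"
    using assms(2)[of i] assms(1) by (auto simp: end_params_nth)
qed (use assms in simp)

text \<open>With constant spine weights the flux vanishes at every single vertex, not only in the
  sum over an edge, so the length of the spine does not enter.\<close>

lemma cat_max_end_params_3_3:
  assumes "m \<ge> 2"
  shows "cat_max (end_params m 3 3) = 0"
proof (rule cat_max_zeroI[of _ "\<lambda>_. 1"])
  show "2 \<le> length (end_params m 3 3)" using assms by simp
  have flux: "cat_flux (end_params m 3 3) (\<lambda>_. 1) i 1 = 0" if "i < m" for i
    using that assms by (auto simp: cat_flux_def cat_deg_def cat_spine_sum_def end_params_nth)
  show "cat_residual (end_params m 3 3) (\<lambda>_. 1) i = 0" if "Suc i < length (end_params m 3 3)" for i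
    using flux[of i] flux[of "Suc i"] that assms by (simp add: cat_residual_def)
qed simp

text \<open>The residual is -1/3 + (n - 3)/(3(n + 1)) = -4/(3(n + 1)): beside an end with one leaf,
  no number of leaves at the other end reaches 0.\<close>

lemma cat_max_two_neg: "cat_max [1, n] < 0"
proof (rule cat_max_negI[of _ "\<lambda>_. 1" 0])
  show res: "cat_residual [1, n] (\<lambda>_. 1) 0 < 0"
    by (simp add: cat_residual_def cat_flux_def cat_deg_def cat_spine_sum_def divide_simps)
  show "cat_residual [1, n] (\<lambda>_. 1) i \<le> 0" if "Suc i < length [1, n]" for i
    using that res by simp
qed simp_all

definition cat_zero :: "nat list \<Rightarrow> bool" where
  "cat_zero a \<longleftrightarrow> (\<exists>m\<ge>2. a = end_params m 3 3) \<or> a \<in> zero_params \<or> rev a \<in> zero_params"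

text \<open>The equality cases are part of the definition, so that they are carried along by monotonicity.\<close>

definition cat_nonneg :: "nat list \<Rightarrow> bool" where
  "cat_nonneg a \<longleftrightarrow> cat_max a > 0 \<or> cat_zero a"

definition cat_listed :: "nat list \<Rightarrow> bool" where
  "cat_listed a \<longleftrightarrow> length a = 1
        \<or> (length a = 2 \<and> (int (a ! 0) - 1) * (int (a ! 1) - 1) < 4)
        \<or> (3 \<le> length a \<and> length a \<le> 11 \<and>
            (\<exists>b\<in>max_params (length a). coord_le a b \<or> coord_le (rev a) b))
        \<or> (12 \<le> length a \<and>
            (\<exists>p q. a = end_params (length a) p q \<and>
               1 \<le> p \<and> p \<le> 3 \<and> 1 \<le> q \<and> q \<le> 3 \<and> (p, q) \<noteq> (3, 3)))"

lemma rev_end_params: "rev (end_params m p q) = end_params m q p"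
  by (simp add: end_params_def)

lemma cat_zero_rev: "cat_zero (rev a) \<longleftrightarrow> cat_zero a"
  unfolding cat_zero_def by (metis rev_end_params rev_rev_ident)

lemma zero_params_max: "a \<in> zero_params \<Longrightarrow> cat_max a = 0"
  using cat_zero_certs[of a] unfolding zero_params_def sgn_zero_iff by (auto simp: cat_zero_certs_def)

lemma zero_params_param: "a \<in> zero_params \<Longrightarrow> cat_param a"
  by (auto simp: zero_params_def cat_param_def)

lemma cat_zero_max:
  assumes "cat_zero a"
  shows "cat_max a = 0"
  using assms unfolding cat_zero_def
proof (elim disjE exE conjE)
  assume "rev a \<in> zero_params"
  then show ?thesis
    using zero_params_max[of "rev a"] zero_params_param[of "rev a"] cat_max_rev[of "rev a"] by simp
qed (use cat_max_end_params_3_3 zero_params_max in auto)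

lemma cat_nonneg_ge: "cat_nonneg a \<Longrightarrow> cat_max a \<ge> 0"
  using cat_zero_max by (auto simp: cat_nonneg_def)

lemma cat_nonneg_rev: "cat_param a \<Longrightarrow> cat_nonneg (rev a) \<longleftrightarrow> cat_nonneg a"
  by (simp add: cat_nonneg_def cat_max_rev cat_zero_rev)

section \<open>Domination by critical caterpillars and insertion of spine vertices\<close>

lemma cat_nonneg_mono:
  assumes "cat_param c" "coord_le c a" "cat_nonneg c"
  shows "cat_nonneg a"
  using cat_max_mono[OF assms(1,2) cat_nonneg_ge[OF assms(3)]] assms(3) by (auto simp: cat_nonneg_def)

lemma cat_nonneg_dominates:
  assumes a: "cat_param a" and c: "cat_param c" "cat_nonneg c" and le: "coord_le c a \<or> coord_le c (rev a)"
  shows "cat_nonneg a"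
  using cat_nonneg_mono[OF c(1) _ c(2)] le cat_nonneg_rev[OF a] by blast

lemma cat_nonneg_positive_table:
  "\<forall>a\<in>set (map fst cat_positive_certs). cat_nonneg a"
  using cat_positive_certs by (auto simp: cat_nonneg_def sgn_1_pos)

text \<open>Each step applies \<open>cat_max_extend_spine\<close> with \<open>x = 0\<close>: the
  only leaf at the first spine vertex becomes a spine vertex that carries one new leaf. The sign is
  strictly positive from the first insertion on, even when the original list has eigenvalue
  0.\<close>

lemma cat_max_extend_zeros:
  assumes "cat_param (1 # r)" "r \<noteq> []" "cat_nonneg (1 # r)"
  shows "k = 0 \<or> cat_max (1 # replicate k 0 @ r) > 0"
proof (induction k)
  case (Suc k)
  have p: "cat_param (Suc 0 # replicate k 0 @ r)" using assms(1,2) by (auto simp: cat_param_def split: if_splits)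
  have "cat_max (Suc 0 # replicate k 0 @ r) \<ge> 0"
    using Suc.IH cat_nonneg_ge[OF assms(3)] by (cases "k = 0") auto
  from cat_max_extend_spine[OF p, of 1] this show ?case by simp
qed simp

lemma cat_nonneg_extend_zeros:
  assumes "cat_param (1 # r)" "r \<noteq> []" "cat_nonneg (1 # r)"
  shows "cat_nonneg (1 # replicate k 0 @ r)"
  using cat_max_extend_zeros[OF assms, of k] assms(3) by (auto simp: cat_nonneg_def)

text \<open>The spider with one leg of length \<open>1\<close> and two legs of lengths \<open>k + 2\<close> and \<open>l + 2\<close>.\<close>

definition cat_spider :: "nat \<Rightarrow> nat \<Rightarrow> nat list" where
  "cat_spider k l = 1 # replicate k 0 @ 1 # replicate l 0 @ [1]"

lemma rev_cat_spider: "rev (cat_spider k l) = cat_spider l k"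
  by (simp add: cat_spider_def)

lemma cat_param_spider: "cat_param (cat_spider k l)"
  by (simp add: cat_spider_def cat_param_def)

lemma cat_spider_extend_left:
  assumes "cat_nonneg (cat_spider k l)"
  shows "cat_nonneg (cat_spider (d + k) l)"
  using cat_nonneg_extend_zeros[of "replicate k 0 @ 1 # replicate l 0 @ [1]" d] assms cat_param_spider[of k l]
  by (simp add: cat_spider_def replicate_add)

lemma cat_spider_mono:
  assumes "cat_nonneg (cat_spider k l)" "k \<le> k'" "l \<le> l'"
  shows "cat_nonneg (cat_spider k' l')"
proof -
  have "cat_nonneg (cat_spider k' l)" using cat_spider_extend_left[OF assms(1), of "k' - k"] assms(2) by simp
  then have "cat_nonneg (cat_spider l k')"
    using cat_nonneg_rev[OF cat_param_spider, of k' l] by (simp add: rev_cat_spider)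
  then have "cat_nonneg (cat_spider l' k')" using cat_spider_extend_left[of l k' "l' - l"] assms(3) by simp
  then show ?thesis using cat_nonneg_rev[OF cat_param_spider, of l' k'] by (simp add: rev_cat_spider)
qed

text \<open>The minimal pairs with both entries positive and sum at least 4 are (3,1), (2,2) and
  (1,3). The first two are certified, and the third is a reversal.\<close>

lemma cat_nonneg_spider:
  assumes "k \<ge> 1" "l \<ge> 1" "k + l \<ge> 4"
  shows "cat_nonneg (cat_spider k l)"
proof -
  have 31: "cat_nonneg (cat_spider 3 1)" and 22: "cat_nonneg (cat_spider 2 2)"
    using cat_nonneg_positive_table[unfolded cat_positive_certs_def]
    by (simp_all add: cat_spider_def eval_nat_numeral)
  have 13: "cat_nonneg (cat_spider 1 3)"
    using cat_nonneg_rev[OF cat_param_spider, of 3 1] 31 by (simp add: rev_cat_spider)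
  consider "k \<ge> 3" | "k \<ge> 2" "l \<ge> 2" | "l \<ge> 3" using assms by linarith
  then show ?thesis
    using cat_spider_mono[OF 31, of k l] cat_spider_mono[OF 22, of k l] cat_spider_mono[OF 13, of k l] assms
    by cases auto
qed

lemma coord_le_spider:
  assumes a: "cat_param a" and i: "1 \<le> i" "i + 2 \<le> length a" "1 \<le> a ! i"
  shows "coord_le (cat_spider (i - 1) (length a - i - 2)) a"
  unfolding list_all2_conv_all_nth
proof (intro conjI allI impI)
  show "length (cat_spider (i - 1) (length a - i - 2)) = length a" using i by (simp add: cat_spider_def)
  fix j assume "j < length (cat_spider (i - 1) (length a - i - 2))"
  then have j: "j < length a" using i by (simp add: cat_spider_def)
  have "cat_spider (i - 1) (length a - i - 2) ! j = (if j = 0 \<or> j = i \<or> j = length a - 1 then 1 else 0)"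
    using i j by (auto simp: cat_spider_def nth_Cons' nth_append)
  then show "cat_spider (i - 1) (length a - i - 2) ! j \<le> a ! j"
    using a i by (auto simp: cat_param_nth)
qed

lemma cat_nonneg_interior:
  assumes "cat_param a" "7 \<le> length a" "2 \<le> i" "i + 3 \<le> length a" "1 \<le> a ! i"
  shows "cat_nonneg a"
proof -
  have "cat_nonneg (cat_spider (i - 1) (length a - i - 2))"
    by (rule cat_nonneg_spider) (use assms in linarith)+
  moreover have "coord_le (cat_spider (i - 1) (length a - i - 2)) a"
    by (rule coord_le_spider) (use assms in linarith)+
  ultimately show ?thesis using cat_nonneg_mono[OF cat_param_spider] by blast
qed

text \<open>\<open>cat_spider 9 0\<close> is the sporadic zero list of length 12. This is why a
  second leaf-bearing vertex next to an end is excluded from length 12 on.\<close>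

lemma cat_nonneg_second_last:
  assumes a: "cat_param a" and len: "12 \<le> length a" and nz: "1 \<le> a ! (length a - 2)"
  shows "cat_nonneg a"
proof -
  have "cat_nonneg (cat_spider 9 0)"
    by (simp add: cat_spider_def cat_nonneg_def cat_zero_def zero_params_def eval_nat_numeral)
  then have "cat_nonneg (cat_spider (length a - 3) 0)" using cat_spider_mono len by simp
  moreover have "coord_le (cat_spider (length a - 3) 0) a"
    using coord_le_spider[OF a, of "length a - 2"] len nz by (simp add: numeral_eq_Suc)
  ultimately show ?thesis using cat_nonneg_mono cat_param_spider by blast
qed

text \<open>The critical list is (1,0,0,0,0,0,0,4), which has eigenvalue 0 at length 8; longer
  spines arise from it by inserting zeros after the leading 1.\<close>

lemma cat_nonneg_large_end:
  assumes a: "cat_param a" and len: "8 \<le> length a" and nz: "4 \<le> a ! (length a - 1)"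
  shows "cat_nonneg a"
proof -
  have c: "cat_nonneg (1 # replicate (length a - 8) 0 @ [0, 0, 0, 0, 0, 0, 4])"
    by (rule cat_nonneg_extend_zeros)
       (simp_all add: cat_param_def cat_nonneg_def cat_zero_def zero_params_def)
  have "replicate (length a - 2) (0 :: nat) = replicate (length a - 8) 0 @ replicate 6 0"
    using len by (simp add: replicate_add[symmetric])
  then have "1 # replicate (length a - 8) 0 @ [0, 0, 0, 0, 0, 0, 4] = end_params (length a) 1 4"
    by (simp add: end_params_def eval_nat_numeral)
  with c have "cat_nonneg (end_params (length a) 1 4)" by simp
  moreover have "coord_le (end_params (length a) 1 4) a"
    unfolding list_all2_conv_all_nth using a len nz by (auto simp: end_params_nth cat_param_nth)
  ultimately show ?thesis
    using cat_nonneg_mono[of "end_params (length a) 1 4" a] cat_param_end_params[of _ 1 4] by simp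
qed

text \<open>If no critical caterpillar is contained, then the interior entries vanish and both ends
  are at most 3. The only such list outside the negative region is (3,0,...,0,3), which is a zero
  case.\<close>

lemma cat_nonneg_long:
  assumes a: "cat_param a" and len: "12 \<le> length a" and nl: "\<not> cat_listed a"
  shows "cat_nonneg a"
proof (rule ccontr)
  assume "\<not> cat_nonneg a"
  then have neg: "\<not> cat_nonneg a" "\<not> cat_nonneg (rev a)" using cat_nonneg_rev[OF a] by simp_all
  have ra: "cat_param (rev a)" using a by (simp add: cat_param_rev)
  have zero: "a ! i = 0" if i: "1 \<le> i" "i + 2 \<le> length a" for i
  proof (rule ccontr)
    assume "a ! i \<noteq> 0"
    then have nz: "1 \<le> a ! i" by simp
    consider "i = 1" | "2 \<le> i" "i + 3 \<le> length a" | "i + 2 = length a" using i by linarith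
    then show False
    proof cases
      case 1
      then show False
        using cat_nonneg_second_last[OF ra] neg nz len by (simp add: rev_nth)
    next
      case 2
      then show False using cat_nonneg_interior[OF a] neg nz len by simp
    next
      case 3
      then have "i = length a - 2" by simp
      then show False using cat_nonneg_second_last[OF a] neg nz len by simp
    qed
  qed
  have len2: "2 \<le> length a" using len by simp
  let ?p = "a ! 0" and ?q = "a ! (length a - 1)"
  have ends: "a = end_params (length a) ?p ?q" by (rule eq_end_paramsI[OF len2 zero])
  have q: "?q \<le> 3" using cat_nonneg_large_end[OF a] neg len by fastforce
  have "length a \<noteq> 0" using len by auto
  then have p: "?p \<le> 3" using cat_nonneg_large_end[OF ra] neg len by (fastforce simp: rev_nth)
  have "(?p, ?q) \<noteq> (3, 3)"
  proof
    assume "(?p, ?q) = (3, 3)"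
    then have "a = end_params (length a) 3 3" using ends by simp
    then have "cat_zero a" unfolding cat_zero_def using len2 by blast
    then show False using neg by (simp add: cat_nonneg_def)
  qed
  then show False using nl ends p q a len unfolding cat_listed_def cat_param_nth by blast
qed

section \<open>The two halves of the classification\<close>

lemma max_params_max:
  assumes "b \<in> max_params m"
  shows "cat_max b < 0"
proof -
  have "sgn (cat_max b) = - 1"
    by (rule cat_negative_certs)
       (use assms in \<open>auto simp: max_params_def cat_negative_certs_def split: if_splits\<close>)
  then show ?thesis by (simp add: sgn_1_neg)
qed

lemma cat_listed_neg:
  assumes a: "cat_param a" and listed: "cat_listed a"
  shows "cat_max a < 0"
proof -
  have ra: "cat_param (rev a)" using a by (simp add: cat_param_rev)
  have dom: "cat_max a < 0" if "coord_le a b \<or> coord_le (rev a) b" "cat_max b < 0" for b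
    using that cat_max_neg_antimono[OF a, of b] cat_max_neg_antimono[OF ra, of b] cat_max_rev[OF a] by auto
  consider (1) "length a = 1" | (2) "length a = 2" "(int (a ! 0) - 1) * (int (a ! 1) - 1) < 4"
    | (3) b where "b \<in> max_params (length a)" "coord_le a b \<or> coord_le (rev a) b"
    | (12) p q where "12 \<le> length a" "a = end_params (length a) p q" "1 \<le> p" "p \<le> 3" "1 \<le> q" "q \<le> 3"
      "(p, q) \<noteq> (3, 3)"
    using listed unfolding cat_listed_def by blast
  then show ?thesis
  proof cases
    case 1
    then obtain n where "a = [n]" by (auto simp: length_Suc_conv)
    then show ?thesis using cat_max_star[of n] a by (simp add: cat_param_def)
  next
    case 2
    then obtain p q where pq: "a = [p, q]" by (auto simp: length_Suc_conv eval_nat_numeral)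
    have pos: "1 \<le> p" "1 \<le> q" using a pq by (simp_all add: cat_param_def)
    have prod: "(int p - 1) * (int q - 1) < 4" using 2 pq by simp
    consider "p = 1" | "q = 1" | "2 \<le> p" "2 \<le> q" using pos by linarith
    then show ?thesis
    proof cases
      case 1
      then show ?thesis using cat_max_two_neg pq by simp
    next
      case 2
      then have "cat_max (rev a) < 0" using cat_max_two_neg[of p] pq by simp
      then show ?thesis using cat_max_rev[OF a] by simp
    next
      case 3
      \<comment> \<open>With both entries at least 3 the product is already 4. So one entry is 2,
        and then the other is at most 4.\<close>
      have "\<not> (3 \<le> p \<and> 3 \<le> q)"
        using prod mult_mono[of 2 "int p - 1" 2 "int q - 1"] by auto
      then have "p = 2 \<or> q = 2" using 3 by linarith
      then have "coord_le a [2, 4] \<or> coord_le (rev a) [2, 4]" using prod pq by auto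
      moreover have "cat_max [2, 4] < 0"
        using cat_negative_certs[of "[2, 4]"] by (simp add: cat_negative_certs_def sgn_1_neg)
      ultimately show ?thesis using dom by blast
    qed
  next
    case 3
    then show ?thesis using dom max_params_max by blast
  next
    case 12
    \<comment> \<open>The comparison list has eigenvalue 0 and differs from \<open>a\<close>. If
      \<open>a\<close> were nonnegative, strict monotonicity would make the comparison list
      positive.\<close>
    let ?c = "end_params (length a) 3 3"
    have len: "2 \<le> length a" using 12 by simp
    have nth: "a ! i = (if i = 0 then p else if i = length a - 1 then q else 0)" if "i < length a" for i
      using end_params_nth[OF len that, of p q] 12(2) by simp
    have le: "coord_le a ?c"
      unfolding list_all2_conv_all_nth using len nth 12 by (auto simp: end_params_nth)
    have ne: "a \<noteq> []" using len by auto
    have neq: "?c \<noteq> a"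
    proof
      assume "?c = a"
      then have "a ! 0 = 3" "a ! (length a - 1) = 3"
        using end_params_nth[OF len, of 0 3 3] end_params_nth[OF len, of "length a - 1" 3 3] len ne by auto
      then show False using nth[of 0] nth[of "length a - 1"] 12(1,7) ne by auto
    qed
    show ?thesis
      using cat_max_mono[OF a le] neq cat_max_end_params_3_3[OF len] by fastforce
  qed
qed

lemma cat_not_listed_nonneg:
  assumes a: "cat_param a" and nl: "\<not> cat_listed a"
  shows "cat_nonneg a"
proof (cases "12 \<le> length a")
  case True
  then show ?thesis using cat_nonneg_long a nl by blast
next
  case False
  have dom: "cat_nonneg a" if "\<exists>c\<in>C. coord_le c a \<or> coord_le c (rev a)" "\<forall>c\<in>C. cat_param c \<and> cat_nonneg c" for C
    using that cat_nonneg_dominates[OF a] by blast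
  have ne: "length a \<noteq> 0" "length a \<noteq> 1" using a nl by (auto simp: cat_param_def cat_listed_def)
  have nl': "\<forall>b\<in>max_params (length a). \<not> coord_le a b \<and> \<not> coord_le (rev a) b" if "3 \<le> length a"
    using nl that False unfolding cat_listed_def by auto
  have zero: "cat_nonneg c" if "c \<in> zero_params \<or> rev c \<in> zero_params" for c
    using that by (auto simp: cat_nonneg_def cat_zero_def)
  have zero33: "cat_nonneg (3 # replicate k 0 @ [3])" for k
  proof -
    have "3 # replicate k 0 @ [3] = end_params (k + 2) 3 3" by (simp add: end_params_def)
    then show ?thesis unfolding cat_nonneg_def cat_zero_def by (metis le_add2)
  qed
  have z33: "cat_nonneg [3, 0, 3]" "cat_nonneg [3, 0, 0, 3]" "cat_nonneg [3, 0, 0, 0, 3]"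
      "cat_nonneg [3, 0, 0, 0, 0, 3]" "cat_nonneg [3, 0, 0, 0, 0, 0, 3]" "cat_nonneg [3, 0, 0,
      0, 0, 0, 0, 3]" "cat_nonneg [3, 0, 0, 0, 0, 0, 0, 0, 3]" "cat_nonneg [3, 0, 0, 0, 0, 0, 0,
      0, 0, 3]" "cat_nonneg [3, 0, 0, 0, 0, 0, 0, 0, 0, 0, 3]"
    using zero33[of 1] zero33[of 2] zero33[of 3] zero33[of 4] zero33[of 5] zero33[of 6]
        zero33[of 7] zero33[of 8] zero33[of 9] by (simp_all add: eval_nat_numeral)
  have mid: "a ! i = 0" if "\<not> cat_nonneg a" "7 \<le> length a" "2 \<le> i" "i + 3 \<le> length a" for i
    using cat_nonneg_interior[OF a] that by fastforce
  note known = cat_nonneg_positive_table[unfolded cat_positive_certs_def, simplified] z33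
  have "length a = 2 \<or> length a = 3 \<or> length a = 4 \<or> length a = 5 \<or> length a = 6
      \<or> length a = 7 \<or> length a = 8 \<or> length a = 9 \<or> length a = 10 \<or> length
      a = 11"
    using ne False by presburger
  then consider "length a = 2" | "length a = 3" | "length a = 4" | "length a = 5" | "length a =
      6" | "length a = 7" | "length a = 8" | "length a = 9" | "length a = 10" | "length a = 11"
    by blast
  then show ?thesis
  proof cases
    case 1
    then obtain p q where pq: "a = [p, q]" by (auto simp: length_Suc_conv eval_nat_numeral)
    have pos: "1 \<le> p" "1 \<le> q" using a pq by (simp_all add: cat_param_def)
    have prod: "\<not> (int p - 1) * (int q - 1) < 4" using nl pq by (simp add: cat_listed_def)
    have "p \<noteq> 1" "q \<noteq> 1" using prod by auto
    moreover have "5 \<le> q" if "p = 2" using prod that by simp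
    moreover have "5 \<le> p" if "q = 2" using prod that by simp
    ultimately have "(3 \<le> p \<and> 3 \<le> q) \<or> (2 \<le> p \<and> 5 \<le> q) \<or> (5 \<le> p \<and> 2 \<le> q)" using pos by linarith
    \<comment> \<open>Up to reversal these are the minimal solutions of (p - 1)(q - 1) \<ge> 4 in
      positive integers, and both have eigenvalue 0.\<close>
    then have "\<exists>c\<in>{[3, 3], [2, 5]}. coord_le c a \<or> coord_le c (rev a)" using pq by auto
    then show ?thesis
      by (rule dom) (use zero33[of 0] zero[of "[2, 5]"] in \<open>simp add: zero_params_def cat_param_def\<close>)
  next
    case 2
    have nl: "\<forall>b\<in>max_params 3. \<not> coord_le a b \<and> \<not> coord_le (rev a) b" using nl' 2 by simp
    show ?thesis
      by (rule dom[OF nonneg_dominates_3[OF 2 a nl]])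
         (simp add: known zero zero_params_def cat_param_def)
  next
    case 3
    have nl: "\<forall>b\<in>max_params 4. \<not> coord_le a b \<and> \<not> coord_le (rev a) b" using nl' 3 by simp
    show ?thesis
      by (rule dom[OF nonneg_dominates_4[OF 3 a nl]])
         (simp add: known zero zero_params_def cat_param_def)
  next
    case 4
    have nl: "\<forall>b\<in>max_params 5. \<not> coord_le a b \<and> \<not> coord_le (rev a) b" using nl' 4 by simp
    show ?thesis
      by (rule dom[OF nonneg_dominates_5[OF 4 a nl]])
         (simp add: known zero zero_params_def cat_param_def)
  next
    case 5
    have nl: "\<forall>b\<in>max_params 6. \<not> coord_le a b \<and> \<not> coord_le (rev a) b" using nl' 5 by simp
    show ?thesis
      by (rule dom[OF nonneg_dominates_6[OF 5 a nl]])
         (simp add: known zero zero_params_def cat_param_def)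
  next
    case 6
    have nl: "\<forall>b\<in>max_params 7. \<not> coord_le a b \<and> \<not> coord_le (rev a) b" using nl' 6 by simp
    show ?thesis
    proof (rule ccontr)
      \<comment> \<open>Arguing by contradiction makes \<open>mid\<close> available: the interior
        entries are known to vanish only when \<open>a\<close> is not already covered by a
        spider.\<close>
      assume neg: "\<not> cat_nonneg a"
      have "cat_nonneg a"
        by (rule dom, rule nonneg_dominates_7[OF 6 a nl])
           (use mid[OF neg] 6 in simp, simp add: known zero zero_params_def cat_param_def)
      then show False using neg by simp
    qed
  next
    case 7
    have nl: "\<forall>b\<in>max_params 8. \<not> coord_le a b \<and> \<not> coord_le (rev a) b" using nl' 7 by simp
    show ?thesis
    proof (rule ccontr)
      assume neg: "\<not> cat_nonneg a"
      have "cat_nonneg a"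
        by (rule dom, rule nonneg_dominates_8[OF 7 a nl])
           (use mid[OF neg] 7 in simp, simp add: known zero zero_params_def cat_param_def)
      then show False using neg by simp
    qed
  next
    case 8
    have nl: "\<forall>b\<in>max_params 9. \<not> coord_le a b \<and> \<not> coord_le (rev a) b" using nl' 8 by simp
    show ?thesis
    proof (rule ccontr)
      assume neg: "\<not> cat_nonneg a"
      have "cat_nonneg a"
        by (rule dom, rule nonneg_dominates_9[OF 8 a nl])
           (use mid[OF neg] 8 in simp, simp add: known zero zero_params_def cat_param_def)
      then show False using neg by simp
    qed
  next
    case 9
    have nl: "\<forall>b\<in>max_params 10. \<not> coord_le a b \<and> \<not> coord_le (rev a) b" using nl' 9 by simp
    show ?thesis
    proof (rule ccontr)
      assume neg: "\<not> cat_nonneg a"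
      have "cat_nonneg a"
        by (rule dom, rule nonneg_dominates_10[OF 9 a nl])
           (use mid[OF neg] 9 in simp, simp add: known zero zero_params_def cat_param_def)
      then show False using neg by simp
    qed
  next
    case 10
    have nl: "\<forall>b\<in>max_params 11. \<not> coord_le a b \<and> \<not> coord_le (rev a) b" using nl' 10 by simp
    show ?thesis
    proof (rule ccontr)
      assume neg: "\<not> cat_nonneg a"
      have "cat_nonneg a"
        by (rule dom, rule nonneg_dominates_11[OF 10 a nl])
           (use mid[OF neg] 10 in simp, simp add: known zero zero_params_def cat_param_def)
      then show False using neg by simp
    qed
  qed
qed

lemma cat_max_neg_iff:
  assumes "cat_param a"
  shows "cat_max a < 0 \<longleftrightarrow> cat_listed a"
  using cat_listed_neg[OF assms] cat_not_listed_nonneg[OF assms] cat_nonneg_ge[of a] by fastforce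

text \<open>A list outside the negative region is strictly positive or an explicit zero case, since
  \<open>cat_nonneg\<close> keeps the two apart. No further analysis of equality is left.\<close>

lemma cat_max_zero_iff:
  assumes "cat_param a"
  shows "cat_max a = 0 \<longleftrightarrow> cat_zero a"
  using cat_listed_neg[OF assms] cat_not_listed_nonneg[OF assms] cat_zero_max[of a]
  by (cases "cat_listed a") (auto simp: cat_nonneg_def)

theorem theorem1p1:
  fixes V :: "'a set" and E :: "'a set set"
  assumes tree: "finite_tree V E" and edge: "E \<noteq> {}"
  shows
    "((\<exists>w \<kappa>. einstein_metric E w \<kappa>) \<and>
      (\<forall>w \<kappa>. einstein_metric E w \<kappa> \<longrightarrow> (\<kappa> > 0 \<longleftrightarrow> lambda_max (ricci_matrix E) < 0)) \<and>
      (lambda_max (ricci_matrix E) < 0 \<longrightarrow> is_caterpillar V E))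
     \<and>
     (\<forall>a. iso_caterpillar V E a \<longrightarrow>
       (lambda_max (ricci_matrix E) < 0 \<longleftrightarrow>
          length a = 1
        \<or> (length a = 2 \<and> (int (a ! 0) - 1) * (int (a ! 1) - 1) < 4)
        \<or> (3 \<le> length a \<and> length a \<le> 11 \<and>
            (\<exists>b\<in>max_params (length a). coord_le a b \<or> coord_le (rev a) b))
        \<or> (12 \<le> length a \<and>
            (\<exists>p q. a = end_params (length a) p q \<and>
               1 \<le> p \<and> p \<le> 3 \<and> 1 \<le> q \<and> q \<le> 3 \<and> (p, q) \<noteq> (3, 3)))))
     \<and>
     (lambda_max (ricci_matrix E) = 0 \<longleftrightarrow>
        graph_iso V E S32_verts S32_edges
      \<or> (\<exists>m\<ge>2. iso_caterpillar V E (end_params m 3 3))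
      \<or> (\<exists>a. iso_caterpillar V E a \<and> (a \<in> zero_params \<or> rev a \<in> zero_params)))"
proof -
  have G: "conn_graph V E" and sg: "simple_graph V E"
    using tree by (auto simp: finite_tree_conn_graph finite_tree_def)
  have cat: "cat_param a \<and> ricci_max E = cat_max a" if "iso_caterpillar V E a" for a
    using cat_max_iso[OF G edge that] that by (simp add: iso_caterpillar_def)
  have nc: "ricci_max E > 0 \<or> graph_iso V E S32_verts S32_edges" if "\<not> is_caterpillar V E"
    using non_caterpillar_sign[OF tree edge that] .
  have S32: "ricci_max E = 0" if "graph_iso V E S32_verts S32_edges"
    using ricci_max_iso[OF G edge simple_graph_S32 that] ricci_max_S32 by simp
  have "\<kappa> > 0 \<longleftrightarrow> ricci_max E < 0" if "einstein_metric E w \<kappa>" for w \<kappa>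
    using einstein_curvature[OF G edge that] by simp
  \<comment> \<open>A tree that is no caterpillar is either positive or the subdivided star itself,
    whose eigenvalue is 0; neither is negative.\<close>
  moreover have "is_caterpillar V E" if "ricci_max E < 0"
    using nc S32 that by fastforce
  moreover have "ricci_max E < 0 \<longleftrightarrow> cat_listed a" if "iso_caterpillar V E a" for a
    using cat[OF that] cat_max_neg_iff[of a] by simp
  moreover have "ricci_max E = 0 \<longleftrightarrow>
        graph_iso V E S32_verts S32_edges
      \<or> (\<exists>m\<ge>2. iso_caterpillar V E (end_params m 3 3))
      \<or> (\<exists>a. iso_caterpillar V E a \<and> (a \<in> zero_params \<or> rev a \<in> zero_params))" (is "_ \<longleftrightarrow> ?R")
  proof
    assume zero: "ricci_max E = 0"
    show ?R
    proof (cases "is_caterpillar V E")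
      case True
      then obtain a where a: "iso_caterpillar V E a" by (auto simp: is_caterpillar_def)
      then have "cat_zero a" using cat[OF a] cat_max_zero_iff[of a] zero by simp
      then show ?thesis using a unfolding cat_zero_def by blast
    qed (use nc zero in auto)
  next
    assume ?R
    then consider "graph_iso V E S32_verts S32_edges" | a where "iso_caterpillar V E a" "cat_zero a"
      unfolding cat_zero_def by blast
    then show "ricci_max E = 0"
      using S32 cat cat_zero_max by cases auto
  qed
  ultimately show ?thesis
    using ex_einstein_metric[OF G edge] unfolding cat_listed_def by blast
qed

end
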